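(* Let $n\ge4$. Consider an $n$-dimensional spherically symmetric spacetime $$ds^2=g_{AB}(y)\,dy^Ady^B+r^2(y)\,\gamma_{ij}(z)\,dz^idz^j$$ satisfying $(Dr)^2:=g^{AB}(\partial_Ar)(\partial_Br)\ne0$, in the system with action $$S=\int d^nx\sqrt{-g}\Bigl(\tfrac12R-\beta\,\mathcal L(X)\Bigr),\qquad X:=\alpha F_{\rho\sigma}F^{\rho\sigma},$$ where the gauge field has the form $A_\mu dx^\mu=A_B(y)\,dy^B+A_i(z)\,dz^i$. Suppose that the algebraic equation $\mathcal L_{,X}(X)=0$ does not admit any real solution. Then the general solution for $n\ge5$ is $$ds^2=-f(r)\,dt^2+f(r)^{-1}dr^2+r^2\gamma_{ij}\,dz^idz^j,$$ $$f(r)=1-\frac{2\bar M}{r^{n-3}}-\frac{8\beta}{(n-2)r^{n-3}}\int^r x^{n-2}\Bigl(\alpha\,\mathcal L_{,X}F_{tr}^2+\tfrac14\mathcal L\Bigr)dx,\qquad F_{\mu\nu}dx^\mu\wedge dx^\nu=2F_{tr}\,dt\wedge dr,$$ where $\bar M$ is a constant and $F_{tr}(r)$ is determined algebraically by $$\mathcal L_{,X}F_{tr}=\frac{Q_e}{r^{n-2}},\qquad X=-2\alpha F_{tr}^2$$ with an arbitrary constant $Q_e$. The general solution for $n=4$ is $$ds^2=-f(r)\,dt^2+f(r)^{-1}dr^2+r^2(d\theta^2+\sin^2\theta\, d\phi^2),$$ $$F_{\mu\nu}dx^\mu\wedge dx^\nu=2F_{tr}\,dt\wedge dr+2Q_m\sin\theta\,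 d\theta\wedge d\phi,$$ where $$f(r)=1-\frac{2\bar M}{r}-\frac{4\beta}{r}\int^r x^{2}\Bigl(\alpha\,\mathcal L_{,X}F_{tr}^2+\tfrac14\mathcal L\Bigr)dx$$ with a constant $\bar M$, and $F_{tr}(r)$ is determined algebraically by $$\mathcal L_{,X}F_{tr}=\frac{Q_e}{r^2},\qquad X=-2\alpha\bigl(F_{tr}^2-Q_m^2r^{-4}\bigr)$$ with arbitrary constants $Q_e$ and $Q_m$.
   Context: $A,B\in\{0,1\}$, $i,j\in\{2,\dots,n-1\}$; $g_{AB}$ is a two-dimensional Lorentzian metric, $r(y)$ a scalar, $\gamma_{ij}$ the metric of the unit sphere $S^{n-2}$. $F_{\mu\nu}=\partial_\mu A_\nu-\partial_\nu A_\mu$ is the Faraday tensor, so $F_{\mu\nu}dx^\mu\wedge dx^\nu=F_{AB}(y)dy^A\wedge dy^B+F_{ij}(z)dz^i\wedge dz^j$; $F_{ij}$ is a globally defined closed two-form on $S^{n-2}$ (the potential $A_i$ may be only locally defined). $\alpha,\beta$ are non-zero constants and $\mathcal L$ is a non-constant (sufficiently smooth) function of $X$, with $\mathcal L_{,X}=d\mathcal L/dX$. The field equations are $G_{\mu\nu}=T_{\mu\nu}$ with $T_{\mu\nu}=4\beta\bigl(\alpha\mathcal L_{,X}F_{\mu\rho}F_\nu{}^\rho-\tfrac14g_{\mu\nu}\mathcal L\bigr)$, and $\nabla_\nu(\mathcal L_{,X}F^{\mu\nu})=0$. "General solution" means that, locally in coordinates using $r$ as a coordinate, every solution has the given form for some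 values of the constants, and conversely. The integral denotes a fixed primitive (its additive constant is absorbed in $\bar M$), the integrand being evaluated at radius $x$. *)

theory Defs
  imports "HOL-Analysis.Analysis" "HOL-Library.Extended_Nat"
begin

section \<open>Partial derivatives and regularity classes\<close>

definition pd :: "'i::finite \<Rightarrow> (real^'i \<Rightarrow> 'b::real_normed_vector) \<Rightarrow> real^'i \<Rightarrow> 'b" where
  "pd i f x = frechet_derivative f (at x) (axis i 1)"

primrec Ck_nat :: "nat \<Rightarrow> (real^'i::finite) set \<Rightarrow> (real^'i \<Rightarrow> real) \<Rightarrow> bool" where
  "Ck_nat 0 S f \<longleftrightarrow> continuous_on S f"
| "Ck_nat (Suc k) S f \<longleftrightarrow> f differentiable_on S \<and> (\<forall>i. Ck_nat k S (pd i f))"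

text \<open>Only used for open \<open>S\<close>; the value \<open>k = \<infinity>\<close> gives the smooth functions.\<close>

definition Ck :: "enat \<Rightarrow> (real^'i::finite) set \<Rightarrow> (real^'i \<Rightarrow> real) \<Rightarrow> bool" where
  "Ck k S f \<longleftrightarrow> (\<forall>m. enat m \<le> k \<longrightarrow> Ck_nat m S f)"


section \<open>Curvature of a metric given by its components in a coordinate system\<close>

text \<open>A covariant or contravariant tensor field of rank two on a coordinate domain is the function
  assigning to a point the matrix of its components.\<close>

type_synonym 'i tensor2 = "real^'i \<Rightarrow> real^'i^'i"

definition christoffel :: "'i::finite tensor2 \<Rightarrow> 'i \<Rightarrow> 'i \<Rightarrow> 'i \<Rightarrow> real^'i \<Rightarrow> real" where
  "christoffel g \<kappa> \<mu> \<nu> x =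
     (\<Sum>\<sigma>\<in>UNIV. 1/2 * matrix_inv (g x) $ \<kappa> $ \<sigma> *
        (pd \<mu> (\<lambda>x. g x $ \<sigma> $ \<nu>) x + pd \<nu> (\<lambda>x. g x $ \<mu> $ \<sigma>) x - pd \<sigma> (\<lambda>x. g x $ \<mu> $ \<nu>) x))"

text \<open>\<open>riemann g \<rho> \<sigma> \<mu> \<nu>\<close> is the component with \<open>\<rho>\<close> raised,
  with the sign convention that makes round spheres positively curved.\<close>

definition riemann :: "'i::finite tensor2 \<Rightarrow> 'i \<Rightarrow> 'i \<Rightarrow> 'i \<Rightarrow> 'i \<Rightarrow> real^'i \<Rightarrow> real" where
  "riemann g \<rho> \<sigma> \<mu> \<nu> x =
     pd \<mu> (christoffel g \<rho> \<nu> \<sigma>) x - pd \<nu> (christoffel g \<rho> \<mu> \<sigma>) x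
     + (\<Sum>\<kappa>\<in>UNIV. christoffel g \<rho> \<mu> \<kappa> x * christoffel g \<kappa> \<nu> \<sigma> x
                 - christoffel g \<rho> \<nu> \<kappa> x * christoffel g \<kappa> \<mu> \<sigma> x)"

definition ricci :: "'i::finite tensor2 \<Rightarrow> 'i tensor2" where
  "ricci g x = (\<chi> \<mu> \<nu>. \<Sum>\<rho>\<in>UNIV. riemann g \<rho> \<mu> \<rho> \<nu> x)"

definition scalar_curvature :: "'i::finite tensor2 \<Rightarrow> real^'i \<Rightarrow> real" where
  "scalar_curvature g x = (\<Sum>\<mu>\<in>UNIV. \<Sum>\<nu>\<in>UNIV. matrix_inv (g x) $ \<mu> $ \<nu> * ricci g x $ \<mu> $ \<nu>)"

definition einstein :: "'i::finite tensor2 \<Rightarrow> 'i tensor2" where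
  "einstein g x = ricci g x - (1/2 * scalar_curvature g x) *\<^sub>R g x"

definition raise_both :: "'i::finite tensor2 \<Rightarrow> 'i tensor2 \<Rightarrow> 'i tensor2" where
  "raise_both g H x = (\<chi> \<mu> \<nu>. \<Sum>\<rho>\<in>UNIV. \<Sum>\<sigma>\<in>UNIV.
     matrix_inv (g x) $ \<mu> $ \<rho> * matrix_inv (g x) $ \<nu> $ \<sigma> * H x $ \<rho> $ \<sigma>)"

text \<open>The contraction over \<open>\<nu>\<close> of the covariant derivative of a contravariant tensor field
  \<open>H\<^sup>\<mu>\<^sup>\<nu>\<close>.\<close>

definition covariant_divergence :: "'i::finite tensor2 \<Rightarrow> 'i tensor2 \<Rightarrow> 'i \<Rightarrow> real^'i \<Rightarrow> real" where
  "covariant_divergence g H \<mu> x =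
     (\<Sum>\<nu>\<in>UNIV. pd \<nu> (\<lambda>x. H x $ \<mu> $ \<nu>) x
        + (\<Sum>\<kappa>\<in>UNIV. christoffel g \<mu> \<nu> \<kappa> x * H x $ \<kappa> $ \<nu> + christoffel g \<nu> \<nu> \<kappa> x * H x $ \<mu> $ \<kappa>))"


section \<open>Nonlinear electrodynamics\<close>

definition em_invariant :: "real \<Rightarrow> 'i::finite tensor2 \<Rightarrow> 'i tensor2 \<Rightarrow> real^'i \<Rightarrow> real" where
  "em_invariant \<alpha> g F x = \<alpha> * (\<Sum>\<rho>\<in>UNIV. \<Sum>\<sigma>\<in>UNIV. F x $ \<rho> $ \<sigma> * raise_both g F x $ \<rho> $ \<sigma>)"

definition stress_energy ::
    "real \<Rightarrow> real \<Rightarrow> (real \<Rightarrow> real) \<Rightarrow> 'i::finite tensor2 \<Rightarrow> 'i tensor2 \<Rightarrow> 'i tensor2" where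
  "stress_energy \<alpha> \<beta> L g F x = (\<chi> \<mu> \<nu>. 4 * \<beta> *
     (\<alpha> * deriv L (em_invariant \<alpha> g F x) *
        (\<Sum>\<rho>\<in>UNIV. \<Sum>\<sigma>\<in>UNIV. F x $ \<mu> $ \<rho> * matrix_inv (g x) $ \<rho> $ \<sigma> * F x $ \<nu> $ \<sigma>)
      - 1/4 * g x $ \<mu> $ \<nu> * L (em_invariant \<alpha> g F x)))"

definition field_equations_at ::
    "real \<Rightarrow> real \<Rightarrow> (real \<Rightarrow> real) \<Rightarrow> 'i::finite tensor2 \<Rightarrow> 'i tensor2 \<Rightarrow> real^'i \<Rightarrow> bool" where
  "field_equations_at \<alpha> \<beta> L g F x \<longleftrightarrow>
     einstein g x = stress_energy \<alpha> \<beta> L g F x \<and>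
     (\<forall>\<mu>. covariant_divergence g
            (\<lambda>x. deriv L (em_invariant \<alpha> g F x) *\<^sub>R raise_both g F x) \<mu> x = 0)"


section \<open>The unit sphere\<close>

text \<open>The unit sphere of dimension \<open>CARD('m)\<close> lives in \<open>real^'m \<times> real\<close>. Its atlas consists of the
  inverses of the two stereographic projections, from the north pole (\<open>s = 1\<close>) and from the south
  pole (\<open>s = -1\<close>).\<close>

definition stereo :: "real \<Rightarrow> real^'m::finite \<Rightarrow> (real^'m) \<times> real" where
  "stereo s z = ((2 / (z \<bullet> z + 1)) *\<^sub>R z, s * (z \<bullet> z - 1) / (z \<bullet> z + 1))"

definition sphere_metric :: "real \<Rightarrow> 'm::finite tensor2" where
  "sphere_metric s z = (\<chi> i j. pd i (stereo s) z \<bullet> pd j (stereo s) z)"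

text \<open>A two-form on the sphere is represented by alternating bilinear forms on the ambient space, of
  which only the restrictions to the tangent spaces matter.\<close>

type_synonym 'm sphere_form =
  "(real^'m) \<times> real \<Rightarrow> (real^'m) \<times> real \<Rightarrow> (real^'m) \<times> real \<Rightarrow> real"

definition sphere_form_comp :: "'m::finite sphere_form \<Rightarrow> real \<Rightarrow> 'm tensor2" where
  "sphere_form_comp \<omega> s z = (\<chi> i j. \<omega> (stereo s z) (pd i (stereo s) z) (pd j (stereo s) z))"

definition closed_two_form_on_sphere :: "enat \<Rightarrow> 'm::finite sphere_form \<Rightarrow> bool" where
  "closed_two_form_on_sphere k \<omega> \<longleftrightarrow>
     (\<forall>p\<in>sphere 0 1. bilinear (\<omega> p) \<and> (\<forall>u. \<omega> p u u = 0)) \<and>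
     (\<forall>s\<in>{1, -1}.
        (\<forall>i j. Ck k UNIV (\<lambda>z. sphere_form_comp \<omega> s z $ i $ j)) \<and>
        (\<forall>i j l z. pd i (\<lambda>z. sphere_form_comp \<omega> s z $ j $ l) z
                 + pd j (\<lambda>z. sphere_form_comp \<omega> s z $ l $ i) z
                 + pd l (\<lambda>z. sphere_form_comp \<omega> s z $ i $ j) z = 0))"

definition vanishes_on_sphere :: "'m::finite sphere_form \<Rightarrow> bool" where
  "vanishes_on_sphere \<omega> \<longleftrightarrow>
     (\<forall>p\<in>sphere 0 1. \<forall>u v. u \<bullet> p = 0 \<longrightarrow> v \<bullet> p = 0 \<longrightarrow> \<omega> p u v = 0)"

text \<open>Polar coordinates on the two-sphere; \<open>e1\<close> and \<open>e2\<close> are the two elements of the index type.\<close>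

definition polar :: "'m::finite \<Rightarrow> 'm \<Rightarrow> real \<Rightarrow> real \<Rightarrow> (real^'m) \<times> real" where
  "polar e1 e2 \<theta> \<phi> =
     (axis e1 (sin \<theta> * cos \<phi>) + axis e2 (sin \<theta> * sin \<phi>), cos \<theta>)"

abbreviation polar_dtheta :: "'m::finite \<Rightarrow> 'm \<Rightarrow> real \<Rightarrow> real \<Rightarrow> (real^'m) \<times> real" where
  "polar_dtheta e1 e2 \<theta> \<phi> \<equiv> vector_derivative (\<lambda>s. polar e1 e2 s \<phi>) (at \<theta>)"

abbreviation polar_dphi :: "'m::finite \<Rightarrow> 'm \<Rightarrow> real \<Rightarrow> real \<Rightarrow> (real^'m) \<times> real" where
  "polar_dphi e1 e2 \<theta> \<phi> \<equiv> vector_derivative (\<lambda>s. polar e1 e2 \<theta> s) (at \<phi>)"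

text \<open>The form \<open>Q sin \<theta> d\<theta> \<and> d\<phi>\<close>; by continuity the component in polar coordinates
  also determines a continuous form at the poles.\<close>

definition is_monopole_form :: "'m::finite \<Rightarrow> 'm \<Rightarrow> real \<Rightarrow> 'm sphere_form \<Rightarrow> bool" where
  "is_monopole_form e1 e2 Q \<omega> \<longleftrightarrow>
     (\<forall>\<theta>\<in>{0<..<pi}. \<forall>\<phi>.
        \<omega> (polar e1 e2 \<theta> \<phi>) (polar_dtheta e1 e2 \<theta> \<phi>) (polar_dphi e1 e2 \<theta> \<phi>) = Q * sin \<theta>)"

lemma stereo_in_sphere:
  assumes "s \<in> {1, -1}"
  shows "stereo s z \<in> sphere 0 1"
proof -
  have pos: "z \<bullet> z + 1 > 0"
    by (simp add: add_nonneg_pos)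
  have s2: "s * s = 1"
    using assms by auto
  define q where "q = z \<bullet> z"
  have "stereo s z \<bullet> stereo s z
      = (2 / (q + 1)) * (2 / (q + 1)) * q + (s * s) * ((q - 1) / (q + 1)) * ((q - 1) / (q + 1))"
    by (simp add: stereo_def q_def)
  also have "\<dots> = (4 * q + (q - 1) * (q - 1)) / ((q + 1) * (q + 1))"
    by (simp add: s2 add_divide_distrib)
  also have "4 * q + (q - 1) * (q - 1) = (q + 1) * (q + 1)"
    by (simp add: algebra_simps)
  finally have "stereo s z \<bullet> stereo s z = 1"
    using pos by (simp add: q_def)
  then show ?thesis
    by (simp add: norm_eq_sqrt_inner)
qed

lemma polar_has_vector_derivative:
  "((\<lambda>s. polar e1 e2 s \<phi>) has_vector_derivative
     (axis e1 (cos \<theta> * cos \<phi>) + axis e2 (cos \<theta> * sin \<phi>), - sin \<theta>)) (at \<theta>)"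
  "((\<lambda>s. polar e1 e2 \<theta> s) has_vector_derivative
     (axis e1 (- sin \<theta> * sin \<phi>) + axis e2 (sin \<theta> * cos \<phi>), 0)) (at \<phi>)"
proof -
  have ax: "((\<lambda>s. axis i (h s)) has_vector_derivative axis i h') (at x)"
    if "(h has_real_derivative h') (at x)" for i :: 'a and h :: "real \<Rightarrow> real" and h' x
  proof -
    have eq: "axis i c = c *\<^sub>R axis i (1::real)" for c :: real
      by (simp add: axis_def vec_eq_iff)
    show ?thesis
      unfolding eq[of "h _"] eq[of h']
      using has_vector_derivative_scaleR[OF that has_vector_derivative_const] by simp
  qed
  have d: "((\<lambda>s. sin s * c) has_real_derivative cos x * c) (at x)"
    "((\<lambda>s. c * cos s) has_real_derivative - c * sin x) (at x)"
    "((\<lambda>s. c * sin s) has_real_derivative c * cos x) (at x)"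
    "(cos has_vector_derivative - sin x) (at x)" for c x :: real
    by (auto intro!: derivative_eq_intros
        simp: has_real_derivative_iff_has_vector_derivative[symmetric])
  show "((\<lambda>s. polar e1 e2 s \<phi>) has_vector_derivative
     (axis e1 (cos \<theta> * cos \<phi>) + axis e2 (cos \<theta> * sin \<phi>), - sin \<theta>)) (at \<theta>)"
    unfolding polar_def
    by (intro has_vector_derivative_Pair has_vector_derivative_add ax d)
  show "((\<lambda>s. polar e1 e2 \<theta> s) has_vector_derivative
     (axis e1 (- sin \<theta> * sin \<phi>) + axis e2 (sin \<theta> * cos \<phi>), 0)) (at \<phi>)"
    unfolding polar_def
    by (intro has_vector_derivative_Pair has_vector_derivative_add has_vector_derivative_const ax d)
qed

text \<open>In polar coordinates the metric of the unit two-sphere is \<open>d\<theta>\<^sup>2 + sin\<^sup>2 \<theta> d\<phi>\<^sup>2\<close>.\<close>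

lemma polar_metric:
  assumes "e1 \<noteq> e2"
  shows "polar_dtheta e1 e2 \<theta> \<phi> \<bullet> polar_dtheta e1 e2 \<theta> \<phi> = 1"
    and "polar_dtheta e1 e2 \<theta> \<phi> \<bullet> polar_dphi e1 e2 \<theta> \<phi> = 0"
    and "polar_dphi e1 e2 \<theta> \<phi> \<bullet> polar_dphi e1 e2 \<theta> \<phi> = (sin \<theta>)\<^sup>2"
proof -
  have ip: "(axis e1 a + axis e2 b) \<bullet> (axis e1 c + axis e2 d) = a * c + b * d" for a b c d :: real
    using assms by (simp add: inner_add_left inner_add_right inner_axis_axis)
  note d = polar_has_vector_derivative[THEN vector_derivative_at]
  have sc: "sin a * sin a + cos a * cos a = 1" for a :: real
    using sin_cos_squared_add[of a] by (simp add: power2_eq_square)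
  show "polar_dtheta e1 e2 \<theta> \<phi> \<bullet> polar_dtheta e1 e2 \<theta> \<phi> = 1"
    unfolding d inner_Pair ip inner_real_def using sc[of \<theta>] sc[of \<phi>] by algebra
  show "polar_dtheta e1 e2 \<theta> \<phi> \<bullet> polar_dphi e1 e2 \<theta> \<phi> = 0"
    unfolding d inner_Pair ip inner_real_def by algebra
  show "polar_dphi e1 e2 \<theta> \<phi> \<bullet> polar_dphi e1 e2 \<theta> \<phi> = (sin \<theta>)\<^sup>2"
    unfolding d inner_Pair ip inner_real_def using sc[of \<phi>] by algebra
qed


section \<open>Spherically symmetric configurations\<close>

text \<open>Spacetime coordinates are indexed by \<open>2 + 'm\<close>: \<open>Inl A\<close> for the coordinates \<open>y\<close> of the
  two-dimensional part, \<open>Inr i\<close> for the coordinates \<open>z\<close> on the sphere. The elements of the type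
  \<open>2\<close> are \<open>0\<close> and \<open>1\<close>.\<close>

definition ypart :: "real^(2 + 'm::finite) \<Rightarrow> real^2" where
  "ypart x = (\<chi> A. x $ Inl A)"

definition zpart :: "real^(2 + 'm::finite) \<Rightarrow> real^'m" where
  "zpart x = (\<chi> i. x $ Inr i)"

definition block_tensor :: "real^2^2 \<Rightarrow> real^'m^'m \<Rightarrow> real^(2 + 'm::finite)^(2 + 'm)" where
  "block_tensor a b = (\<chi> \<mu> \<nu>. case (\<mu>, \<nu>) of
       (Inl A, Inl B) \<Rightarrow> a $ A $ B
     | (Inr i, Inr j) \<Rightarrow> b $ i $ j
     | _ \<Rightarrow> 0)"

definition spacetime_metric ::
    "2 tensor2 \<Rightarrow> (real^2 \<Rightarrow> real) \<Rightarrow> real \<Rightarrow> (2 + 'm::finite) tensor2" where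
  "spacetime_metric g r s x =
     block_tensor (g (ypart x)) ((r (ypart x))\<^sup>2 *\<^sub>R sphere_metric s (zpart x))"

definition faraday2 :: "(real^2 \<Rightarrow> real^2) \<Rightarrow> 2 tensor2" where
  "faraday2 a y = (\<chi> A B. pd A (\<lambda>y. a y $ B) y - pd B (\<lambda>y. a y $ A) y)"

definition faraday ::
    "(real^2 \<Rightarrow> real^2) \<Rightarrow> 'm::finite sphere_form \<Rightarrow> real \<Rightarrow> (2 + 'm) tensor2" where
  "faraday a \<omega> s x = block_tensor (faraday2 a (ypart x)) (sphere_form_comp \<omega> s (zpart x))"

definition lorentzian2 :: "real^2^2 \<Rightarrow> bool" where
  "lorentzian2 G \<longleftrightarrow> transpose G = G \<and>
     (\<exists>P :: real^2^2. invertible P \<and>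
        transpose P ** G ** P = (\<chi> A B. if A \<noteq> B then 0 else if A = 0 then -1 else 1))"

definition grad_square :: "2 tensor2 \<Rightarrow> (real^2 \<Rightarrow> real) \<Rightarrow> real^2 \<Rightarrow> real" where
  "grad_square g r y = (\<Sum>A\<in>UNIV. \<Sum>B\<in>UNIV. matrix_inv (g y) $ A $ B * pd A r y * pd B r y)"

text \<open>The data over the coordinate domain \<open>U\<close>: the metric \<open>g\<close>, the areal radius \<open>r\<close>, the
  components \<open>a\<close> of the gauge potential along the two-dimensional part, and the angular part \<open>\<omega>\<close> of
  the Faraday tensor. The angular potential need not exist globally and enters through \<open>\<omega>\<close> only.\<close>

definition configuration ::
    "enat \<Rightarrow> (real^2) set \<Rightarrow> 2 tensor2 \<Rightarrow> (real^2 \<Rightarrow> real) \<Rightarrow> (real^2 \<Rightarrow> real^2)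
      \<Rightarrow> 'm::finite sphere_form \<Rightarrow> bool" where
  "configuration k U g r a \<omega> \<longleftrightarrow>
     open U \<and>
     (\<forall>A B. Ck k U (\<lambda>y. g y $ A $ B)) \<and> (\<forall>y\<in>U. lorentzian2 (g y)) \<and>
     Ck (k + 1) U r \<and> (\<forall>y\<in>U. r y > 0) \<and>
     (\<forall>A. Ck (k + 1) U (\<lambda>y. a y $ A)) \<and>
     closed_two_form_on_sphere k \<omega>"

definition solution ::
    "real \<Rightarrow> real \<Rightarrow> (real \<Rightarrow> real) \<Rightarrow> (real^2) set \<Rightarrow> 2 tensor2 \<Rightarrow> (real^2 \<Rightarrow> real)
      \<Rightarrow> (real^2 \<Rightarrow> real^2) \<Rightarrow> 'm::finite sphere_form \<Rightarrow> bool" where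
  "solution \<alpha> \<beta> L U g r a \<omega> \<longleftrightarrow>
     (\<forall>s\<in>{1, -1}. \<forall>x. ypart x \<in> U \<longrightarrow>
        field_equations_at \<alpha> \<beta> L (spacetime_metric g r s) (faraday a \<omega> s) x)"


section \<open>The explicit solutions\<close>

definition coordinates_on :: "enat \<Rightarrow> (real^2) set \<Rightarrow> (real^2 \<Rightarrow> real) \<Rightarrow> (real^2 \<Rightarrow> real) \<Rightarrow> bool" where
  "coordinates_on k W t r \<longleftrightarrow>
     open W \<and> Ck k W t \<and> Ck k W r \<and> inj_on (\<lambda>y. (t y, r y)) W \<and>
     (\<forall>y\<in>W. pd 0 t y * pd 1 r y - pd 1 t y * pd 0 r y \<noteq> 0)"

text \<open>In the coordinates \<open>t, r\<close> on \<open>W\<close>, the two-dimensional metric is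
  \<open>- f(r) dt\<^sup>2 + f(r)\<^sup>-\<^sup>1 dr\<^sup>2\<close> and the two-dimensional part of the Faraday tensor is
  \<open>2 F\<^sub>t\<^sub>r dt \<and> dr\<close>, both pulled back to the coordinates \<open>y\<close>.\<close>

definition metric_has_form ::
    "(real^2) set \<Rightarrow> 2 tensor2 \<Rightarrow> (real^2 \<Rightarrow> real) \<Rightarrow> (real^2 \<Rightarrow> real) \<Rightarrow> (real \<Rightarrow> real) \<Rightarrow> bool" where
  "metric_has_form W g t r f \<longleftrightarrow>
     (\<forall>y\<in>W. f (r y) \<noteq> 0 \<and>
        (\<forall>A B. g y $ A $ B = - f (r y) * pd A t y * pd B t y + inverse (f (r y)) * pd A r y * pd B r y))"

definition faraday_has_form ::
    "(real^2) set \<Rightarrow> (real^2 \<Rightarrow> real^2) \<Rightarrow> (real^2 \<Rightarrow> real) \<Rightarrow> (real^2 \<Rightarrow> real) \<Rightarrow> (real \<Rightarrow> real) \<Rightarrow> bool"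
  where
  "faraday_has_form W a t r Ftr \<longleftrightarrow>
     (\<forall>y\<in>W. \<forall>A B. faraday2 a y $ A $ B = Ftr (r y) * (pd A t y * pd B r y - pd B t y * pd A r y))"

text \<open>The conditions on the metric function and on \<open>F\<^sub>t\<^sub>r\<close> over the range \<open>I\<close> of radii, where
  \<open>X\<close> is the invariant as a function of the radius. The primitive \<open>P\<close> stands for the indefinite
  integral, its additive constant being absorbed in \<open>M\<close>.\<close>

definition radial_profile ::
    "nat \<Rightarrow> real \<Rightarrow> real \<Rightarrow> (real \<Rightarrow> real) \<Rightarrow> real set \<Rightarrow> (real \<Rightarrow> real) \<Rightarrow> real \<Rightarrow> real
      \<Rightarrow> (real \<Rightarrow> real) \<Rightarrow> (real \<Rightarrow> real) \<Rightarrow> bool" where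
  "radial_profile n \<alpha> \<beta> L I X M Qe Ftr f \<longleftrightarrow>
     (\<forall>x\<in>I. deriv L (X x) * Ftr x = Qe / x ^ (n - 2)) \<and>
     (\<exists>P. \<forall>x\<in>I.
        (P has_real_derivative x ^ (n - 2) * (\<alpha> * deriv L (X x) * (Ftr x)\<^sup>2 + 1/4 * L (X x))) (at x) \<and>
        f x = 1 - 2 * M / x ^ (n - 3) - 8 * \<beta> / (real (n - 2) * x ^ (n - 3)) * P x)"

definition electric_form ::
    "enat \<Rightarrow> nat \<Rightarrow> real \<Rightarrow> real \<Rightarrow> (real \<Rightarrow> real) \<Rightarrow> (real^2) set \<Rightarrow> 2 tensor2 \<Rightarrow> (real^2 \<Rightarrow> real)
      \<Rightarrow> (real^2 \<Rightarrow> real^2) \<Rightarrow> 'm::finite sphere_form \<Rightarrow> bool" where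
  "electric_form k n \<alpha> \<beta> L W g r a \<omega> \<longleftrightarrow>
     (\<exists>t M Qe Ftr f l u.
        coordinates_on (k + 1) W t r \<and> r ` W = {l<..<u} \<and>
        radial_profile n \<alpha> \<beta> L {l<..<u} (\<lambda>x. - 2 * \<alpha> * (Ftr x)\<^sup>2) M Qe Ftr f \<and>
        metric_has_form W g t r f \<and> faraday_has_form W a t r Ftr \<and>
        vanishes_on_sphere \<omega>)"

definition dyonic_form ::
    "enat \<Rightarrow> 'm \<Rightarrow> 'm \<Rightarrow> real \<Rightarrow> real \<Rightarrow> (real \<Rightarrow> real) \<Rightarrow> (real^2) set \<Rightarrow> 2 tensor2
      \<Rightarrow> (real^2 \<Rightarrow> real) \<Rightarrow> (real^2 \<Rightarrow> real^2) \<Rightarrow> 'm::finite sphere_form \<Rightarrow> bool" where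
  "dyonic_form k e1 e2 \<alpha> \<beta> L W g r a \<omega> \<longleftrightarrow>
     (\<exists>t M Qe Qm Ftr f l u.
        coordinates_on (k + 1) W t r \<and> r ` W = {l<..<u} \<and>
        radial_profile 4 \<alpha> \<beta> L {l<..<u} (\<lambda>x. - 2 * \<alpha> * ((Ftr x)\<^sup>2 - Qm\<^sup>2 / x ^ 4)) M Qe Ftr f \<and>
        metric_has_form W g t r f \<and> faraday_has_form W a t r Ftr \<and>
        is_monopole_form e1 e2 Qm \<omega>)"

end

theory Submission
  imports Defs
begin

text \<open>
  The Einstein tensor of the warped product is expressed through the Hessian of \<open>r\<close> and the
  Gauss curvature of the two-dimensional metric. Since \<open>\<L>\<^sub>,\<^sub>X\<close> has no zero, the angular Einstein
  equations make the square of \<open>F\<^sub>i\<^sub>j\<close> a multiple of the sphere metric; differentiating the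
  Einstein equations along the sphere shows that \<open>\<bar>F\<^sub>i\<^sub>j\<bar>\<close> is constant, whence \<open>X\<close> does not
  depend on \<open>z\<close> and \<open>F\<^sub>i\<^sub>j\<close> is coclosed. A closed and coclosed two-form of constant norm vanishes
  on a sphere of dimension at least three by the Weitzenboeck formula, and is a multiple of the
  area form on the two-sphere. The remaining equations say that the Hessian of \<open>r\<close> is a multiple of
  the metric, so that the rotated gradient of \<open>r\<close> divided by \<open>(Dr)\<^sup>2\<close> is a closed one-form \<open>dt\<close>, and
  that the charge is conserved; in the coordinates \<open>t, r\<close> everything depends on \<open>r\<close> only.

  Conversely, for the explicit metric the Hessian of \<open>r\<close> is computed directly, the Gauss curvature
  follows from the Ricci identity for \<open>dr\<close>, and the angular Einstein equation is the radial derivative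
  of the \<open>tt\<close> equation combined with the Gauss law.
\<close>

section \<open>Partial derivatives\<close>

text \<open>\<open>deriv L\<close> has no zero, but nothing keeps \<open>L''\<close> away from zero,
  so the Gauss law cannot be solved for the field by an implicit function theorem. That the field
  depends on the radius alone, and that the angular norm is constant, is shown by contradiction
  instead: continuity spreads a failure at one point to an open set, relations valid on that set can
  be differentiated, and the degenerate relation found there determines the quantity in a way that
  contradicts the assumption. For the same reason the converse takes the derivative of
  \<open>F\<close> from the spacetime field \<open>\<phi>\<close>. The sign of
  \<open>(Dr)\<^sup>2\<close>, and hence of \<open>f\<close>, is not prescribed, so \<open>t\<close>
  is built as the potential of a closed form and not from a choice of timelike direction. Both
  directions share one description of the field equations, in which the sphere metric enters only
  through its stereographic conformal factor.\<close>

lemma two_eq_zero: "(2::2) = 0"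
  by simp

text \<open>Library facts enumerate the type \<open>2\<close> as \<open>1, 2\<close>, whereas the
  coordinates are numbered \<open>0, 1\<close>; the identity \<open>2 = 0\<close> moves between the
  two.\<close>

lemma sum_2': "sum h (UNIV::2 set) = h 0 + h 1"
  unfolding sum_2 two_eq_zero by (rule add.commute)

lemma forall_2': "(\<forall>A::2. P A) \<longleftrightarrow> P 0 \<and> P 1"
  unfolding forall_2 two_eq_zero by blast

lemma exhaust_2': "(A::2) = 0 \<or> A = 1"
  using exhaust_2[of A] two_eq_zero by metis

lemma pd_eqI: "(f has_derivative f') (at x) \<Longrightarrow> pd i f x = f' (axis i 1)"
  by (simp add: pd_def frechet_derivative_at[symmetric])

lemma has_derivative_pd:
  fixes f :: "real^'i::finite \<Rightarrow> 'b::real_normed_vector"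
  assumes "f differentiable at x"
  shows "(f has_derivative (\<lambda>h. \<Sum>i\<in>UNIV. h $ i *\<^sub>R pd i f x)) (at x)"
proof -
  have d: "(f has_derivative frechet_derivative f (at x)) (at x)"
    using assms frechet_derivative_works by blast
  have l: "linear (frechet_derivative f (at x))"
    using assms linear_frechet_derivative by blast
  have "frechet_derivative f (at x) h = (\<Sum>i\<in>UNIV. h $ i *\<^sub>R pd i f x)" for h
  proof -
    have "h = (\<Sum>i\<in>UNIV. h $ i *\<^sub>R axis i 1)"
      by (simp add: vec_eq_iff axis_def if_distrib[where f="\<lambda>x. _ * x"] cong: if_cong)
    then have "frechet_derivative f (at x) h = frechet_derivative f (at x) (\<Sum>i\<in>UNIV. h $ i *\<^sub>R axis i 1)"
      by simp
    also have "\<dots> = (\<Sum>i\<in>UNIV. h $ i *\<^sub>R pd i f x)"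
      by (simp add: linear_sum[OF l] linear_scale[OF l] pd_def)
    finally show ?thesis .
  qed
  then have "frechet_derivative f (at x) = (\<lambda>h. \<Sum>i\<in>UNIV. h $ i *\<^sub>R pd i f x)"
    by blast
  then show ?thesis using d by simp
qed

lemma has_derivative_cong_open:
  assumes "open S" "x \<in> S" "\<And>y. y \<in> S \<Longrightarrow> f y = g y"
  shows "(f has_derivative D) (at x) \<longleftrightarrow> (g has_derivative D) (at x)"
  using assms has_derivative_transform_within_open[of f D x UNIV S g]
    has_derivative_transform_within_open[of g D x UNIV S f] by auto

text \<open>Differentiability is not assumed: the Frechet derivative is a choice among all
  derivatives, and functions with the same germ have the same ones. Identities valid only on the
  open domain can thus be differentiated.\<close>

lemma pd_cong:
  assumes "open S" "x \<in> S" "\<And>y. y \<in> S \<Longrightarrow> f y = g y"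
  shows "pd i f x = pd i g x"
  unfolding pd_def frechet_derivative_def using has_derivative_cong_open[OF assms] by simp

lemma differentiable_cong_open:
  assumes "open S" "x \<in> S" "\<And>y. y \<in> S \<Longrightarrow> f y = g y"
  shows "f differentiable at x \<longleftrightarrow> g differentiable at x"
  unfolding differentiable_def using has_derivative_cong_open[OF assms] by simp

lemma pd_const [simp]: "pd i (\<lambda>x. c) x = 0"
  by (simp add: pd_def)

lemma pd_add:
  "f differentiable at x \<Longrightarrow> g differentiable at x \<Longrightarrow> pd i (\<lambda>x. f x + g x) x = pd i f x + pd i g x"
  by (rule pd_eqI[THEN trans]) (auto intro!: derivative_eq_intros simp: frechet_derivative_works pd_def)

lemma pd_diff:
  "f differentiable at x \<Longrightarrow> g differentiable at x \<Longrightarrow> pd i (\<lambda>x. f x - g x) x = pd i f x - pd i g x"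
  by (rule pd_eqI[THEN trans]) (auto intro!: derivative_eq_intros simp: frechet_derivative_works pd_def)

lemma pd_minus:
  "f differentiable at x \<Longrightarrow> pd i (\<lambda>x. - f x) x = - pd i f x"
  by (rule pd_eqI[THEN trans]) (auto intro!: derivative_eq_intros simp: frechet_derivative_works pd_def)

lemma pd_mult:
  fixes f g :: "real^'i::finite \<Rightarrow> real"
  shows "f differentiable at x \<Longrightarrow> g differentiable at x \<Longrightarrow>
    pd i (\<lambda>x. f x * g x) x = pd i f x * g x + f x * pd i g x"
  by (rule pd_eqI[THEN trans]) (auto intro!: derivative_eq_intros simp: frechet_derivative_works pd_def)

lemma pd_sum:
  "(\<And>j. j \<in> J \<Longrightarrow> f j differentiable at x) \<Longrightarrow> pd i (\<lambda>x. \<Sum>j\<in>J. f j x) x = (\<Sum>j\<in>J. pd i (f j) x)"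
  by (rule pd_eqI[THEN trans], rule has_derivative_sum)
     (auto simp: frechet_derivative_works pd_def)

lemma has_derivative_compose_real:
  fixes f :: "'a::real_normed_vector \<Rightarrow> real"
  assumes "f differentiable at x" "(u has_real_derivative u') (at (f x))"
  shows "((\<lambda>x. u (f x)) has_derivative (\<lambda>h. u' * frechet_derivative f (at x) h)) (at x)"
  using has_derivative_compose[OF assms(1)[unfolded frechet_derivative_works] assms(2)[unfolded has_field_derivative_def]]
  by simp

lemma differentiable_compose_real:
  fixes f :: "'a::real_normed_vector \<Rightarrow> real"
  assumes "f differentiable at x" "(u has_real_derivative u') (at (f x))"
  shows "(\<lambda>x. u (f x)) differentiable at x"
  using has_derivative_compose_real[OF assms] by (rule differentiableI)

lemma pd_compose_real:
  fixes f :: "real^'i::finite \<Rightarrow> real"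
  assumes "f differentiable at x" "(u has_real_derivative u') (at (f x))"
  shows "pd i (\<lambda>x. u (f x)) x = u' * pd i f x"
  using pd_eqI[OF has_derivative_compose_real[OF assms]] by (simp add: pd_def)

lemma pd_cmult:
  fixes f :: "real^'i::finite \<Rightarrow> real"
  shows "f differentiable at x \<Longrightarrow> pd i (\<lambda>x. c * f x) x = c * pd i f x"
  using pd_mult[of "\<lambda>_. c" x f i] by simp

lemma pd_power:
  fixes f :: "real^'i::finite \<Rightarrow> real"
  shows "f differentiable at x \<Longrightarrow> pd i (\<lambda>x. f x ^ n) x = n * f x ^ (n - 1) * pd i f x"
  by (rule pd_compose_real) (auto intro!: derivative_eq_intros)

lemma pd_inverse:
  fixes f :: "real^'i::finite \<Rightarrow> real"
  shows "f differentiable at x \<Longrightarrow> f x \<noteq> 0 \<Longrightarrow> pd i (\<lambda>x. inverse (f x)) x = - pd i f x / (f x)\<^sup>2"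
  using pd_compose_real[of f x inverse "- inverse ((f x)\<^sup>2)" i] DERIV_inverse[of "f x"]
  by (simp add: power2_eq_square) (simp add: divide_simps)

lemma pd_divide:
  fixes f g :: "real^'i::finite \<Rightarrow> real"
  assumes "f differentiable at x" "g differentiable at x" "g x \<noteq> 0"
  shows "pd i (\<lambda>x. f x / g x) x = (pd i f x * g x - f x * pd i g x) / (g x)\<^sup>2"
proof -
  have "(\<lambda>x. inverse (g x)) differentiable at x"
    using assms by (intro differentiable_inverse)
  from pd_mult[OF assms(1) this, of i] show ?thesis
    using assms by (simp add: divide_inverse pd_inverse) (simp add: field_simps power2_eq_square)
qed

lemma component_has_derivative: "((\<lambda>x::real^'i::finite. x $ j) has_derivative (\<lambda>h. h $ j)) (at x within S)"
  by (intro bounded_linear_imp_has_derivative bounded_linear_vec_nth)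

lemma component_differentiable [simp]: "(\<lambda>x::real^'i::finite. x $ j) differentiable at x within S"
  using component_has_derivative differentiableI by blast

lemma pd_component [simp]: "pd i (\<lambda>x::real^'i::finite. x $ j) x = (if i = j then 1 else 0)"
  by (simp add: pd_eqI[OF component_has_derivative] axis_def)

section \<open>Functions of one group of coordinates\<close>

lemma linear_ypart: "bounded_linear (ypart :: real^(2 + 'm::finite) \<Rightarrow> real^2)"
  unfolding linear_conv_bounded_linear[symmetric]
  by (rule linearI) (auto simp: ypart_def vec_eq_iff)

lemma linear_zpart: "bounded_linear (zpart :: real^(2 + 'm::finite) \<Rightarrow> real^'m)"
  unfolding linear_conv_bounded_linear[symmetric]
  by (rule linearI) (auto simp: zpart_def vec_eq_iff)

lemma ypart_axis: "ypart (axis (Inl A) 1) = axis A 1" "ypart (axis (Inr i) 1) = 0"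
  and zpart_axis: "zpart (axis (Inl A) 1) = 0" "zpart (axis (Inr i) 1) = axis i 1"
  by (auto simp: ypart_def zpart_def axis_def vec_eq_iff)

lemma ypart_differentiable:
  assumes "h differentiable at (ypart x)"
  shows "(\<lambda>x. h (ypart x)) differentiable at x"
    and "pd (Inl A) (\<lambda>x. h (ypart x)) x = pd A h (ypart x)"
    and "pd (Inr i) (\<lambda>x. h (ypart x)) x = 0"
proof -
  have d: "((\<lambda>x. h (ypart x)) has_derivative (\<lambda>v. frechet_derivative h (at (ypart x)) (ypart v))) (at x)"
    by (rule has_derivative_compose[OF bounded_linear_imp_has_derivative[OF linear_ypart]])
      (use assms frechet_derivative_works in blast)
  show "(\<lambda>x. h (ypart x)) differentiable at x" using d by (rule differentiableI)
  show "pd (Inl A) (\<lambda>x. h (ypart x)) x = pd A h (ypart x)"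
    using pd_eqI[OF d] by (simp add: pd_def ypart_axis)
  show "pd (Inr i) (\<lambda>x. h (ypart x)) x = 0"
    using pd_eqI[OF d] linear_0[OF linear_frechet_derivative[OF assms]] by (simp add: ypart_axis)
qed

lemma zpart_differentiable:
  assumes "h differentiable at (zpart x)"
  shows "(\<lambda>x. h (zpart x)) differentiable at x"
    and "pd (Inl A) (\<lambda>x. h (zpart x)) x = 0"
    and "pd (Inr i) (\<lambda>x. h (zpart x)) x = pd i h (zpart x)"
proof -
  have d: "((\<lambda>x. h (zpart x)) has_derivative (\<lambda>v. frechet_derivative h (at (zpart x)) (zpart v))) (at x)"
    by (rule has_derivative_compose[OF bounded_linear_imp_has_derivative[OF linear_zpart]])
      (use assms frechet_derivative_works in blast)
  show "(\<lambda>x. h (zpart x)) differentiable at x" using d by (rule differentiableI)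
  show "pd (Inr i) (\<lambda>x. h (zpart x)) x = pd i h (zpart x)"
    using pd_eqI[OF d] by (simp add: pd_def zpart_axis)
  show "pd (Inl A) (\<lambda>x. h (zpart x)) x = 0"
    using pd_eqI[OF d] linear_0[OF linear_frechet_derivative[OF assms]] by (simp add: zpart_axis)
qed

section \<open>Regularity classes\<close>

lemma Ck_nat_Suc_D:
  assumes "open S" "Ck_nat (Suc k) S f" "x \<in> S"
  shows "f differentiable at x"
  using assms by (simp add: differentiable_on_eq_differentiable_at)

lemma Ck_nat_Suc_iff:
  assumes "open S"
  shows "Ck_nat (Suc k) S f \<longleftrightarrow> (\<forall>x\<in>S. f differentiable at x) \<and> (\<forall>i. Ck_nat k S (pd i f))"
  using assms by (simp add: differentiable_on_eq_differentiable_at)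

lemma Ck_nat_cong:
  assumes "open S" "\<And>x. x \<in> S \<Longrightarrow> f x = g x"
  shows "Ck_nat k S f \<longleftrightarrow> Ck_nat k S g"
  using assms(2)
proof (induction k arbitrary: f g)
  case 0
  then show ?case by (auto cong: continuous_on_cong)
next
  case (Suc k)
  have "Ck_nat k S (pd i f) \<longleftrightarrow> Ck_nat k S (pd i g)" for i
    by (rule Suc.IH) (use pd_cong[OF assms(1)] Suc.prems in blast)
  moreover have "f differentiable at x \<longleftrightarrow> g differentiable at x" if "x \<in> S" for x
    using differentiable_cong_open[OF assms(1) that] Suc.prems by blast
  ultimately show ?case unfolding Ck_nat_Suc_iff[OF assms(1)] by simp
qed

lemma Ck_nat_subset: "Ck_nat k S f \<Longrightarrow> T \<subseteq> S \<Longrightarrow> Ck_nat k T f"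
  by (induction k arbitrary: f) (auto intro: continuous_on_subset differentiable_on_subset)

lemma Ck_nat_SucD: "Ck_nat (Suc k) S f \<Longrightarrow> Ck_nat k S f"
  by (induction k arbitrary: f) (auto intro: differentiable_imp_continuous_on)

lemma Ck_nat_mono: "Ck_nat k S f \<Longrightarrow> l \<le> k \<Longrightarrow> Ck_nat l S f"
  by (induction k) (auto simp: le_Suc_eq simp del: Ck_nat.simps dest: Ck_nat_SucD)

lemma Ck_nat_pd: "Ck_nat (Suc k) S f \<Longrightarrow> Ck_nat k S (pd i f)"
  by simp

lemma Ck_nat_const:
  fixes S :: "(real^'i::finite) set"
  shows "Ck_nat k S (\<lambda>x. c)"
proof (induction k arbitrary: c)
  case (Suc k)
  have "pd i (\<lambda>x::real^'i. c) = (\<lambda>x. 0)" for i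
    by auto
  then show ?case using Suc by simp
qed simp

lemma Ck_nat_add:
  assumes "open S" "Ck_nat k S f" "Ck_nat k S g"
  shows "Ck_nat k S (\<lambda>x. f x + g x)"
  using assms(2,3)
proof (induction k arbitrary: f g)
  case 0
  then show ?case by (auto intro: continuous_intros)
next
  case (Suc k)
  note d = Suc.prems[unfolded Ck_nat_Suc_iff[OF assms(1)]]
  have "Ck_nat k S (pd i (\<lambda>x. f x + g x))" for i
    using Suc.IH[of "pd i f" "pd i g"] d
      Ck_nat_cong[OF assms(1), of "pd i (\<lambda>x. f x + g x)" "\<lambda>x. pd i f x + pd i g x" k] by (auto simp: pd_add)
  then show ?case unfolding Ck_nat_Suc_iff[OF assms(1)] using d by auto
qed

lemma Ck_nat_mult:
  assumes "open S" "Ck_nat k S f" "Ck_nat k S g"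
  shows "Ck_nat k S (\<lambda>x. f x * g x)"
  using assms(2,3)
proof (induction k arbitrary: f g)
  case 0
  then show ?case by (auto intro: continuous_intros)
next
  case (Suc k)
  note d = Suc.prems[unfolded Ck_nat_Suc_iff[OF assms(1)]]
  have "Ck_nat k S (\<lambda>x. pd i f x * g x + f x * pd i g x)" for i
    using Suc.IH[of "pd i f" g] Suc.IH[of f "pd i g"] d Ck_nat_SucD[OF Suc.prems(1)] Ck_nat_SucD[OF Suc.prems(2)]
    by (intro Ck_nat_add[OF assms(1)]) auto
  then have "Ck_nat k S (pd i (\<lambda>x. f x * g x))" for i
    using d Ck_nat_cong[OF assms(1), of "pd i (\<lambda>x. f x * g x)" "\<lambda>x. pd i f x * g x + f x * pd i g x" k] by (auto simp: pd_mult)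
  then show ?case unfolding Ck_nat_Suc_iff[OF assms(1)] using d by (auto intro: differentiable_mult)
qed

lemma Ck_nat_minus:
  assumes "open S" "Ck_nat k S f"
  shows "Ck_nat k S (\<lambda>x. - f x)"
  using Ck_nat_mult[OF assms(1) Ck_nat_const[of k S "-1"] assms(2)] by simp

lemma Ck_nat_diff:
  assumes "open S" "Ck_nat k S f" "Ck_nat k S g"
  shows "Ck_nat k S (\<lambda>x. f x - g x)"
  using Ck_nat_add[OF assms(1,2) Ck_nat_minus[OF assms(1,3)]] by simp

text \<open>The derivative is a polynomial in the inverse itself and in the derivatives of
  \<open>f\<close>, so the induction hypothesis for the same function, one order lower, closes the
  step.\<close>

lemma Ck_nat_inverse:
  assumes "open S" "Ck_nat k S f" "\<And>x. x \<in> S \<Longrightarrow> f x \<noteq> 0"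
  shows "Ck_nat k S (\<lambda>x. inverse (f x))"
  using assms(2)
proof (induction k)
  case 0
  then show ?case using assms(3) by (auto intro!: continuous_intros)
next
  case (Suc k)
  note d = Suc.prems[unfolded Ck_nat_Suc_iff[OF assms(1)]]
  have "Ck_nat k S (\<lambda>x. inverse (f x))"
    using Suc Ck_nat_SucD by blast
  then have "Ck_nat k S (\<lambda>x. - pd i f x * (inverse (f x) * inverse (f x)))" for i
    using d by (intro Ck_nat_mult Ck_nat_minus assms(1)) auto
  then have "Ck_nat k S (pd i (\<lambda>x. inverse (f x)))" for i
    using d assms(3) Ck_nat_cong[OF assms(1), of "pd i (\<lambda>x. inverse (f x))" "\<lambda>x. - pd i f x * (inverse (f x) * inverse (f x))" k]
    by (auto simp: pd_inverse power2_eq_square divide_inverse)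
  then show ?case unfolding Ck_nat_Suc_iff[OF assms(1)] using d assms(3)
    by (auto intro!: differentiable_inverse)
qed

lemma Ck_nat_divide:
  assumes "open S" "Ck_nat k S f" "Ck_nat k S g" "\<And>x. x \<in> S \<Longrightarrow> g x \<noteq> 0"
  shows "Ck_nat k S (\<lambda>x. f x / g x)"
  using Ck_nat_mult[OF assms(1,2) Ck_nat_inverse[OF assms(1,3,4)]] by (simp add: divide_inverse)

lemma Ck_nat_sqrt:
  assumes "open S" "Ck_nat k S f" "\<And>x. x \<in> S \<Longrightarrow> f x > 0"
  shows "Ck_nat k S (\<lambda>x. sqrt (f x))"
  using assms(2)
proof (induction k)
  case 0
  then show ?case by (auto intro!: continuous_intros)
next
  case (Suc k)
  note d = Suc.prems[unfolded Ck_nat_Suc_iff[OF assms(1)]]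
  have s: "(sqrt has_real_derivative inverse (sqrt (f x)) / 2) (at (f x))" if "x \<in> S" for x
    using assms(3)[OF that] by (rule DERIV_real_sqrt)
  have pos: "sqrt (f x) \<noteq> 0" if "x \<in> S" for x
    using assms(3)[OF that] by simp
  have "Ck_nat k S (\<lambda>x. sqrt (f x))"
    using Suc Ck_nat_SucD by blast
  then have "Ck_nat k S (\<lambda>x. (inverse (sqrt (f x)) * (1/2)) * pd i f x)" for i
    using d pos by (intro Ck_nat_mult Ck_nat_inverse Ck_nat_const assms(1)) auto
  then have "Ck_nat k S (pd i (\<lambda>x. sqrt (f x)))" for i
    using d pd_compose_real[of f _ sqrt, OF _ s] Ck_nat_cong[OF assms(1), of "pd i (\<lambda>x. sqrt (f x))" "\<lambda>x. (inverse (sqrt (f x)) * (1/2)) * pd i f x" k]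
    by simp
  then show ?case unfolding Ck_nat_Suc_iff[OF assms(1)]
    using d differentiable_compose_real[of f _ sqrt, OF _ s] by blast
qed

lemma Ck_nat_sum:
  assumes "open S" "\<And>j. j \<in> J \<Longrightarrow> Ck_nat k S (f j)"
  shows "Ck_nat k S (\<lambda>x. \<Sum>j\<in>J. f j x)"
proof (cases "finite J")
  case True
  then show ?thesis using assms(2)
    by (induction J) (auto intro!: Ck_nat_const Ck_nat_add[OF assms(1)])
next
  case False
  then show ?thesis by (simp add: Ck_nat_const)
qed

lemma Ck_nat_power:
  assumes "open S" "Ck_nat k S f"
  shows "Ck_nat k S (\<lambda>x. f x ^ n)"
  by (induction n) (auto intro!: Ck_nat_const Ck_nat_mult assms)

section \<open>Symmetry of second derivatives and the Poincare lemma\<close>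

lemma pd_line:
  fixes f :: "real^'i::finite \<Rightarrow> real"
  assumes "f differentiable at (p + s *\<^sub>R axis i 1)"
  shows "((\<lambda>s. f (p + s *\<^sub>R axis i 1)) has_real_derivative pd i f (p + s *\<^sub>R axis i 1)) (at s)"
proof -
  have "((\<lambda>s. p + s *\<^sub>R axis i 1) has_derivative (\<lambda>h. h *\<^sub>R axis i 1)) (at s)"
    by (auto intro!: derivative_eq_intros)
  from has_derivative_compose[OF this assms[unfolded frechet_derivative_works]]
  have "((\<lambda>s. f (p + s *\<^sub>R axis i 1)) has_derivative
      (\<lambda>h. frechet_derivative f (at (p + s *\<^sub>R axis i 1)) (h *\<^sub>R axis i 1))) (at s)" .
  then show ?thesis
    unfolding has_field_derivative_def linear_scale[OF linear_frechet_derivative[OF assms]] pd_def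
    by (simp add: mult_commute_abs)
qed

text \<open>The mean value theorem, once along each axis: first for the increment in direction
  \<open>j\<close> as a function of the displacement along \<open>i\<close>, then for
  \<open>pd i f\<close> along \<open>j\<close>.\<close>

lemma second_difference:
  fixes f :: "real^'i::finite \<Rightarrow> real"
  assumes "open S" "Ck_nat 2 S f" "h > 0"
    and sub: "\<And>s u. 0 \<le> s \<Longrightarrow> s \<le> h \<Longrightarrow> 0 \<le> u \<Longrightarrow> u \<le> h \<Longrightarrow> x + s *\<^sub>R axis i 1 + u *\<^sub>R axis j 1 \<in> S"
  shows "\<exists>s u. 0 < s \<and> s < h \<and> 0 < u \<and> u < h \<and>
    f (x + h *\<^sub>R axis i 1 + h *\<^sub>R axis j 1) - f (x + h *\<^sub>R axis i 1) - f (x + h *\<^sub>R axis j 1) + f x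
      = h * h * pd j (pd i f) (x + s *\<^sub>R axis i 1 + u *\<^sub>R axis j 1)"
proof -
  have c2: "Ck_nat (Suc (Suc 0)) S f" using assms(2) by (simp add: numeral_2_eq_2)
  have d1: "f differentiable at p" if "p \<in> S" for p
    using Ck_nat_Suc_D[OF assms(1) c2 that] .
  have d2: "pd i f differentiable at p" if "p \<in> S" for p
    using Ck_nat_Suc_D[OF assms(1) Ck_nat_pd[OF c2] that] .
  define v where "v = (\<lambda>s. f ((x + h *\<^sub>R axis j 1) + s *\<^sub>R axis i 1) - f (x + s *\<^sub>R axis i 1))"
  have v: "(v has_real_derivative pd i f ((x + h *\<^sub>R axis j 1) + s *\<^sub>R axis i 1) - pd i f (x + s *\<^sub>R axis i 1)) (at s)"
    if "0 \<le> s" "s \<le> h" for s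
    unfolding v_def using sub[of s h] sub[of s 0] that assms(3)
    by (intro DERIV_diff pd_line d1) (auto simp: algebra_simps)
  obtain s where s: "0 < s" "s < h"
    "v h - v 0 = (h - 0) * (pd i f ((x + h *\<^sub>R axis j 1) + s *\<^sub>R axis i 1) - pd i f (x + s *\<^sub>R axis i 1))"
    using MVT2[OF assms(3) v] by blast
  have w: "((\<lambda>u. pd i f ((x + s *\<^sub>R axis i 1) + u *\<^sub>R axis j 1)) has_real_derivative
      pd j (pd i f) ((x + s *\<^sub>R axis i 1) + u *\<^sub>R axis j 1)) (at u)" if "0 \<le> u" "u \<le> h" for u
    using sub[of s u] that s by (intro pd_line d2) auto
  obtain u where u: "0 < u" "u < h"
    "pd i f ((x + s *\<^sub>R axis i 1) + h *\<^sub>R axis j 1) - pd i f ((x + s *\<^sub>R axis i 1) + 0 *\<^sub>R axis j 1)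
      = (h - 0) * pd j (pd i f) ((x + s *\<^sub>R axis i 1) + u *\<^sub>R axis j 1)"
    using MVT2[OF assms(3) w] by blast
  have "v h - v 0 = h * (h * pd j (pd i f) ((x + s *\<^sub>R axis i 1) + u *\<^sub>R axis j 1))"
    using s(3) u(3) by (simp add: algebra_simps)
  then show ?thesis
    using s(1,2) u(1,2) by (intro exI[of _ s] exI[of _ u]) (simp add: v_def algebra_simps)
qed

text \<open>The mixed second difference over a square does not see the order of the axes, yet it
  equals the squared side times either mixed derivative at some point of the square. Continuity of
  both mixed derivatives then forces equality on a small enough square.\<close>

theorem pd_commute:
  fixes f :: "real^'i::finite \<Rightarrow> real"
  assumes S: "open S" and f: "Ck_nat 2 S f" and x: "x \<in> S"
  shows "pd i (pd j f) x = pd j (pd i f) x"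
proof (rule ccontr)
  assume ne: "pd i (pd j f) x \<noteq> pd j (pd i f) x"
  define e where "e = \<bar>pd i (pd j f) x - pd j (pd i f) x\<bar> / 2"
  have e: "e > 0" using ne by (simp add: e_def)
  have c: "continuous_on S (pd i (pd j f))" "continuous_on S (pd j (pd i f))"
    using f by (auto simp: numeral_2_eq_2)
  obtain d0 where d0: "d0 > 0" "ball x d0 \<subseteq> S" using S x open_contains_ball by blast
  obtain d1 where d1: "d1 > 0" "\<And>y. y \<in> S \<Longrightarrow> dist y x < d1 \<Longrightarrow> dist (pd i (pd j f) y) (pd i (pd j f) x) < e"
    using c(1) x e unfolding continuous_on_iff by metis
  obtain d2 where d2: "d2 > 0" "\<And>y. y \<in> S \<Longrightarrow> dist y x < d2 \<Longrightarrow> dist (pd j (pd i f) y) (pd j (pd i f) x) < e"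
    using c(2) x e unfolding continuous_on_iff by metis
  \<comment> \<open>A point of the square of side \<open>h\<close> is at distance at most
    \<open>2 * h\<close> from the corner, which the divisor \<open>3\<close> keeps strictly inside
    all three balls.\<close>
  define h where "h = Min {d0, d1, d2} / 3"
  have h: "h > 0" "3 * h \<le> d0" "3 * h \<le> d1" "3 * h \<le> d2"
    using d0 d1 d2 by (auto simp: h_def)
  have close: "dist (x + s *\<^sub>R axis a 1 + u *\<^sub>R axis b 1) x < 3 * h"
    if "0 \<le> s" "s \<le> h" "0 \<le> u" "u \<le> h" for s u and a b :: 'i
  proof -
    have "norm (s *\<^sub>R axis a (1::real) + u *\<^sub>R axis b 1) \<le> norm (s *\<^sub>R axis a (1::real)) + norm (u *\<^sub>R axis b (1::real))"
      by (rule norm_triangle_ineq)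
    also have "\<dots> = s + u" using that by simp
    also have "\<dots> < 3 * h" using that h by simp
    finally show ?thesis by (simp add: dist_norm add.assoc)
  qed
  have mem: "x + s *\<^sub>R axis a 1 + u *\<^sub>R axis b 1 \<in> S"
    if "0 \<le> s" "s \<le> h" "0 \<le> u" "u \<le> h" for s u and a b :: 'i
    using close[OF that, of a b] h d0 by (auto simp: dist_commute)
  obtain s u where 1: "0 < s" "s < h" "0 < u" "u < h"
    "f (x + h *\<^sub>R axis i 1 + h *\<^sub>R axis j 1) - f (x + h *\<^sub>R axis i 1) - f (x + h *\<^sub>R axis j 1) + f x
      = h * h * pd j (pd i f) (x + s *\<^sub>R axis i 1 + u *\<^sub>R axis j 1)"
    using second_difference[OF S f h(1) mem] by blast
  obtain s' u' where 2: "0 < s'" "s' < h" "0 < u'" "u' < h"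
    "f (x + h *\<^sub>R axis j 1 + h *\<^sub>R axis i 1) - f (x + h *\<^sub>R axis j 1) - f (x + h *\<^sub>R axis i 1) + f x
      = h * h * pd i (pd j f) (x + s' *\<^sub>R axis j 1 + u' *\<^sub>R axis i 1)"
    using second_difference[OF S f h(1) mem] by blast
  have "h * h * pd j (pd i f) (x + s *\<^sub>R axis i 1 + u *\<^sub>R axis j 1)
      = h * h * pd i (pd j f) (x + s' *\<^sub>R axis j 1 + u' *\<^sub>R axis i 1)"
    using 1(5) 2(5) by (simp add: algebra_simps)
  then have "pd j (pd i f) (x + s *\<^sub>R axis i 1 + u *\<^sub>R axis j 1)
      = pd i (pd j f) (x + s' *\<^sub>R axis j 1 + u' *\<^sub>R axis i 1)"
    using h(1) by simp
  moreover have "dist (pd j (pd i f) (x + s *\<^sub>R axis i 1 + u *\<^sub>R axis j 1)) (pd j (pd i f) x) < e"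
    using 1 close[of s u i j] h by (intro d2 mem) auto
  moreover have "dist (pd i (pd j f) (x + s' *\<^sub>R axis j 1 + u' *\<^sub>R axis i 1)) (pd i (pd j f) x) < e"
    using 2 close[of s' u' j i] h by (intro d1 mem) auto
  ultimately have "\<bar>pd i (pd j f) x - pd j (pd i f) x\<bar> < 2 * e"
    unfolding dist_real_def by arith
  then show False by (simp add: e_def)
qed

lemma Ck_nat_1_continuous:
  "Ck_nat 1 S f \<Longrightarrow> continuous_on S f" "Ck_nat 1 S f \<Longrightarrow> continuous_on S (pd i f)"
  using Ck_nat_mono[of 1 S f 0] by auto

text \<open>The potential is the integral of the form along segments from a base point,
  differentiated under the integral sign by the Leibniz rule.\<close>

lemma poincare:
  fixes \<tau> :: "'i::finite \<Rightarrow> real^'i \<Rightarrow> real"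
  assumes S: "open S" "convex S" and \<tau>: "\<And>i. Ck_nat 1 S (\<tau> i)"
    and closed: "\<And>i j y. y \<in> S \<Longrightarrow> pd i (\<tau> j) y = pd j (\<tau> i) y"
  shows "\<exists>t. \<forall>y\<in>S. (t has_derivative (\<lambda>h. \<Sum>i\<in>UNIV. h $ i * \<tau> i y)) (at y)"
proof (cases "S = {}")
  case False
  then obtain c where c: "c \<in> S" by blast
  have diff: "\<tau> i differentiable at y" if "y \<in> S" for i y
    using Ck_nat_Suc_D[OF S(1) _ that, of 0] \<tau>[of i] by simp
  define T where "T y = (\<chi> i. \<tau> i y)" for y
  define p where "p y s = c + s *\<^sub>R (y - c)" for y and s :: real
  \<comment> \<open>This field has two readings. It is the derivative in \<open>s\<close> of
    \<open>s *\<^sub>R T (p y s)\<close>, so its integral over the unit interval is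
    \<open>T y\<close>; and, by closedness, it is the gradient in \<open>y\<close> of the integrand
    \<open>F y s\<close>.\<close>
  define G where "G y s = T (p y s) + s *\<^sub>R (\<chi> i. \<Sum>j\<in>UNIV. (y - c) $ j * pd j (\<tau> i) (p y s))" for y s
  have p: "p y s \<in> S" if "y \<in> S" "s \<in> {0..1}" for y s
  proof -
    have "p y s = (1 - s) *\<^sub>R c + s *\<^sub>R y" by (simp add: p_def algebra_simps)
    then show ?thesis using convexD[OF S(2) c that(1), of "1 - s" s] that(2) by auto
  qed
  define F where "F y s = (\<Sum>i\<in>UNIV. (y - c) $ i * \<tau> i (p y s))" for y s
  have dp: "((\<lambda>y. p y s) has_derivative (\<lambda>h. s *\<^sub>R h)) (at y)" for y s
    unfolding p_def by (auto intro!: derivative_eq_intros)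
  have dF: "((\<lambda>y. F y s) has_derivative (\<lambda>h. h \<bullet> G y s)) (at y)" if "y \<in> S" "s \<in> {0..1}" for y s
  proof -
    have d: "((\<lambda>y. \<tau> i (p y s)) has_derivative (\<lambda>h. s * (\<Sum>j\<in>UNIV. h $ j * pd j (\<tau> i) (p y s)))) (at y)" for i
      using has_derivative_compose[OF dp has_derivative_pd[OF diff[OF p[OF that]]], of i]
      by (simp add: sum_distrib_left mult.assoc)
    have cc: "((\<lambda>y. (y - c) $ i) has_derivative (\<lambda>h. h $ i)) (at y)" for i
      using has_derivative_diff[OF component_has_derivative[of i y UNIV] has_derivative_const[of "c $ i"]] by simp
    have "((\<lambda>y. F y s) has_derivative (\<lambda>h. \<Sum>i\<in>UNIV.
        (y - c) $ i * (s * (\<Sum>j\<in>UNIV. h $ j * pd j (\<tau> i) (p y s))) + h $ i * \<tau> i (p y s))) (at y)"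
      unfolding F_def by (intro has_derivative_sum has_derivative_mult d cc)
    moreover have "(\<Sum>i\<in>UNIV. (y - c) $ i * (s * (\<Sum>j\<in>UNIV. h $ j * pd j (\<tau> i) (p y s))) + h $ i * \<tau> i (p y s))
        = h \<bullet> G y s" for h
    proof -
      have "(\<Sum>i\<in>UNIV. (y - c) $ i * (s * (\<Sum>j\<in>UNIV. h $ j * pd j (\<tau> i) (p y s))))
          = (\<Sum>i\<in>UNIV. \<Sum>j\<in>UNIV. s * (h $ j * ((y - c) $ i * pd i (\<tau> j) (p y s))))"
        using closed[OF p[OF that]]
        by (auto simp: sum_distrib_left algebra_simps intro!: sum.cong)
      also have "\<dots> = (\<Sum>j\<in>UNIV. \<Sum>i\<in>UNIV. s * (h $ j * ((y - c) $ i * pd i (\<tau> j) (p y s))))"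
        by (rule sum.swap)
      also have "\<dots> = (\<Sum>j\<in>UNIV. h $ j * (s * (\<Sum>i\<in>UNIV. (y - c) $ i * pd i (\<tau> j) (p y s))))"
        by (simp add: sum_distrib_left mult.left_commute)
      finally show ?thesis
        by (simp add: inner_vec_def G_def T_def sum.distrib distrib_left)
    qed
    ultimately show ?thesis by simp
  qed
  have contp: "continuous_on (S \<times> {0..1}) (\<lambda>(y, s). p y s)"
    unfolding p_def case_prod_beta by (intro continuous_intros)
  have compp: "continuous_on (S \<times> {0..1}) (\<lambda>(y, s). q (p y s))" if "continuous_on S q" for q :: "real^'i \<Rightarrow> real"
  proof -
    have "(\<lambda>(y, s). p y s) ` (S \<times> {0..1}) \<subseteq> S" using p by auto
    from continuous_on_compose2[OF that contp this] show ?thesis by (simp add: case_prod_beta)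
  qed
  have contG: "continuous_on (S \<times> {0..1}) (\<lambda>(y, s). G y s)"
    unfolding G_def T_def case_prod_beta
    using compp[OF Ck_nat_1_continuous(1)[OF \<tau>]] compp[OF Ck_nat_1_continuous(2)[OF \<tau>]]
    by (intro continuous_intros) (auto simp: case_prod_beta)
  define t where "t y = integral {0..1} (F y)" for y
  have contF: "continuous_on {0..1} (F y)" if "y \<in> S" for y
  proof -
    have cP: "continuous_on {0..1} (\<lambda>s::real. (y, s))" by (intro continuous_intros)
    have sP: "(\<lambda>s. (y, s)) ` {0..1} \<subseteq> S \<times> {0..1::real}" using that by auto
    have "continuous_on {0..1} (\<lambda>s. \<tau> i (p y s))" for i
      using continuous_on_compose2[OF compp[OF Ck_nat_1_continuous(1)[OF \<tau>[of i]]], of "{0..1}" "\<lambda>s. (y, s)", OF cP sP] that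
      by simp
    then show ?thesis unfolding F_def by (intro continuous_intros)
  qed
  have "(t has_derivative (\<lambda>h. \<Sum>i\<in>UNIV. h $ i * \<tau> i y)) (at y)" if y: "y \<in> S" for y
  proof -
    have "(t has_derivative integral (cbox 0 1) (\<lambda>s. blinfun_inner_left (G y s))) (at y within S)"
      unfolding t_def cbox_interval[symmetric]
    proof (rule leibniz_rule)
      show "((\<lambda>y. F y s) has_derivative blinfun_inner_left (G y s)) (at y within S)"
        if "y \<in> S" "s \<in> cbox 0 1" for y s
        using dF[of y s] that has_derivative_at_withinI by auto
      show "F y integrable_on cbox 0 1" if "y \<in> S" for y
        using contF[OF that] integrable_continuous_interval by auto
      show "continuous_on (S \<times> cbox 0 1) (\<lambda>(y, s). blinfun_inner_left (G y s))"
        using bounded_linear.continuous_on[OF bounded_linear_blinfun_inner_left contG]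
        by (simp add: case_prod_beta)
    qed (use S y in auto)
    moreover have "integral (cbox 0 1) (\<lambda>s. blinfun_inner_left (G y s)) = blinfun_inner_left (T y)"
    proof -
      have FT: "(G y has_integral (1 *\<^sub>R T (p y 1) - 0 *\<^sub>R T (p y 0))) {0..1}"
      proof (rule fundamental_theorem_of_calculus)
        fix s :: real assume s: "s \<in> {0..1}"
        have ds: "((\<lambda>s. p y s) has_derivative (\<lambda>h. h *\<^sub>R (y - c))) (at s)"
          unfolding p_def by (auto intro!: derivative_eq_intros)
        have "((\<lambda>s. \<tau> i (p y s)) has_derivative (\<lambda>h. \<Sum>j\<in>UNIV. (h *\<^sub>R (y - c)) $ j *\<^sub>R pd j (\<tau> i) (p y s))) (at s)" for i
          using has_derivative_compose[OF ds has_derivative_pd[OF diff[OF p[OF y s]]]] .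
        then have "((\<lambda>s. \<tau> i (p y s)) has_real_derivative (\<Sum>j\<in>UNIV. (y - c) $ j * pd j (\<tau> i) (p y s))) (at s)" for i
          unfolding has_field_derivative_def
          by (rule has_derivative_eq_rhs) (auto simp: sum_distrib_right sum_distrib_left algebra_simps)
        then have "((\<lambda>s. s * \<tau> i (p y s)) has_real_derivative
            \<tau> i (p y s) + s * (\<Sum>j\<in>UNIV. (y - c) $ j * pd j (\<tau> i) (p y s))) (at s)" for i
          by (auto intro!: derivative_eq_intros)
        then have "((\<lambda>s. \<chi> i. s * \<tau> i (p y s)) has_vector_derivative
            (\<chi> i. \<tau> i (p y s) + s * (\<Sum>j\<in>UNIV. (y - c) $ j * pd j (\<tau> i) (p y s)))) (at s)"
          unfolding has_vector_derivative_def has_field_derivative_def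
          by (subst has_derivative_componentwise_within)
             (auto simp: Basis_vec_def inner_axis mult_commute_abs)
        moreover have "(\<lambda>s. \<chi> i. s * \<tau> i (p y s)) = (\<lambda>s. s *\<^sub>R T (p y s))"
          by (auto simp: T_def vec_eq_iff)
        moreover have "(\<chi> i. \<tau> i (p y s) + s * (\<Sum>j\<in>UNIV. (y - c) $ j * pd j (\<tau> i) (p y s))) = G y s"
          by (auto simp: G_def T_def vec_eq_iff)
        ultimately show "((\<lambda>s. s *\<^sub>R T (p y s)) has_vector_derivative G y s) (at s within {0..1})"
          by (auto intro: has_vector_derivative_at_within)
      qed simp
      have "((\<lambda>s. blinfun_inner_left (G y s)) has_integral blinfun_inner_left (T y)) (cbox 0 1)"
        using has_integral_linear[OF FT bounded_linear_blinfun_inner_left] by (simp add: o_def p_def)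
      then show ?thesis by (rule integral_unique)
    qed
    ultimately have "(t has_derivative (\<lambda>h. h \<bullet> T y)) (at y within S)"
      by simp
    then show ?thesis
      by (simp add: at_within_open[OF y S(1)] inner_vec_def T_def)
  qed
  then show ?thesis by blast
qed auto

lemma has_derivative_imp_pd:
  "(t has_derivative (\<lambda>h. \<Sum>i\<in>UNIV. h $ i * \<tau> i)) (at y) \<Longrightarrow> pd i t y = \<tau> i"
  by (drule pd_eqI[where i=i]) (simp add: axis_def if_distrib[where f="\<lambda>x. x * _"] cong: if_cong)

text \<open>The gain of one order is what gives the coordinate \<open>t\<close> the class
  \<open>k + 1\<close> required by \<open>coordinates_on\<close>.\<close>

lemma Ck_potential:
  assumes S: "open S" and t: "\<And>y. y \<in> S \<Longrightarrow> (t has_derivative (\<lambda>h. \<Sum>i\<in>UNIV. h $ i * \<tau> i y)) (at y)"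
    and \<tau>: "\<And>i. Ck k S (\<tau> i)"
  shows "Ck (k + 1) S t"
  unfolding Ck_def
proof (intro allI impI)
  fix m assume m: "enat m \<le> k + 1"
  have d: "t differentiable at y" if "y \<in> S" for y
    using t[OF that] by (rule differentiableI)
  show "Ck_nat m S t"
  proof (cases m)
    case 0
    then show ?thesis
      using d by (auto intro!: differentiable_imp_continuous_on simp: differentiable_on_eq_differentiable_at[OF S])
  next
    case (Suc l)
    then have "enat l \<le> k"
      using m by (cases k) (auto simp: one_enat_def)
    then have "Ck_nat l S (\<tau> i)" for i using \<tau> by (auto simp: Ck_def)
    then have "Ck_nat l S (pd i t)" for i
      using Ck_nat_cong[OF S, of "pd i t" "\<tau> i"] has_derivative_imp_pd[OF t] by auto
    then show ?thesis
      unfolding Suc Ck_nat_Suc_iff[OF S] using d by auto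
  qed
qed

section \<open>Local coordinates\<close>

definition coord_map :: "(real^2 \<Rightarrow> real) \<Rightarrow> (real^2 \<Rightarrow> real) \<Rightarrow> real^2 \<Rightarrow> real^2" where
  "coord_map t r y = (\<chi> A. if A = 0 then t y else r y)"

definition jac :: "(real^2 \<Rightarrow> real) \<Rightarrow> (real^2 \<Rightarrow> real) \<Rightarrow> real^2 \<Rightarrow> real" where
  "jac t r y = pd 0 t y * pd 1 r y - pd 1 t y * pd 0 r y"

lemma coord_map_nth: "coord_map t r y $ 0 = t y" "coord_map t r y $ 1 = r y"
  by (auto simp: coord_map_def)

lemma vec2_eq_iff: "(v::'a^2) = w \<longleftrightarrow> v $ 0 = w $ 0 \<and> v $ 1 = w $ 1"
  by (simp add: vec_eq_iff forall_2')

definition coord_deriv :: "(real^2 \<Rightarrow> real) \<Rightarrow> (real^2 \<Rightarrow> real) \<Rightarrow> real^2 \<Rightarrow> real^2 \<Rightarrow> real^2" where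
  "coord_deriv t r y h = (\<chi> A. if A = 0 then h $ 0 * pd 0 t y + h $ 1 * pd 1 t y
     else h $ 0 * pd 0 r y + h $ 1 * pd 1 r y)"

text \<open>Cramer's rule for \<open>coord_deriv\<close>.\<close>

definition coord_deriv_inv :: "(real^2 \<Rightarrow> real) \<Rightarrow> (real^2 \<Rightarrow> real) \<Rightarrow> real^2 \<Rightarrow> real^2 \<Rightarrow> real^2" where
  "coord_deriv_inv t r y h = (\<chi> A. if A = 0 then (h $ 0 * pd 1 r y - h $ 1 * pd 1 t y) / jac t r y
     else (h $ 1 * pd 0 t y - h $ 0 * pd 0 r y) / jac t r y)"

lemma coord_deriv_inverses:
  assumes "jac t r y \<noteq> 0"
  shows "coord_deriv t r y (coord_deriv_inv t r y h) = h" "coord_deriv_inv t r y (coord_deriv t r y h) = h"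
  using assms unfolding vec2_eq_iff
  by (simp_all add: coord_deriv_def coord_deriv_inv_def field_simps) (simp_all add: jac_def algebra_simps)

lemma coord_deriv_eq:
  "coord_deriv t r y = (\<lambda>h. h $ 0 *\<^sub>R coord_deriv t r y (axis 0 1) + h $ 1 *\<^sub>R coord_deriv t r y (axis 1 1))"
  by (rule ext) (simp add: vec2_eq_iff coord_deriv_def axis_def)

lemma coord_deriv_inv_eq:
  "coord_deriv_inv t r y = (\<lambda>h. h $ 0 *\<^sub>R coord_deriv_inv t r y (axis 0 1) + h $ 1 *\<^sub>R coord_deriv_inv t r y (axis 1 1))"
  by (rule ext) (simp add: vec2_eq_iff coord_deriv_inv_def axis_def diff_divide_distrib)

lemma coord_map_has_derivative:
  assumes "t differentiable at y" "r differentiable at y"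
  shows "(coord_map t r has_derivative coord_deriv t r y) (at y)"
proof -
  have "((\<lambda>y. coord_map t r y \<bullet> axis A 1) has_derivative (\<lambda>h. coord_deriv t r y h \<bullet> axis A 1)) (at y)" for A
    using has_derivative_pd[OF assms(1)] has_derivative_pd[OF assms(2)]
    by (cases "A = 0") (simp_all add: coord_map_def coord_deriv_def inner_axis sum_2')
  then show ?thesis
    by (subst has_derivative_componentwise_within) (auto simp: Basis_vec_def)
qed

text \<open>The inverse function theorem, with the neighbourhood cut down until its image is an open
  rectangle. This makes the level sets of \<open>r\<close> connected, so that a function whose
  gradient is parallel to \<open>dr\<close> descends to the radius, and it makes the range of
  \<open>r\<close> an interval.\<close>

lemma local_coordinates:
  assumes V: "open V" "y0 \<in> V" and t: "Ck_nat 1 V t" and r: "Ck_nat 1 V r" and J: "jac t r y0 \<noteq> 0"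
  obtains W a b l u where "open W" "y0 \<in> W" "W \<subseteq> V" "inj_on (\<lambda>y. (t y, r y)) W"
    "\<And>y. y \<in> W \<Longrightarrow> jac t r y \<noteq> 0"
    "(\<lambda>y. (t y, r y)) ` W = {a<..<b} \<times> {l<..<u}"
proof -
  have dt: "t differentiable at y" if "y \<in> V" for y
    using Ck_nat_Suc_D[OF V(1) _ that, of 0] t by simp
  have dr: "r differentiable at y" if "y \<in> V" for y
    using Ck_nat_Suc_D[OF V(1) _ that, of 0] r by simp
  have cont: "continuous_on V (pd i t)" "continuous_on V (pd i r)" for i
    using Ck_nat_1_continuous t r by blast+
  have "continuous_on V (jac t r)"
    unfolding jac_def[abs_def] by (intro continuous_intros cont)
  then have "open (V \<inter> jac t r -` (- {0}))"
    using V(1) by (rule continuous_open_preimage) auto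
  then obtain V' where V': "open V'" "y0 \<in> V'" "V' \<subseteq> V" "\<And>y. y \<in> V' \<Longrightarrow> jac t r y \<noteq> 0"
    using V J by auto
  have bl: "bounded_linear (coord_deriv t r y)" for y
    by (subst coord_deriv_eq) (intro bounded_linear_intros bounded_linear_vec_nth)
  have bli: "bounded_linear (coord_deriv_inv t r y)" for y
    by (subst coord_deriv_inv_eq) (intro bounded_linear_intros bounded_linear_vec_nth)
  define f' where "f' y = Blinfun (coord_deriv t r y)" for y
  have f': "blinfun_apply (f' y) = coord_deriv t r y" for y
    unfolding f'_def by (simp add: bounded_linear_Blinfun_apply bl)
  define e where "e A = Blinfun (\<lambda>h::real^2. h $ A *\<^sub>R (1::real))" for A
  have contf': "continuous_on V' f'"
  proof (rule continuous_on_blinfun_componentwise)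
    fix i :: "real^2" assume "i \<in> Basis"
    have "continuous_on V' (\<lambda>y. coord_deriv t r y i)"
      unfolding coord_deriv_def
      by (rule continuous_on_vec_lambda, rename_tac A, case_tac "A = 0")
         (auto intro!: continuous_intros continuous_on_subset[OF cont(1)] continuous_on_subset[OF cont(2)] V')
    then show "continuous_on V' (\<lambda>y. blinfun_apply (f' y) i)" by (simp add: f')
  qed
  obtain U' V1 g g' where U': "open U'" "U' \<subseteq> V'" "y0 \<in> U'" "open V1" "coord_map t r y0 \<in> V1"
    "homeomorphism U' V1 (coord_map t r) g"
  proof (rule inverse_function_theorem[OF V'(1) _ contf' V'(2), of "coord_map t r" "Blinfun (coord_deriv_inv t r y0)"])
    show "(coord_map t r has_derivative blinfun_apply (f' y)) (at y)" if "y \<in> V'" for y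
      unfolding f' using that V' by (intro coord_map_has_derivative dt dr) auto
    show "Blinfun (coord_deriv_inv t r y0) o\<^sub>L f' y0 = id_blinfun"
      by (rule blinfun_eqI) (simp add: f' bounded_linear_Blinfun_apply[OF bli] coord_deriv_inverses(2) J)
  qed (use that in blast)
  obtain d where d: "d > 0" "ball (coord_map t r y0) d \<subseteq> V1"
    using U'(4,5) open_contains_ball by blast
  \<comment> \<open>The sum of the two coordinate differences bounds the distance, so half the
    radius fits the rectangle into the ball.\<close>
  define \<epsilon> where "\<epsilon> = d / 2"
  define R where "R = {t y0 - \<epsilon><..<t y0 + \<epsilon>} \<times> {r y0 - \<epsilon><..<r y0 + \<epsilon>}"
  define R' where "R' = {v::real^2. (v $ 0, v $ 1) \<in> R}"
  have oR': "open R'"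
  proof -
    have "R' = (\<lambda>v. (v $ 0, v $ 1)) -` R" by (auto simp: R'_def)
    moreover have "open ((\<lambda>v::real^2. (v $ 0, v $ 1)) -` R)"
      by (intro open_vimage continuous_intros) (auto simp: R_def intro: open_Times)
    ultimately show ?thesis by simp
  qed
  have R'V: "R' \<subseteq> V1"
  proof
    fix v assume "v \<in> R'"
    then have b: "\<bar>v $ 0 - t y0\<bar> < \<epsilon>" "\<bar>v $ 1 - r y0\<bar> < \<epsilon>" by (auto simp: R'_def R_def)
    have "norm (v - coord_map t r y0) \<le> (\<Sum>A\<in>UNIV. \<bar>(v - coord_map t r y0) $ A\<bar>)"
      by (rule norm_le_l1_cart)
    also have "\<dots> < d" using b by (simp add: sum_2' coord_map_nth \<epsilon>_def)
    finally show "v \<in> V1" using d(2) by (auto simp: dist_norm norm_minus_commute)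
  qed
  define W where "W = U' \<inter> coord_map t r -` R'"
  have hom: "\<And>y. y \<in> U' \<Longrightarrow> g (coord_map t r y) = y" "\<And>v. v \<in> V1 \<Longrightarrow> g v \<in> U' \<and> coord_map t r (g v) = v"
    "continuous_on U' (coord_map t r)"
    using U'(6) by (auto simp: homeomorphism_def)
  have iff: "(t y, r y) \<in> R \<longleftrightarrow> coord_map t r y \<in> R'" for y
    by (simp add: R'_def coord_map_nth)
  show ?thesis
  proof (rule that[of W])
    show "open W" unfolding W_def using hom(3) U'(1) oR' by (simp add: continuous_on_open_vimage Int_commute)
    show "y0 \<in> W" using U'(3) d by (auto simp: W_def iff[symmetric] R_def \<epsilon>_def)
    show "W \<subseteq> V" using U'(2) V'(3) by (auto simp: W_def)
    show "inj_on (\<lambda>y. (t y, r y)) W"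
    proof (rule inj_onI)
      fix x y assume "x \<in> W" "y \<in> W" "(t x, r x) = (t y, r y)"
      then have "coord_map t r x = coord_map t r y" "x \<in> U'" "y \<in> U'" by (auto simp: coord_map_def W_def)
      then show "x = y" using hom(1) by metis
    qed
    show "jac t r y \<noteq> 0" if "y \<in> W" for y
      using that V'(4) U'(2) by (auto simp: W_def)
    show "(\<lambda>y. (t y, r y)) ` W = {t y0 - \<epsilon><..<t y0 + \<epsilon>} \<times> {r y0 - \<epsilon><..<r y0 + \<epsilon>}"
      unfolding R_def[symmetric]
    proof (intro equalityI subsetI)
      fix q assume "q \<in> R"
      define v where "v = (\<chi> A::2. if A = 0 then fst q else snd q)"
      have v: "v \<in> R'" using \<open>q \<in> R\<close> by (simp add: R'_def v_def)
      then have "g v \<in> U'" "coord_map t r (g v) = v" using hom(2) R'V by blast+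
      moreover have "(t (g v), r (g v)) = q"
        unfolding coord_map_nth(1)[of t r, symmetric] coord_map_nth(2)[of t r, symmetric] \<open>coord_map t r (g v) = v\<close>
        by (simp add: v_def)
      ultimately show "q \<in> (\<lambda>y. (t y, r y)) ` W"
        using v by (auto simp: W_def intro!: image_eqI[of _ _ "g v"])
    qed (auto simp: W_def iff)
  qed
qed

text \<open>Along the coordinate lines of \<open>(t, r)\<close>, Cramer's rule turns the derivatives
  of \<open>h\<close> into quotients of Jacobians. The last claim says that the radius takes all
  values near \<open>r y\<close> on the line of constant \<open>t\<close>, so that identities
  between profiles may be differentiated in the radius.\<close>

lemma coord_curve:
  assumes W: "open W" "y \<in> W" and t: "Ck_nat 1 W t" and r: "Ck_nat 1 W r"
    and inj: "inj_on (\<lambda>y. (t y, r y)) W" and J: "jac t r y \<noteq> 0" and h: "h differentiable at y"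
  defines "\<psi> \<equiv> \<lambda>s x. inv_into W (\<lambda>y. (t y, r y)) (s, x)"
  shows "((\<lambda>x. h (\<psi> (t y) x)) has_real_derivative (pd 0 t y * pd 1 h y - pd 1 t y * pd 0 h y) / jac t r y) (at (r y))"
    and "((\<lambda>s. h (\<psi> s (r y))) has_real_derivative (pd 1 r y * pd 0 h y - pd 0 r y * pd 1 h y) / jac t r y) (at (t y))"
    and "\<forall>\<^sub>F x in nhds (r y). \<psi> (t y) x \<in> W \<and> r (\<psi> (t y) x) = x"
proof -
  have dt: "t differentiable at y" and dr: "r differentiable at y"
    using Ck_nat_Suc_D[OF W(1) _ W(2), of 0] t r by simp_all
  define \<Phi> where "\<Phi> = coord_map t r"
  define g where "g v = inv_into W (\<lambda>y. (t y, r y)) (v $ 0, v $ 1)" for v :: "real^2"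
  have g: "g (\<Phi> z) = z" if "z \<in> W" for z
    using inv_into_f_f[OF inj that] by (simp add: g_def \<Phi>_def coord_map_nth)
  have cont\<Phi>: "continuous_on W \<Phi>"
    unfolding \<Phi>_def coord_map_def
    by (rule continuous_on_vec_lambda, rename_tac A, case_tac "A = 0")
       (use Ck_nat_1_continuous(1)[OF t] Ck_nat_1_continuous(1)[OF r] in auto)
  have inj\<Phi>: "inj_on \<Phi> W" by (rule inj_on_inverseI[of _ g]) (rule g)
  \<comment> \<open>The Jacobian is assumed nonzero at \<open>y\<close> alone, so openness of the
    image comes from invariance of domain.\<close>
  have op: "open (\<Phi> ` W)"
    by (rule invariance_of_domain[OF cont\<Phi> W(1) inj\<Phi>])
  have dg: "(g has_derivative coord_deriv_inv t r y) (at (\<Phi> y))"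
  proof (rule has_derivative_inverse_strong[OF W cont\<Phi> g])
    show "(\<Phi> has_derivative coord_deriv t r y) (at y)"
      unfolding \<Phi>_def by (rule coord_map_has_derivative[OF dt dr])
    show "coord_deriv t r y \<circ> coord_deriv_inv t r y = id"
      using coord_deriv_inverses[OF J] by auto
  qed auto
  have dh: "((\<lambda>v. h (g v)) has_derivative (\<lambda>v. \<Sum>i\<in>UNIV. coord_deriv_inv t r y v $ i *\<^sub>R pd i h y)) (at (\<Phi> y))"
    using has_derivative_compose[OF dg, of h] has_derivative_pd[OF h] g[OF W(2)] by simp
  have line: "((\<lambda>x. p + x *\<^sub>R axis A 1) has_derivative (\<lambda>x. x *\<^sub>R axis A 1)) (at x)" for p :: "real^2" and A x
    by (auto intro!: derivative_eq_intros)
  have e1: "\<Phi> y = t y *\<^sub>R axis 0 1 + r y *\<^sub>R axis 1 1" "\<Phi> y = r y *\<^sub>R axis 1 1 + t y *\<^sub>R axis 0 1"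
    by (simp_all add: vec2_eq_iff \<Phi>_def coord_map_nth axis_def)
  have p1: "g (t y *\<^sub>R axis 0 1 + x *\<^sub>R axis 1 1) = \<psi> (t y) x" for x
    by (simp add: g_def \<psi>_def axis_def)
  have p2: "g (r y *\<^sub>R axis 1 1 + s *\<^sub>R axis 0 1) = \<psi> s (r y)" for s
    by (simp add: g_def \<psi>_def axis_def)
  from has_derivative_compose[OF line dh[unfolded e1(1)]]
  show "((\<lambda>x. h (\<psi> (t y) x)) has_real_derivative (pd 0 t y * pd 1 h y - pd 1 t y * pd 0 h y) / jac t r y) (at (r y))"
    unfolding p1 has_field_derivative_def
    by (rule has_derivative_eq_rhs)
       (auto simp: sum_2' coord_deriv_inv_def axis_def diff_divide_distrib algebra_simps)
  from has_derivative_compose[OF line dh[unfolded e1(2)]]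
  show "((\<lambda>s. h (\<psi> s (r y))) has_real_derivative (pd 1 r y * pd 0 h y - pd 0 r y * pd 1 h y) / jac t r y) (at (t y))"
    unfolding p2 has_field_derivative_def
    by (rule has_derivative_eq_rhs)
       (auto simp: sum_2' coord_deriv_inv_def axis_def diff_divide_distrib algebra_simps)
  have "open ((\<lambda>x. t y *\<^sub>R axis 0 1 + x *\<^sub>R axis 1 (1::real) :: real^2) -` (\<Phi> ` W))"
    using op by (rule open_vimage) (intro continuous_intros)
  moreover have "r y \<in> (\<lambda>x. t y *\<^sub>R axis 0 1 + x *\<^sub>R axis 1 (1::real) :: real^2) -` (\<Phi> ` W)"
    using imageI[OF W(2), of \<Phi>] unfolding e1(1) by simp
  ultimately have "\<forall>\<^sub>F x in nhds (r y). x \<in> (\<lambda>x. t y *\<^sub>R axis 0 1 + x *\<^sub>R axis 1 (1::real) :: real^2) -` (\<Phi> ` W)"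
    by (rule eventually_nhds_in_open)
  then have "\<forall>\<^sub>F x in nhds (r y). t y *\<^sub>R axis 0 1 + x *\<^sub>R axis 1 1 \<in> \<Phi> ` W"
    by simp
  then show "\<forall>\<^sub>F x in nhds (r y). \<psi> (t y) x \<in> W \<and> r (\<psi> (t y) x) = x"
  proof (rule eventually_mono)
    fix x assume "t y *\<^sub>R axis 0 1 + x *\<^sub>R axis 1 1 \<in> \<Phi> ` W"
    then obtain z where z: "z \<in> W" "\<Phi> z = t y *\<^sub>R axis 0 1 + x *\<^sub>R axis 1 1" by auto
    have "\<psi> (t y) x = z" using g[OF z(1)] z(2) p1 by simp
    moreover have "r z = x" using arg_cong[OF z(2), of "\<lambda>v. v $ 1"] by (simp add: \<Phi>_def coord_map_nth axis_def)
    ultimately show "\<psi> (t y) x \<in> W \<and> r (\<psi> (t y) x) = x" using z(1) by simp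
  qed
qed

text \<open>The hypothesis \<open>par\<close> says that the derivative of \<open>h\<close> along the
  lines of constant radius vanishes, and in the rectangle each such line is an interval.\<close>

lemma function_of_coordinate:
  assumes W: "open W" and t: "Ck_nat 1 W t" and r: "Ck_nat 1 W r"
    and inj: "inj_on (\<lambda>y. (t y, r y)) W" and J: "\<And>y. y \<in> W \<Longrightarrow> jac t r y \<noteq> 0"
    and im: "(\<lambda>y. (t y, r y)) ` W = {a<..<b} \<times> {l<..<v}"
    and h: "\<And>y. y \<in> W \<Longrightarrow> h differentiable at y"
    and par: "\<And>y. y \<in> W \<Longrightarrow> pd 1 r y * pd 0 h y = pd 0 r y * pd 1 h y"
  shows "\<exists>u. \<forall>y\<in>W. h y = u (r y) \<and>
    (u has_real_derivative (pd 0 t y * pd 1 h y - pd 1 t y * pd 0 h y) / jac t r y) (at (r y))"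
proof -
  define \<psi> where "\<psi> s x = inv_into W (\<lambda>y. (t y, r y)) (s, x)" for s x
  have \<psi>: "\<psi> s x \<in> W" "t (\<psi> s x) = s" "r (\<psi> s x) = x" if "s \<in> {a<..<b}" "x \<in> {l<..<v}" for s x
  proof -
    have "(s, x) \<in> (\<lambda>y. (t y, r y)) ` W" using im that by auto
    from inv_into_into[OF this] f_inv_into_f[OF this]
    show "\<psi> s x \<in> W" "t (\<psi> s x) = s" "r (\<psi> s x) = x" by (auto simp: \<psi>_def)
  qed
  have \<psi>': "\<psi> (t y) (r y) = y" if "y \<in> W" for y
    using inv_into_f_f[OF inj that] by (simp add: \<psi>_def)
  have range: "t y \<in> {a<..<b}" "r y \<in> {l<..<v}" if "y \<in> W" for y
    using im that by blast+
  \<comment> \<open>The midpoint serves as a reference value of \<open>t\<close>; it lies in the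
    interval whenever the latter is nonempty.\<close>
  define u where "u x = h (\<psi> ((a + b) / 2) x)" for x
  have hu: "h (\<psi> s x) = u x" if s: "s \<in> {a<..<b}" and x: "x \<in> {l<..<v}" for s x
  proof -
    have "((\<lambda>s. h (\<psi> s x)) has_real_derivative 0) (at s within {a<..<b})" if "s \<in> {a<..<b}" for s
      using coord_curve(2)[OF W \<psi>(1)[OF that x] t r inj J[OF \<psi>(1)[OF that x]] h[OF \<psi>(1)[OF that x]]]
        par[OF \<psi>(1)[OF that x]] that x
      by (auto simp: \<psi>_def[symmetric] \<psi> intro: has_field_derivative_at_within)
    then obtain c where "\<forall>s\<in>{a<..<b}. h (\<psi> s x) = c"
      using has_field_derivative_zero_constant[of "{a<..<b}" "\<lambda>s. h (\<psi> s x)"] by auto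
    moreover have "(a + b) / 2 \<in> {a<..<b}" using s by auto
    ultimately show ?thesis using s unfolding u_def by metis
  qed
  have "h y = u (r y)" if "y \<in> W" for y
    using hu[OF range[OF that]] \<psi>'[OF that] by simp
  moreover have "(u has_real_derivative (pd 0 t y * pd 1 h y - pd 1 t y * pd 0 h y) / jac t r y) (at (r y))"
    if y: "y \<in> W" for y
  proof (rule has_field_derivative_transform_within_open)
    show "((\<lambda>x. h (\<psi> (t y) x)) has_real_derivative (pd 0 t y * pd 1 h y - pd 1 t y * pd 0 h y) / jac t r y) (at (r y))"
      using coord_curve(1)[OF W y t r inj J[OF y] h[OF y]] by (simp add: \<psi>_def)
    show "r y \<in> {l<..<v}" using range[OF y] by simp
    show "h (\<psi> (t y) x) = u x" if "x \<in> {l<..<v}" for x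
      using hu[OF range(1)[OF y] that] .
  qed auto
  ultimately show ?thesis by blast
qed

text \<open>A profile known only through \<open>h y = u (r y)\<close> inherits its derivative from
  \<open>h\<close>, read along the curve of constant \<open>t\<close>. This supplies the derivative
  of \<open>F\<close> in the converse direction, where no regularity of \<open>F\<close> is
  given.\<close>

lemma profile_derivative:
  assumes W: "open W" "y \<in> W" and t: "Ck_nat 1 W t" and r: "Ck_nat 1 W r"
    and inj: "inj_on (\<lambda>y. (t y, r y)) W" and J: "jac t r y \<noteq> 0" and h: "h differentiable at y"
    and hu: "\<And>y. y \<in> W \<Longrightarrow> h y = u (r y)"
  shows "(u has_real_derivative (pd 0 t y * pd 1 h y - pd 1 t y * pd 0 h y) / jac t r y) (at (r y))"
proof -
  note c = coord_curve[OF W t r inj J h]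
  have "\<forall>\<^sub>F x in nhds (r y). h (inv_into W (\<lambda>y. (t y, r y)) (t y, x)) = u x"
    using c(3) by (rule eventually_mono) (use hu in auto)
  from iffD1[OF DERIV_cong_ev[OF refl this refl] c(1)] show ?thesis .
qed

section \<open>Two-dimensional metrics\<close>

lemma pd_cdivide:
  fixes f :: "real^'i::finite \<Rightarrow> real"
  shows "f differentiable at x \<Longrightarrow> pd i (\<lambda>x. f x / c) x = pd i f x / c"
  using pd_cmult[of f x i "inverse c"] by (simp add: divide_inverse mult.commute)

lemma matrix_inv_unique:
  fixes A B :: "real^'n^'n"
  assumes "A ** B = mat 1"
  shows "matrix_inv A = B"
proof -
  have BA: "B ** A = mat 1" using assms matrix_left_right_inverse by blast
  have "A ** matrix_inv A = mat 1 \<and> matrix_inv A ** A = mat 1"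
    unfolding matrix_inv_def by (rule someI[of _ B]) (use assms BA in auto)
  then have "B ** (A ** matrix_inv A) = B" by simp
  then show ?thesis by (simp add: matrix_mul_assoc BA)
qed

definition det2 :: "real^2^2 \<Rightarrow> real" where
  "det2 G = G $ 0 $ 0 * G $ 1 $ 1 - G $ 0 $ 1 * G $ 1 $ 0"

lemma matrix_inv_2:
  fixes G :: "real^2^2"
  assumes "det2 G \<noteq> 0"
  shows "matrix_inv G $ 0 $ 0 = G $ 1 $ 1 / det2 G" "matrix_inv G $ 0 $ 1 = - G $ 0 $ 1 / det2 G"
    "matrix_inv G $ 1 $ 0 = - G $ 1 $ 0 / det2 G" "matrix_inv G $ 1 $ 1 = G $ 0 $ 0 / det2 G"
proof -
  define B :: "real^2^2" where "B = (\<chi> i j. if i = 0 then (if j = 0 then G $ 1 $ 1 / det2 G else - G $ 0 $ 1 / det2 G)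
     else (if j = 0 then - G $ 1 $ 0 / det2 G else G $ 0 $ 0 / det2 G))"
  have "G ** B = mat 1"
    using assms
    by (simp add: vec2_eq_iff matrix_matrix_mult_def mat_def sum_2' B_def field_simps)
       (simp add: det2_def algebra_simps)
  from matrix_inv_unique[OF this]
  show "matrix_inv G $ 0 $ 0 = G $ 1 $ 1 / det2 G" "matrix_inv G $ 0 $ 1 = - G $ 0 $ 1 / det2 G"
    "matrix_inv G $ 1 $ 0 = - G $ 1 $ 0 / det2 G" "matrix_inv G $ 1 $ 1 = G $ 0 $ 0 / det2 G"
    by (simp_all add: B_def)
qed

definition hess :: "2 tensor2 \<Rightarrow> (real^2 \<Rightarrow> real) \<Rightarrow> 2 \<Rightarrow> 2 \<Rightarrow> real^2 \<Rightarrow> real" where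
  "hess g r A B y = pd A (pd B r) y - (\<Sum>C\<in>UNIV. christoffel g C A B y * pd C r y)"

definition lapl :: "2 tensor2 \<Rightarrow> (real^2 \<Rightarrow> real) \<Rightarrow> real^2 \<Rightarrow> real" where
  "lapl g r y = (\<Sum>A\<in>UNIV. \<Sum>B\<in>UNIV. matrix_inv (g y) $ A $ B * hess g r A B y)"

definition grad_up :: "2 tensor2 \<Rightarrow> (real^2 \<Rightarrow> real) \<Rightarrow> 2 \<Rightarrow> real^2 \<Rightarrow> real" where
  "grad_up g r A y = (\<Sum>B\<in>UNIV. matrix_inv (g y) $ A $ B * pd B r y)"

text \<open>Christoffel symbols of the first kind. They are linear in the derivatives of the metric,
  so the symmetries of the curvature reduce to commuting partial derivatives.\<close>

definition lowered_christoffel :: "2 tensor2 \<Rightarrow> 2 \<Rightarrow> 2 \<Rightarrow> 2 \<Rightarrow> real^2 \<Rightarrow> real" where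
  "lowered_christoffel g \<xi> \<mu> \<nu> y =
     1/2 * (pd \<mu> (\<lambda>y. g y $ \<xi> $ \<nu>) y + pd \<nu> (\<lambda>y. g y $ \<mu> $ \<xi>) y - pd \<xi> (\<lambda>y. g y $ \<mu> $ \<nu>) y)"

definition lowered_riemann :: "2 tensor2 \<Rightarrow> 2 \<Rightarrow> 2 \<Rightarrow> 2 \<Rightarrow> 2 \<Rightarrow> real^2 \<Rightarrow> real" where
  "lowered_riemann g \<xi> \<sigma> \<mu> \<nu> y = (\<Sum>\<rho>\<in>UNIV. g y $ \<xi> $ \<rho> * riemann g \<rho> \<sigma> \<mu> \<nu> y)"

text \<open>\<open>R\<^sub>0\<^sub>1\<^sub>0\<^sub>1\<close> over the determinant; on a surface this
  single component carries the whole Riemann tensor.\<close>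

definition gauss_curvature :: "2 tensor2 \<Rightarrow> real^2 \<Rightarrow> real" where
  "gauss_curvature g y = lowered_riemann g 0 1 0 1 y / det2 (g y)"

locale metric2 =
  fixes S :: "(real^2) set" and g :: "2 tensor2"
  assumes open_S: "open S"
    and g_C2: "\<And>A B. Ck_nat 2 S (\<lambda>y. g y $ A $ B)"
    and g_sym: "\<And>y A B. y \<in> S \<Longrightarrow> g y $ A $ B = g y $ B $ A"
    and g_det: "\<And>y. y \<in> S \<Longrightarrow> det2 (g y) \<noteq> 0"
begin

abbreviation "\<Gamma> \<equiv> christoffel g"
abbreviation "gi y \<equiv> matrix_inv (g y)"
abbreviation "cl \<equiv> lowered_christoffel g"

section \<open>The Levi-Civita connection of a two-dimensional metric\<close>

lemma g_C2': "Ck_nat (Suc (Suc 0)) S (\<lambda>y. g y $ A $ B)"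
  using g_C2 by (simp add: numeral_2_eq_2)

lemma g_diff: "y \<in> S \<Longrightarrow> (\<lambda>y. g y $ A $ B) differentiable at y"
  using Ck_nat_Suc_D[OF open_S g_C2'] by blast

lemma dg_C1: "Ck_nat 1 S (pd C (\<lambda>y. g y $ A $ B))"
  using Ck_nat_pd[OF g_C2'] by simp

lemma Ck1_diff: "Ck_nat 1 S h \<Longrightarrow> y \<in> S \<Longrightarrow> h differentiable at y"
  using Ck_nat_Suc_D[OF open_S, of 0 h] by simp

lemma pd_g_sym: "y \<in> S \<Longrightarrow> pd C (\<lambda>y. g y $ A $ B) y = pd C (\<lambda>y. g y $ B $ A) y"
  by (rule pd_cong[OF open_S]) (use g_sym in auto)

lemma gi:
  assumes "y \<in> S"
  shows "gi y $ 0 $ 0 = g y $ 1 $ 1 / det2 (g y)" "gi y $ 0 $ 1 = - g y $ 0 $ 1 / det2 (g y)"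
    "gi y $ 1 $ 0 = - g y $ 0 $ 1 / det2 (g y)" "gi y $ 1 $ 1 = g y $ 0 $ 0 / det2 (g y)"
  using matrix_inv_2[OF g_det[OF assms]] g_sym[OF assms] by simp_all

lemma g_gi:
  assumes y: "y \<in> S"
  shows "(\<Sum>B\<in>UNIV. g y $ A $ B * gi y $ B $ C) = (if A = C then 1 else 0)"
    and "(\<Sum>B\<in>UNIV. gi y $ A $ B * g y $ B $ C) = (if A = C then 1 else 0)"
  using exhaust_2'[of A] exhaust_2'[of C] g_det[OF y] g_sym[OF y, of 1 0]
  by (auto simp: sum_2' gi[OF y] divide_simps) (auto simp: det2_def algebra_simps)

lemma g_gi_mat:
  assumes y: "y \<in> S"
  shows "g y ** gi y = mat 1" "gi y ** g y = mat 1"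
  using g_gi[OF y] by (simp_all add: vec_eq_iff matrix_matrix_mult_def mat_def)

lemma det_Ck: "(\<And>A B. Ck_nat k S (\<lambda>y. g y $ A $ B)) \<Longrightarrow> Ck_nat k S (\<lambda>y. det2 (g y))"
  unfolding det2_def by (intro Ck_nat_diff Ck_nat_mult open_S)

lemma gi_Ck:
  assumes "\<And>A B. Ck_nat k S (\<lambda>y. g y $ A $ B)"
  shows "Ck_nat k S (\<lambda>y. gi y $ A $ B)"
proof -
  have "Ck_nat k S (\<lambda>y. g y $ C $ D / det2 (g y))" "Ck_nat k S (\<lambda>y. - g y $ C $ D / det2 (g y))" for C D
    by (intro Ck_nat_divide Ck_nat_minus open_S assms det_Ck g_det; assumption)+
  then show ?thesis
    using exhaust_2'[of A] exhaust_2'[of B]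
      Ck_nat_cong[OF open_S gi(1), where k=k] Ck_nat_cong[OF open_S gi(2), where k=k]
      Ck_nat_cong[OF open_S gi(3), where k=k] Ck_nat_cong[OF open_S gi(4), where k=k] by auto
qed

lemmas det_C2 = det_Ck[OF g_C2] and gi_C2 = gi_Ck[OF g_C2]

lemma gi_diff: "y \<in> S \<Longrightarrow> (\<lambda>y. gi y $ A $ B) differentiable at y"
  using Ck_nat_mono[OF gi_C2, of 1] Ck1_diff by simp

lemma christoffel_cl: "\<Gamma> \<kappa> \<mu> \<nu> y = (\<Sum>\<sigma>\<in>UNIV. gi y $ \<kappa> $ \<sigma> * cl \<sigma> \<mu> \<nu> y)"
  by (simp add: christoffel_def lowered_christoffel_def)

lemma cl_sym: "y \<in> S \<Longrightarrow> cl \<xi> \<mu> \<nu> y = cl \<xi> \<nu> \<mu> y"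
  unfolding lowered_christoffel_def using pd_g_sym[of y \<mu> \<xi> \<nu>] pd_g_sym[of y \<nu> \<xi> \<mu>] pd_g_sym[of y \<xi> \<mu> \<nu>] by simp

lemma christoffel_sym: "y \<in> S \<Longrightarrow> \<Gamma> \<kappa> \<mu> \<nu> y = \<Gamma> \<kappa> \<nu> \<mu> y"
  unfolding christoffel_cl using cl_sym by simp

lemma cl_C1: "Ck_nat 1 S (cl \<xi> \<mu> \<nu>)"
  unfolding lowered_christoffel_def[abs_def]
  by (intro Ck_nat_mult Ck_nat_add Ck_nat_diff Ck_nat_const open_S dg_C1)

lemma christoffel_C1: "Ck_nat 1 S (\<Gamma> \<kappa> \<mu> \<nu>)"
  unfolding christoffel_cl[abs_def]
  by (intro Ck_nat_sum Ck_nat_mult open_S cl_C1 Ck_nat_mono[OF gi_C2]) auto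

lemma christoffel_diff: "y \<in> S \<Longrightarrow> \<Gamma> \<kappa> \<mu> \<nu> differentiable at y"
  using christoffel_C1 Ck1_diff by blast

lemma g_christoffel:
  assumes "y \<in> S"
  shows "(\<Sum>\<kappa>\<in>UNIV. g y $ \<xi> $ \<kappa> * \<Gamma> \<kappa> \<mu> \<nu> y) = cl \<xi> \<mu> \<nu> y"
proof -
  have "(\<Sum>\<kappa>\<in>UNIV. g y $ \<xi> $ \<kappa> * \<Gamma> \<kappa> \<mu> \<nu> y) = (\<Sum>\<sigma>\<in>UNIV. (\<Sum>\<kappa>\<in>UNIV. g y $ \<xi> $ \<kappa> * gi y $ \<kappa> $ \<sigma>) * cl \<sigma> \<mu> \<nu> y)"
    unfolding christoffel_cl sum_2' by (simp add: algebra_simps)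
  then show ?thesis
    using exhaust_2'[of \<xi>] by (auto simp: g_gi[OF assms] sum_2')
qed

lemma pd_g_cl: "y \<in> S \<Longrightarrow> pd \<mu> (\<lambda>y. g y $ \<xi> $ \<nu>) y = cl \<xi> \<mu> \<nu> y + cl \<nu> \<mu> \<xi> y"
  unfolding lowered_christoffel_def
  using pd_g_sym[of y \<mu> \<xi> \<nu>] pd_g_sym[of y \<nu> \<xi> \<mu>] pd_g_sym[of y \<xi> \<mu> \<nu>] by (simp add: field_simps)

lemma pd_g: "y \<in> S \<Longrightarrow> pd \<mu> (\<lambda>y. g y $ \<xi> $ \<nu>) y =
    (\<Sum>\<kappa>\<in>UNIV. g y $ \<xi> $ \<kappa> * \<Gamma> \<kappa> \<mu> \<nu> y) + (\<Sum>\<kappa>\<in>UNIV. g y $ \<nu> $ \<kappa> * \<Gamma> \<kappa> \<mu> \<xi> y)"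
  by (simp add: pd_g_cl g_christoffel)

text \<open>The inverse metric is covariantly constant: differentiate
  \<open>gi y ** g y = mat 1\<close> and insert metric compatibility, written as
  \<open>g y ** G + transpose G ** g y\<close> with the matrix \<open>G\<close> of the connection in
  direction \<open>\<mu>\<close>.\<close>

lemma pd_gi:
  assumes y: "y \<in> S"
  shows "pd \<mu> (\<lambda>y. gi y $ A $ B) y =
    - (\<Sum>C\<in>UNIV. \<Gamma> A \<mu> C y * gi y $ C $ B + gi y $ A $ C * \<Gamma> B \<mu> C y)"
proof -
  define d :: "real^2^2" where "d = (\<chi> A B. pd \<mu> (\<lambda>y. gi y $ A $ B) y)"
  define G :: "real^2^2" where "G = (\<chi> A B. \<Gamma> A \<mu> B y)"
  have dg: "(\<chi> A B. pd \<mu> (\<lambda>y. g y $ A $ B) y) = g y ** G + transpose G ** g y"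
    using g_sym[OF y, of 1 0] christoffel_sym[OF y]
    by (simp add: vec2_eq_iff matrix_matrix_mult_def transpose_def sum_2' G_def pd_g[OF y] algebra_simps)
  have "d ** g y = - (gi y ** (\<chi> A B. pd \<mu> (\<lambda>y. g y $ A $ B) y))"
  proof -
    have "pd \<mu> (\<lambda>y. \<Sum>B\<in>UNIV. gi y $ A $ B * g y $ B $ C) y = 0" for A C
      using pd_cong[OF open_S y, of "\<lambda>y. \<Sum>B\<in>UNIV. gi y $ A $ B * g y $ B $ C" "\<lambda>y. if A = C then 1 else 0"] g_gi(2)
      by simp
    then have "(\<Sum>B\<in>UNIV. pd \<mu> (\<lambda>y. gi y $ A $ B) y * g y $ B $ C + gi y $ A $ B * pd \<mu> (\<lambda>y. g y $ B $ C) y) = 0" for A C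
      by (simp add: pd_sum pd_mult gi_diff[OF y] g_diff[OF y] differentiable_mult)
    then show ?thesis
      by (simp add: vec_eq_iff matrix_matrix_mult_def d_def sum.distrib eq_neg_iff_add_eq_0)
  qed
  then have "d ** g y ** gi y = - (gi y ** (g y ** G + transpose G ** g y)) ** gi y"
    unfolding dg by simp
  moreover have "- (gi y ** (g y ** G + transpose G ** g y)) ** gi y
      = - ((gi y ** g y) ** G ** gi y + gi y ** transpose G ** (g y ** gi y))"
    by (simp add: vec2_eq_iff matrix_matrix_mult_def sum_2' algebra_simps)
  ultimately have "d = - (G ** gi y + gi y ** transpose G)"
    using matrix_mul_assoc[of d "g y" "gi y"] by (simp add: g_gi_mat[OF y])
  then have "d $ A $ B = - (G ** gi y + gi y ** transpose G) $ A $ B" by simp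
  then show ?thesis
    by (simp add: d_def G_def matrix_matrix_mult_def transpose_def sum.distrib)
qed

text \<open>Jacobi's formula combined with metric compatibility: the trace of the connection is the
  logarithmic derivative of the volume density.\<close>

lemma pd_det:
  assumes y: "y \<in> S"
  shows "pd \<mu> (\<lambda>y. det2 (g y)) y = 2 * det2 (g y) * (\<Sum>B\<in>UNIV. \<Gamma> B B \<mu> y)"
proof -
  have "pd \<mu> (\<lambda>y. det2 (g y)) y = pd \<mu> (\<lambda>y. g y $ 0 $ 0) y * g y $ 1 $ 1 + g y $ 0 $ 0 * pd \<mu> (\<lambda>y. g y $ 1 $ 1) y
     - (pd \<mu> (\<lambda>y. g y $ 0 $ 1) y * g y $ 1 $ 0 + g y $ 0 $ 1 * pd \<mu> (\<lambda>y. g y $ 1 $ 0) y)"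
    unfolding det2_def by (simp add: pd_diff pd_mult g_diff[OF y] differentiable_mult)
  also have "\<dots> = 2 * det2 (g y) * (\<Gamma> 0 \<mu> 0 y + \<Gamma> 1 \<mu> 1 y)"
    unfolding pd_g[OF y] sum_2' det2_def g_sym[OF y, of 1 0] by algebra
  finally show ?thesis
    by (simp add: sum_2' christoffel_sym[OF y, of _ \<mu>])
qed

section \<open>Curvature of a two-dimensional metric\<close>

lemma riemann_antisym: "riemann g \<rho> \<sigma> \<mu> \<nu> y = - riemann g \<rho> \<sigma> \<nu> \<mu> y"
  by (simp add: riemann_def sum_subtractf)

text \<open>Lowering the index brings the curvature into a shape where antisymmetry in
  \<open>\<xi>\<close> and \<open>\<sigma>\<close> can be checked separately on the second
  derivatives of the metric and on the quadratic terms.\<close>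

lemma lowered_riemann_eq:
  assumes y: "y \<in> S"
  shows "lowered_riemann g \<xi> \<sigma> \<mu> \<nu> y = pd \<mu> (cl \<xi> \<nu> \<sigma>) y - pd \<nu> (cl \<xi> \<mu> \<sigma>) y
    - (\<Sum>\<rho>\<in>UNIV. cl \<rho> \<mu> \<xi> y * \<Gamma> \<rho> \<nu> \<sigma> y - cl \<rho> \<nu> \<xi> y * \<Gamma> \<rho> \<mu> \<sigma> y)"
proof -
  have d: "pd a (cl \<xi> b \<sigma>) y = (\<Sum>\<rho>\<in>UNIV. (cl \<xi> a \<rho> y + cl \<rho> a \<xi> y) * \<Gamma> \<rho> b \<sigma> y + g y $ \<xi> $ \<rho> * pd a (\<Gamma> \<rho> b \<sigma>) y)" for a b
  proof -
    have "pd a (cl \<xi> b \<sigma>) y = pd a (\<lambda>y. \<Sum>\<rho>\<in>UNIV. g y $ \<xi> $ \<rho> * \<Gamma> \<rho> b \<sigma> y) y"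
      by (rule pd_cong[OF open_S y]) (simp add: g_christoffel)
    also have "\<dots> = (\<Sum>\<rho>\<in>UNIV. pd a (\<lambda>y. g y $ \<xi> $ \<rho>) y * \<Gamma> \<rho> b \<sigma> y + g y $ \<xi> $ \<rho> * pd a (\<Gamma> \<rho> b \<sigma>) y)"
      by (simp add: pd_sum pd_mult g_diff[OF y] christoffel_diff[OF y] differentiable_mult)
    finally show ?thesis by (simp add: pd_g_cl[OF y])
  qed
  show ?thesis
    unfolding d lowered_riemann_def riemann_def g_christoffel[OF y, symmetric, of \<xi>] sum_2'
    by (simp add: algebra_simps)
qed

lemma lowered_riemann_antisym:
  assumes y: "y \<in> S"
  shows "lowered_riemann g \<xi> \<sigma> \<mu> \<nu> y = - lowered_riemann g \<sigma> \<xi> \<mu> \<nu> y"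
proof -
  have dd: "pd a (cl \<xi> b \<sigma>) y = 1/2 * (pd a (pd b (\<lambda>y. g y $ \<xi> $ \<sigma>)) y + pd a (pd \<sigma> (\<lambda>y. g y $ b $ \<xi>)) y - pd a (pd \<xi> (\<lambda>y. g y $ b $ \<sigma>)) y)"
    for a b \<xi> \<sigma>
    unfolding lowered_christoffel_def[abs_def]
    by (simp add: pd_cdivide pd_add pd_diff Ck1_diff[OF dg_C1 y])
  have s: "pd a (pd b (\<lambda>y. g y $ c $ d)) y = pd a (pd b (\<lambda>y. g y $ d $ c)) y" for a b c d
    by (rule pd_cong[OF open_S y]) (rule pd_g_sym)
  have c: "pd a (pd b (\<lambda>y. g y $ c $ d)) y = pd b (pd a (\<lambda>y. g y $ c $ d)) y" for a b c d
    by (rule pd_commute[OF open_S g_C2 y])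
  have "pd \<mu> (cl \<xi> \<nu> \<sigma>) y - pd \<nu> (cl \<xi> \<mu> \<sigma>) y = - (pd \<mu> (cl \<sigma> \<nu> \<xi>) y - pd \<nu> (cl \<sigma> \<mu> \<xi>) y)"
    unfolding dd using c[of \<mu> \<nu>] s[of \<mu> \<nu> \<xi> \<sigma>] c[of \<nu> \<mu>] s[of \<nu> \<mu> \<xi> \<sigma>] by (simp add: field_simps)
  \<comment> \<open>Both sides are the metric applied to the two connection vectors with lower
    indices \<open>\<mu> \<xi>\<close> and \<open>\<nu> \<sigma>\<close>.\<close>
  moreover have "(\<Sum>\<rho>\<in>UNIV. cl \<rho> \<mu> \<xi> y * \<Gamma> \<rho> \<nu> \<sigma> y) = (\<Sum>\<rho>\<in>UNIV. cl \<rho> \<nu> \<sigma> y * \<Gamma> \<rho> \<mu> \<xi> y)" for \<xi> \<sigma> \<mu> \<nu>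
    unfolding g_christoffel[OF y, symmetric] sum_2' g_sym[OF y, of 1 0] by algebra
  ultimately show ?thesis
    unfolding lowered_riemann_eq[OF y] sum_subtractf by simp
qed

lemma riemann_lowered:
  assumes y: "y \<in> S"
  shows "riemann g \<rho> \<sigma> \<mu> \<nu> y = (\<Sum>\<xi>\<in>UNIV. gi y $ \<rho> $ \<xi> * lowered_riemann g \<xi> \<sigma> \<mu> \<nu> y)"
proof -
  have "(\<Sum>\<xi>\<in>UNIV. gi y $ \<rho> $ \<xi> * lowered_riemann g \<xi> \<sigma> \<mu> \<nu> y)
     = (\<Sum>\<tau>\<in>UNIV. (\<Sum>\<xi>\<in>UNIV. gi y $ \<rho> $ \<xi> * g y $ \<xi> $ \<tau>) * riemann g \<tau> \<sigma> \<mu> \<nu> y)"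
    unfolding lowered_riemann_def sum_2' by algebra
  then show ?thesis
    using exhaust_2'[of \<rho>] by (auto simp: g_gi[OF y] sum_2')
qed

lemma lowered_riemann_cases:
  assumes y: "y \<in> S"
  shows "lowered_riemann g A A C D y = 0" "lowered_riemann g A B C C y = 0"
    "lowered_riemann g 1 0 C D y = - lowered_riemann g 0 1 C D y"
    "lowered_riemann g A B 1 0 y = - lowered_riemann g A B 0 1 y"
  using lowered_riemann_antisym[OF y, of A A C D] lowered_riemann_antisym[OF y, of 1 0 C D]
    riemann_antisym[of _ B C C y] riemann_antisym[of _ B 1 0 y]
  by (simp_all add: lowered_riemann_def sum_negf)

text \<open>All components of the lowered curvature are multiples of one, and the cofactors in the
  inverse metric turn the contraction back into the metric itself.\<close>

lemma ricci2:
  assumes y: "y \<in> S"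
  shows "ricci g y $ A $ B = gauss_curvature g y * g y $ A $ B"
  using exhaust_2'[of A] exhaust_2'[of B] g_sym[OF y, of 1 0]
  by (auto simp: ricci_def riemann_lowered[OF y] sum_2' lowered_riemann_cases[OF y] gi[OF y] gauss_curvature_def)

section \<open>Gradient, Hessian and Laplacian of a function on the surface\<close>

context
  fixes r :: "real^2 \<Rightarrow> real"
  assumes r_C3: "Ck_nat 3 S r"
begin

lemma r_C3': "Ck_nat (Suc (Suc (Suc 0))) S r"
  using r_C3 by (simp add: numeral_3_eq_3)

lemma r_diff: "y \<in> S \<Longrightarrow> r differentiable at y"
  using Ck_nat_Suc_D[OF open_S r_C3'] .

lemma dr_C2: "Ck_nat 2 S (pd A r)"
  using Ck_nat_pd[OF r_C3'] by (simp add: numeral_2_eq_2)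

lemma dr_diff: "y \<in> S \<Longrightarrow> pd A r differentiable at y"
  using Ck_nat_mono[OF dr_C2, of 1] Ck1_diff by simp

lemma ddr_diff: "y \<in> S \<Longrightarrow> pd A (pd B r) differentiable at y"
  using Ck_nat_pd[OF Ck_nat_pd[OF r_C3']] Ck1_diff by simp

lemma ddr_sym: "y \<in> S \<Longrightarrow> pd A (pd B r) y = pd B (pd A r) y"
  using pd_commute[OF open_S Ck_nat_mono[OF r_C3]] by simp

lemma hess_sym: "y \<in> S \<Longrightarrow> hess g r A B y = hess g r B A y"
  by (simp add: hess_def ddr_sym[of y A B] christoffel_sym[of y _ A B])

lemma grad_up_diff: "y \<in> S \<Longrightarrow> grad_up g r A differentiable at y"
  unfolding grad_up_def[abs_def] by (simp add: sum_2' gi_diff dr_diff differentiable_mult differentiable_add)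

lemma pd_grad_up:
  assumes y: "y \<in> S"
  shows "pd C (grad_up g r A) y =
    (\<Sum>B\<in>UNIV. gi y $ A $ B * hess g r C B y - \<Gamma> A C B y * grad_up g r B y)"
proof -
  have "pd C (grad_up g r A) y = (\<Sum>B\<in>UNIV. pd C (\<lambda>y. gi y $ A $ B) y * pd B r y + gi y $ A $ B * pd C (pd B r) y)"
    unfolding grad_up_def[abs_def] by (simp add: pd_sum pd_mult gi_diff[OF y] dr_diff[OF y] differentiable_mult)
  then show ?thesis
    unfolding pd_gi[OF y] grad_up_def hess_def sum_2' by algebra
qed

text \<open>The left side is the covariant divergence of the gradient, written in coordinates. It
  occurs in this raw form both in the angular Ricci tensor and in the exterior derivative of
  \<open>\<tau>\<close>.\<close>

lemma divergence_grad:
  assumes y: "y \<in> S"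
  shows "(\<Sum>C\<in>UNIV. pd C (grad_up g r C) y) + (\<Sum>C\<in>UNIV. (\<Sum>B\<in>UNIV. \<Gamma> B B C y) * grad_up g r C y) = lapl g r y"
  unfolding pd_grad_up[OF y] lapl_def sum_2' gi(3)[OF y] gi(2)[OF y] hess_sym[OF y, of 1 0]
    christoffel_sym[OF y, of _ 1 0] by algebra

lemma grad_square_eq: "grad_square g r y = (\<Sum>A\<in>UNIV. grad_up g r A y * pd A r y)"
  unfolding grad_square_def grad_up_def sum_2' by algebra

lemma grad_square_diff: "y \<in> S \<Longrightarrow> grad_square g r differentiable at y"
  unfolding grad_square_eq[abs_def] by (simp add: sum_2' grad_up_diff dr_diff differentiable_mult differentiable_add)

lemma pd_grad_square:
  assumes y: "y \<in> S"
  shows "pd C (grad_square g r) y = 2 * (\<Sum>A\<in>UNIV. grad_up g r A y * hess g r A C y)"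
proof -
  have "pd C (grad_square g r) y = (\<Sum>A\<in>UNIV. pd C (grad_up g r A) y * pd A r y + grad_up g r A y * pd C (pd A r) y)"
    unfolding grad_square_eq[abs_def]
    by (simp add: pd_sum pd_mult grad_up_diff[OF y] dr_diff[OF y] differentiable_mult)
  also have "\<dots> = 2 * (\<Sum>A\<in>UNIV. grad_up g r A y * hess g r C A y)"
    unfolding pd_grad_up[OF y] grad_up_def hess_def sum_2' gi(3)[OF y] gi(2)[OF y] by algebra
  finally show ?thesis by (simp add: hess_sym[OF y, of _ C])
qed

text \<open>The Ricci identity applied to \<open>dr\<close>.\<close>

lemma gauss_curvature_hess:
  assumes y: "y \<in> S" and q: "q differentiable at y" "\<And>A. pd A q y = q' * pd A r y"
    and h: "\<And>y A B. y \<in> S \<Longrightarrow> hess g r A B y = 1/2 * q y * g y $ A $ B"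
    and nz: "grad_square g r y \<noteq> 0"
  shows "gauss_curvature g y = - q' / 2"
proof -
  have ddr: "pd A (pd B r) z = 1/2 * q z * g z $ A $ B + (\<Sum>C\<in>UNIV. \<Gamma> C A B z * pd C r z)" if "z \<in> S" for A B z
    using h[OF that, of A B] by (simp add: hess_def)
  have dddr: "pd D (pd A (pd B r)) y = 1/2 * (q' * pd D r y * g y $ A $ B + q y * pd D (\<lambda>y. g y $ A $ B) y)
      + (\<Sum>C\<in>UNIV. pd D (\<Gamma> C A B) y * pd C r y + \<Gamma> C A B y * pd D (pd C r) y)" for A B D
  proof -
    have "pd D (pd A (pd B r)) y = pd D (\<lambda>z. 1/2 * (q z * g z $ A $ B) + (\<Sum>C\<in>UNIV. \<Gamma> C A B z * pd C r z)) y"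
      by (rule pd_cong[OF open_S y]) (simp add: ddr)
    then show ?thesis
      using q by (simp add: pd_add pd_cdivide pd_mult pd_sum g_diff[OF y] christoffel_diff[OF y] dr_diff[OF y]
          differentiable_mult differentiable_sum)
  qed
  have sym3: "pd 0 (pd 1 (pd B r)) y = pd 1 (pd 0 (pd B r)) y" for B
    by (rule pd_commute[OF open_S dr_C2 y])
  \<comment> \<open>The two orders of the third derivative of \<open>r\<close> agree. The terms with
    \<open>q\<close> itself cancel by metric compatibility, and what remains is the Riemann tensor
    applied to \<open>dr\<close>.\<close>
  have R: "(\<Sum>C\<in>UNIV. riemann g C B 0 1 y * pd C r y) = - 1/2 * q' * (pd 0 r y * g y $ 1 $ B - pd 1 r y * g y $ 0 $ B)" for B
  proof -
    have "cl 1 0 B y - cl 0 1 B y = pd 0 (\<lambda>y. g y $ 1 $ B) y - pd 1 (\<lambda>y. g y $ 0 $ B) y"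
      unfolding lowered_christoffel_def using pd_g_sym[OF y, of B 0 1] by (simp add: field_simps)
    with sym3[of B] show ?thesis
      unfolding dddr ddr[OF y] riemann_def g_christoffel[OF y, symmetric] sum_2' by algebra
  qed
  have "(\<Sum>C\<in>UNIV. riemann g C B 0 1 y * pd C r y) = (\<Sum>A\<in>UNIV. grad_up g r A y * lowered_riemann g A B 0 1 y)" for B
    unfolding riemann_lowered[OF y] grad_up_def sum_2' gi(3)[OF y] gi(2)[OF y] by algebra
  note R' = R[unfolded this sum_2']
  have up: "grad_up g r 0 y * det2 (g y) = g y $ 1 $ 1 * pd 0 r y - g y $ 0 $ 1 * pd 1 r y"
    "grad_up g r 1 y * det2 (g y) = g y $ 0 $ 0 * pd 1 r y - g y $ 0 $ 1 * pd 0 r y"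
    using g_det[OF y] by (simp_all add: grad_up_def sum_2' gi[OF y] field_simps)
  have R1: "grad_up g r 0 y * lowered_riemann g 0 1 0 1 y = - 1/2 * q' * (pd 0 r y * g y $ 1 $ 1 - pd 1 r y * g y $ 0 $ 1)"
    using R'[of 1] lowered_riemann_cases[OF y] by simp
  have R0: "- (grad_up g r 1 y * lowered_riemann g 0 1 0 1 y) = - 1/2 * q' * (pd 0 r y * g y $ 0 $ 1 - pd 1 r y * g y $ 0 $ 0)"
    using R'[of 0] lowered_riemann_cases[OF y] g_sym[OF y, of 1 0] by simp
  have "grad_up g r 0 y * (lowered_riemann g 0 1 0 1 y + q' / 2 * det2 (g y))
      = grad_up g r 0 y * lowered_riemann g 0 1 0 1 y + q' / 2 * (grad_up g r 0 y * det2 (g y))"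
    by (simp add: algebra_simps)
  then have "grad_up g r 0 y * (lowered_riemann g 0 1 0 1 y + q' / 2 * det2 (g y)) = 0"
    unfolding R1 up by (simp add: field_simps)
  moreover have "grad_up g r 1 y * (lowered_riemann g 0 1 0 1 y + q' / 2 * det2 (g y))
      = - (- (grad_up g r 1 y * lowered_riemann g 0 1 0 1 y)) + q' / 2 * (grad_up g r 1 y * det2 (g y))"
    by (simp add: algebra_simps)
  then have "grad_up g r 1 y * (lowered_riemann g 0 1 0 1 y + q' / 2 * det2 (g y)) = 0"
    unfolding R0 up by (simp add: field_simps)
  \<comment> \<open>The same bracket gives zero when multiplied by either component of the gradient,
    so one nonzero component suffices.\<close>
  moreover have "grad_up g r 0 y \<noteq> 0 \<or> grad_up g r 1 y \<noteq> 0"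
    using nz by (auto simp: grad_square_eq sum_2')
  ultimately have "lowered_riemann g 0 1 0 1 y + q' / 2 * det2 (g y) = 0" by auto
  then show ?thesis using g_det[OF y] by (simp add: gauss_curvature_def field_simps)
qed

end

end

section \<open>The sphere in stereographic coordinates\<close>

text \<open>The chart metric is the square of this factor times the flat one, for both poles alike,
  so the sign \<open>s\<close> drops out of the metric and survives in the orientation of the
  charts.\<close>

definition conf_factor :: "real^'m::finite \<Rightarrow> real" where
  "conf_factor z = 2 / (z \<bullet> z + 1)"

lemma conf_factor_pos: "conf_factor z > 0"
  by (simp add: conf_factor_def add_nonneg_pos)

lemma conf_factor_inner: "conf_factor z * (z \<bullet> z + 1) = 2"
proof -
  have "z \<bullet> z + 1 > 0" by (simp add: add_nonneg_pos)
  then have ne: "z \<bullet> z + 1 \<noteq> 0" by simp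
  show ?thesis by (simp only: conf_factor_def times_divide_eq_left nonzero_mult_div_cancel_right[OF ne])
qed

lemma stereo_eq: "stereo s z = (conf_factor z *\<^sub>R z, s * (1 - conf_factor z))"
proof -
  have "z \<bullet> z + 1 > 0" by (simp add: add_nonneg_pos)
  then show ?thesis by (simp add: stereo_def conf_factor_def field_simps)
qed

lemma conf_factor_has_derivative:
  "(conf_factor has_derivative (\<lambda>h. - (conf_factor z)\<^sup>2 * (z \<bullet> h))) (at (z::real^'m::finite))"
proof -
  have "z \<bullet> z + 1 > 0" by (simp add: add_nonneg_pos)
  then show ?thesis unfolding conf_factor_def
    by (auto intro!: derivative_eq_intros simp: inner_commute power2_eq_square field_simps)
qed

lemma conf_factor_diff: "conf_factor differentiable at z"
  using conf_factor_has_derivative differentiableI by blast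

lemma pd_conf_factor: "pd i conf_factor z = - (conf_factor z)\<^sup>2 * z $ i"
  using pd_eqI[OF conf_factor_has_derivative] by (simp add: inner_axis)

lemma pd_stereo:
  "pd i (stereo s) z = (conf_factor z *\<^sub>R axis i 1 - ((conf_factor z)\<^sup>2 * z $ i) *\<^sub>R z, s * (conf_factor z)\<^sup>2 * z $ i)"
proof -
  have "(stereo s has_derivative (\<lambda>h. (conf_factor z *\<^sub>R h + (- (conf_factor z)\<^sup>2 * (z \<bullet> h)) *\<^sub>R z,
      s * ((conf_factor z)\<^sup>2 * (z \<bullet> h))))) (at z)"
    unfolding stereo_eq[abs_def]
    by (auto intro!: derivative_eq_intros has_derivative_Pair conf_factor_has_derivative)
  from pd_eqI[OF this] show ?thesis by (simp add: inner_axis)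
qed

lemma sphere_metric_eq:
  assumes s: "s \<in> {1, -1}"
  shows "sphere_metric s z $ i $ j = (if i = j then (conf_factor z)\<^sup>2 else 0)"
proof -
  have ss: "s * s = 1" using s by auto
  define l where "l = conf_factor z"
  define q where "q = z \<bullet> z"
  have l: "l * (q + 1) = 2" unfolding l_def q_def by (rule conf_factor_inner)
  have "sphere_metric s z $ i $ j = l * l * (if i = j then 1 else 0) - 2 * (l * l * l * z $ i * z $ j)
     + l * l * z $ i * (l * l * z $ j) * q + s * s * (l * l * z $ i * (l * l * z $ j))"
    unfolding sphere_metric_def pd_stereo l_def[symmetric] q_def
    by (simp add: inner_diff_left inner_diff_right inner_axis_axis inner_axis inner_axis' power2_eq_square algebra_simps)
       (auto simp: axis_def)
  also have "\<dots> = l * l * (if i = j then 1 else 0) + l * l * l * z $ i * z $ j * (l * (q + 1) - 2)"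
    unfolding ss by (simp add: algebra_simps)
  finally show ?thesis unfolding l by (simp add: power2_eq_square l_def)
qed

text \<open>The explicit inverse divides the first components by \<open>d = 1 - s * c\<close>, which
  turns out to be the conformal factor at the preimage; it vanishes only at the pole of
  projection.\<close>

lemma stereo_surj:
  assumes p: "p \<in> sphere 0 1" and s: "s \<in> {1, -1}" and ne: "s * snd p \<noteq> 1"
  shows "\<exists>z. stereo s z = p"
proof -
  obtain v c where pv: "p = (v, c)" by (cases p)
  have ss: "s * s = 1" using s by auto
  have n: "v \<bullet> v + c * c = 1"
    using p unfolding pv by (simp add: norm_eq_sqrt_inner)
  define d where "d = 1 - s * c"
  have d: "d \<noteq> 0" using ne by (simp add: d_def pv)
  define z where "z = (1 / d) *\<^sub>R v"
  have "z \<bullet> z + 1 = (v \<bullet> v + d * d) / (d * d)"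
    using d by (simp add: z_def field_simps)
  also have "v \<bullet> v + d * d = 2 * d"
    using n ss unfolding d_def by algebra
  finally have "conf_factor z = d" using d by (simp add: conf_factor_def)
  then have "stereo s z = (v, s * (1 - d))"
    using d by (simp add: stereo_eq z_def)
  also have "s * (1 - d) = c" using ss by (simp add: d_def mult.assoc[symmetric])
  finally show ?thesis by (auto simp: pv)
qed

text \<open>For a combination with coefficients \<open>a\<close> the last component is
  \<open>s * (l * l * (a \<bullet> z))\<close>. This determines \<open>a \<bullet> z\<close>, and
  then the first components determine \<open>a\<close>; orthogonality to the point makes the two
  conditions consistent.\<close>

lemma tangent_decomposition:
  assumes s: "s \<in> {1, -1}" and u: "u \<bullet> stereo s z = 0"
  shows "u = (\<Sum>i\<in>UNIV. ((fst u $ i + s * snd u * z $ i) / conf_factor z) *\<^sub>R pd i (stereo s) z)"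
proof -
  obtain v c where uv: "u = (v, c)" by (cases u)
  have ss: "s * s = 1" using s by auto
  define l where "l = conf_factor z"
  define q where "q = z \<bullet> z"
  have lq: "l * (q + 1) = 2" unfolding l_def q_def by (rule conf_factor_inner)
  have l0: "l > 0" unfolding l_def by (rule conf_factor_pos)
  have orth: "l * (v \<bullet> z) + c * (s * (1 - l)) = 0"
    using u by (simp add: uv stereo_eq l_def)
  define a where "a = (1 / l) *\<^sub>R (v + (s * c) *\<^sub>R z)"
  have az: "l * l * (a \<bullet> z) = s * c"
  proof -
    have "l * l * (a \<bullet> z) = l * (v \<bullet> z) + s * c * (l * q)"
      using l0 by (simp add: a_def inner_add_left q_def field_simps)
    also have "\<dots> = s * c" using orth lq by algebra
    finally show ?thesis .
  qed
  have "(\<Sum>i\<in>UNIV. a $ i *\<^sub>R pd i (stereo s) z) = (l *\<^sub>R a - (l * l * (a \<bullet> z)) *\<^sub>R z, s * (l * l * (a \<bullet> z)))"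
  proof -
    have "fst (\<Sum>i\<in>UNIV. a $ i *\<^sub>R pd i (stereo s) z) $ j = (l *\<^sub>R a - (l * l * (a \<bullet> z)) *\<^sub>R z) $ j" for j
      by (simp add: fst_sum pd_stereo l_def[symmetric] power2_eq_square axis_def inner_vec_def
        if_distrib[where f="\<lambda>x. _ * x"] sum_subtractf sum_distrib_left sum_distrib_right algebra_simps cong: if_cong)
    moreover have "snd (\<Sum>i\<in>UNIV. a $ i *\<^sub>R pd i (stereo s) z) = s * (l * l * (a \<bullet> z))"
      by (simp add: snd_sum pd_stereo l_def[symmetric] power2_eq_square inner_vec_def sum_distrib_left algebra_simps)
    ultimately show ?thesis by (simp add: prod_eq_iff vec_eq_iff)
  qed
  also have "\<dots> = (v, s * s * c)"
    unfolding az using l0 by (simp add: a_def)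
  finally show ?thesis
    by (simp add: ss uv a_def l_def)
qed

section \<open>Two-forms on the sphere in stereographic and polar frames\<close>

lemma form_comp_expansion:
  fixes \<omega> :: "'m::finite sphere_form"
  assumes s: "s \<in> {1, -1}" and bil: "bilinear (\<omega> (stereo s z))"
    and u: "u \<bullet> stereo s z = 0" and v: "v \<bullet> stereo s z = 0"
  shows "\<omega> (stereo s z) u v = (\<Sum>i\<in>UNIV. \<Sum>j\<in>UNIV. (fst u $ i + s * snd u * z $ i) / conf_factor z *
     ((fst v $ j + s * snd v * z $ j) / conf_factor z) * sphere_form_comp \<omega> s z $ i $ j)"
proof -
  define a where "a i = (fst u $ i + s * snd u * z $ i) / conf_factor z" for i
  define b where "b i = (fst v $ i + s * snd v * z $ i) / conf_factor z" for i
  have "\<omega> (stereo s z) u v = \<omega> (stereo s z) (\<Sum>i\<in>UNIV. a i *\<^sub>R pd i (stereo s) z) (\<Sum>j\<in>UNIV. b j *\<^sub>R pd j (stereo s) z)"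
    using tangent_decomposition[OF s u] tangent_decomposition[OF s v] by (simp add: a_def b_def)
  also have "\<dots> = (\<Sum>i\<in>UNIV. \<Sum>j\<in>UNIV. a i * b j * sphere_form_comp \<omega> s z $ i $ j)"
    unfolding bilinear_sum[OF bil] sum.cartesian_product[symmetric]
    by (simp add: bilinear_lmul[OF bil] bilinear_rmul[OF bil] sphere_form_comp_def mult.assoc mult.left_commute sum_distrib_left)
  finally show ?thesis by (simp add: a_def b_def)
qed

lemma pd_stereo_orth:
  assumes s: "s \<in> {1, -1}"
  shows "pd i (stereo s) z \<bullet> stereo s z = 0"
proof -
  have ss: "s * s = 1" using s by auto
  define l where "l = conf_factor z"
  define q where "q = z \<bullet> z"
  have lq: "l * (q + 1) = 2" unfolding l_def q_def by (rule conf_factor_inner)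
  have "pd i (stereo s) z \<bullet> stereo s z = l * l * z $ i - l * l * l * z $ i * q + s * s * (l * l * z $ i * (1 - l))"
    by (simp add: pd_stereo stereo_eq l_def[symmetric] q_def inner_diff_left inner_axis' power2_eq_square algebra_simps)
  also have "\<dots> = l * l * z $ i * (2 - l * (q + 1))"
    unfolding ss by (simp add: algebra_simps)
  finally show ?thesis by (simp add: lq)
qed

text \<open>Each chart misses one point, and the two missing points differ, so the charts cover the
  sphere; in each of them the chart vectors span the tangent space.\<close>

lemma vanishes_on_sphere_iff:
  fixes \<omega> :: "'m::finite sphere_form"
  assumes bil: "\<And>p. p \<in> sphere 0 1 \<Longrightarrow> bilinear (\<omega> p)"
  shows "vanishes_on_sphere \<omega> \<longleftrightarrow> (\<forall>s\<in>{1, -1}. \<forall>z. sphere_form_comp \<omega> s z = 0)"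
proof
  assume "vanishes_on_sphere \<omega>"
  note v = this[unfolded vanishes_on_sphere_def, rule_format]
  show "\<forall>s\<in>{1, -1}. \<forall>z. sphere_form_comp \<omega> s z = 0"
  proof (intro ballI allI)
    fix s :: real and z :: "real^'m" assume s: "s \<in> {1, -1}"
    show "sphere_form_comp \<omega> s z = 0"
      using v[OF stereo_in_sphere[OF s] pd_stereo_orth[OF s] pd_stereo_orth[OF s]]
      by (simp add: vec_eq_iff sphere_form_comp_def)
  qed
next
  assume 0: "\<forall>s\<in>{1, -1}. \<forall>z. sphere_form_comp \<omega> s z = 0"
  show "vanishes_on_sphere \<omega>"
    unfolding vanishes_on_sphere_def
  proof (intro ballI allI impI)
    fix p :: "(real^'m) \<times> real" and u v
    assume p: "p \<in> sphere 0 1" and uv: "u \<bullet> p = 0" "v \<bullet> p = 0"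
    \<comment> \<open>The chart whose pole of projection is not \<open>p\<close>.\<close>
    define s :: real where "s = (if snd p = 1 then -1 else 1)"
    have s: "s \<in> {1, -1}" and "s * snd p \<noteq> 1" by (auto simp: s_def)
    then obtain z where z: "stereo s z = p" using stereo_surj[OF p] by blast
    have "sphere_form_comp \<omega> s z = 0" using 0 s by blast
    then show "\<omega> p u v = 0"
      using form_comp_expansion[OF s, of \<omega> z u v] bil[OF p] uv by (simp add: z)
  qed
qed

lemma polar_in_sphere:
  assumes "e1 \<noteq> e2"
  shows "polar e1 e2 \<theta> \<phi> \<in> sphere 0 1"
proof -
  have ip: "(axis e1 a + axis e2 b :: real^'a) \<bullet> (axis e1 c + axis e2 d) = a * c + b * d" for a b c d :: real
    using assms by (simp add: inner_add_left inner_add_right inner_axis_axis)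
  have sc: "sin x * sin x + cos x * cos x = 1" for x :: real
    using sin_cos_squared_add[of x] by (simp add: power2_eq_square)
  have "polar e1 e2 \<theta> \<phi> \<bullet> polar e1 e2 \<theta> \<phi> = 1"
    unfolding polar_def inner_Pair ip inner_real_def using sc[of \<phi>] sc[of \<theta>] by algebra
  then show ?thesis by (simp add: norm_eq_sqrt_inner)
qed

text \<open>The quotient of \<open>- s * sin \<theta>\<close> by the squared conformal factor is the
  Jacobian between the polar and the chart frame. Its sign records that the two stereographic charts
  are oppositely oriented, and it reappears in the chart components of the monopole form.\<close>

lemma polar_comp:
  fixes \<omega> :: "'m::finite sphere_form"
  assumes s: "s \<in> {1, -1}" and e: "e1 \<noteq> e2" "UNIV = {e1, e2::'m}"
    and bil: "bilinear (\<omega> (stereo s z))" and alt: "\<And>u. \<omega> (stereo s z) u u = 0"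
    and z: "stereo s z = polar e1 e2 \<theta> \<phi>"
  shows "\<omega> (polar e1 e2 \<theta> \<phi>) (polar_dtheta e1 e2 \<theta> \<phi>) (polar_dphi e1 e2 \<theta> \<phi>) * (conf_factor z)\<^sup>2
    = - s * sin \<theta> * sphere_form_comp \<omega> s z $ e1 $ e2"
proof -
  have ss: "s * s = 1" using s by auto
  note d = polar_has_vector_derivative[THEN vector_derivative_at]
  have ip: "(axis e1 a + axis e2 b :: real^'m) \<bullet> (axis e1 c + axis e2 d) = a * c + b * d" for a b c d :: real
    using e by (simp add: inner_add_left inner_add_right inner_axis_axis)
  have sc: "sin x * sin x + cos x * cos x = 1" for x :: real
    using sin_cos_squared_add[of x] by (simp add: power2_eq_square)
  have orth1: "polar_dtheta e1 e2 \<theta> \<phi> \<bullet> stereo s z = 0"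
    unfolding d unfolding z polar_def inner_Pair ip inner_real_def using sc[of \<phi>] by algebra
  have orth2: "polar_dphi e1 e2 \<theta> \<phi> \<bullet> stereo s z = 0"
    unfolding d unfolding z polar_def inner_Pair ip inner_real_def by (simp add: mult_ac)
  define F where "F = sphere_form_comp \<omega> s z"
  have skew: "\<omega> (stereo s z) u v = - \<omega> (stereo s z) v u" for u v
    using alt[of "u + v"] alt[of u] alt[of v] by (simp add: bilinear_ladd[OF bil] bilinear_radd[OF bil])
  have F: "F $ i $ i = 0" "F $ e2 $ e1 = - F $ e1 $ e2" for i
    using alt skew[of "pd e2 (stereo s) z" "pd e1 (stereo s) z"] by (simp_all add: F_def sphere_form_comp_def)
  define l where "l = conf_factor z"
  have l0: "l > 0" unfolding l_def by (rule conf_factor_pos)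
  have zz: "l *\<^sub>R z = axis e1 (sin \<theta> * cos \<phi>) + axis e2 (sin \<theta> * sin \<phi>)" "s * (1 - l) = cos \<theta>"
    using z by (simp_all add: stereo_eq polar_def l_def)
  have lz: "l * z $ e1 = sin \<theta> * cos \<phi>" "l * z $ e2 = sin \<theta> * sin \<phi>" "s * (1 - l) = cos \<theta>"
    using arg_cong[OF zz(1), of "\<lambda>v. v $ e1"] arg_cong[OF zz(1), of "\<lambda>v. v $ e2"] e(1) zz(2)
    by (simp_all add: axis_def)
  note ex = form_comp_expansion[where \<omega>=\<omega>, OF s bil orth1 orth2]
  have w: "\<omega> (polar e1 e2 \<theta> \<phi>) (polar_dtheta e1 e2 \<theta> \<phi>) (polar_dphi e1 e2 \<theta> \<phi>)
    = (cos \<theta> * cos \<phi> - s * sin \<theta> * z $ e1) / l * (sin \<theta> * cos \<phi> / l) * F $ e1 $ e2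
     - (cos \<theta> * sin \<phi> - s * sin \<theta> * z $ e2) / l * (- sin \<theta> * sin \<phi> / l) * F $ e1 $ e2"
    unfolding z[symmetric] ex unfolding e(2) d F_def[symmetric] l_def[symmetric]
    using e(1) F by (simp add: axis_def)
  have "\<omega> (polar e1 e2 \<theta> \<phi>) (polar_dtheta e1 e2 \<theta> \<phi>) (polar_dphi e1 e2 \<theta> \<phi>) * l ^ 3
    = ((cos \<theta> * cos \<phi> * l - s * sin \<theta> * (l * z $ e1)) * (sin \<theta> * cos \<phi>)
       + (cos \<theta> * sin \<phi> * l - s * sin \<theta> * (l * z $ e2)) * (sin \<theta> * sin \<phi>)) * F $ e1 $ e2"
    unfolding w using l0 by (simp add: field_simps power3_eq_cube)
  also have "\<dots> = sin \<theta> * (cos \<theta> * l - s * (sin \<theta> * sin \<theta>)) * F $ e1 $ e2"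
    unfolding lz using sc[of \<phi>] by algebra
  \<comment> \<open>Since \<open>cos \<theta> = s * (1 - l)\<close>, this is a polynomial identity
    in \<open>l\<close>.\<close>
  also have "cos \<theta> * l - s * (sin \<theta> * sin \<theta>) = - s * l"
    using sc[of \<theta>] ss unfolding lz(3)[symmetric] by algebra
  finally have "l * (\<omega> (polar e1 e2 \<theta> \<phi>) (polar_dtheta e1 e2 \<theta> \<phi>) (polar_dphi e1 e2 \<theta> \<phi>) * l\<^sup>2)
      = l * (- s * sin \<theta> * F $ e1 $ e2)"
    by (simp add: power3_eq_cube power2_eq_square mult_ac)
  moreover have "l \<noteq> 0" using l0 by simp
  ultimately show ?thesis
    unfolding F_def l_def[symmetric] using mult_left_cancel by blast
qed

lemma polar_surj:
  assumes e: "e1 \<noteq> e2" "UNIV = {e1, e2::'m::finite}" and p: "p \<in> sphere 0 1" and ne: "fst p \<noteq> (0::real^'m)"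
  shows "\<exists>\<theta>\<in>{0<..<pi}. \<exists>\<phi>. polar e1 e2 \<theta> \<phi> = p"
proof -
  obtain v c where pv: "p = (v, c)" by (cases p)
  have n: "v \<bullet> v + c\<^sup>2 = 1"
    using p unfolding pv by (simp add: norm_eq_sqrt_inner power2_eq_square)
  have v: "v \<bullet> v > 0" using ne by (simp add: pv)
  with n have "c\<^sup>2 < 1" by linarith
  then have c: "-1 < c" "c < 1" using abs_square_less_1[of c] by auto
  define \<theta> where "\<theta> = arccos c"
  have \<theta>: "\<theta> \<in> {0<..<pi}" "cos \<theta> = c"
    using arccos_lt_bounded[OF c] c by (auto simp: \<theta>_def)
  have st: "sin \<theta> > 0" using \<theta>(1) by (simp add: sin_gt_zero)
  have "v \<bullet> v = v $ e1 * v $ e1 + v $ e2 * v $ e2"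
    unfolding inner_vec_def e(2) using e(1) by simp
  then have "(v $ e1 / sin \<theta>)\<^sup>2 + (v $ e2 / sin \<theta>)\<^sup>2 = (v \<bullet> v) / (sin \<theta>)\<^sup>2"
    by (simp add: power_divide power2_eq_square add_divide_distrib)
  also have "v \<bullet> v = (sin \<theta>)\<^sup>2"
    using n sin_cos_squared_add[of \<theta>] \<theta>(2) by simp
  finally have "(v $ e1 / sin \<theta>)\<^sup>2 + (v $ e2 / sin \<theta>)\<^sup>2 = 1" using st by simp
  then obtain \<phi> where "v $ e1 / sin \<theta> = cos \<phi>" "v $ e2 / sin \<theta> = sin \<phi>"
    using sincos_total_2pi by metis
  then have "sin \<theta> * cos \<phi> = v $ e1" "sin \<theta> * sin \<phi> = v $ e2" using st by (auto simp: field_simps)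
  moreover have "i = e1 \<or> i = e2" for i using e(2) by auto
  ultimately have "polar e1 e2 \<theta> \<phi> = p"
    using e(1) \<theta>(2) by (auto simp: polar_def pv vec_eq_iff axis_def)
  then show ?thesis using \<theta>(1) by blast
qed

text \<open>Polar coordinates miss the poles, one of which is the origin of the chart; the value
  there follows by continuity from the complement of the origin.\<close>

lemma monopole_comp:
  fixes \<omega> :: "'m::finite sphere_form"
  assumes e: "e1 \<noteq> e2" "UNIV = {e1, e2::'m}"
    and bil: "\<And>p. p \<in> sphere 0 1 \<Longrightarrow> bilinear (\<omega> p)" and alt: "\<And>p u. p \<in> sphere 0 1 \<Longrightarrow> \<omega> p u u = 0"
    and cont: "continuous_on UNIV (\<lambda>z. sphere_form_comp \<omega> s z $ e1 $ e2)"
    and s: "s \<in> {1, -1}" and mono: "is_monopole_form e1 e2 Q \<omega>"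
  shows "sphere_form_comp \<omega> s z $ e1 $ e2 = - s * Q * (conf_factor z)\<^sup>2"
proof -
  define D where "D z = sphere_form_comp \<omega> s z $ e1 $ e2 + s * Q * (conf_factor z)\<^sup>2" for z
  have ss: "s * s = 1" using s by auto
  have nz: "D z = 0" if "z \<noteq> 0" for z
  proof -
    note p = stereo_in_sphere[OF s, of z]
    have "fst (stereo s z) \<noteq> 0" using that conf_factor_pos[of z] by (simp add: stereo_eq)
    then obtain \<theta> \<phi> where t: "\<theta> \<in> {0<..<pi}" "polar e1 e2 \<theta> \<phi> = stereo s z"
      using polar_surj[OF e p] by blast
    have "\<omega> (polar e1 e2 \<theta> \<phi>) (polar_dtheta e1 e2 \<theta> \<phi>) (polar_dphi e1 e2 \<theta> \<phi>) = Q * sin \<theta>"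
      using mono t(1) unfolding is_monopole_form_def by blast
    moreover have "\<omega> (polar e1 e2 \<theta> \<phi>) (polar_dtheta e1 e2 \<theta> \<phi>) (polar_dphi e1 e2 \<theta> \<phi>) * (conf_factor z)\<^sup>2
      = - s * sin \<theta> * sphere_form_comp \<omega> s z $ e1 $ e2"
      by (rule polar_comp[OF s e]) (fact bil[OF p] alt[OF p] t(2)[symmetric])+
    ultimately have "Q * sin \<theta> * (conf_factor z)\<^sup>2 = - s * sin \<theta> * sphere_form_comp \<omega> s z $ e1 $ e2"
      by simp
    moreover have "sin \<theta> > 0" using t(1) by (simp add: sin_gt_zero)
    moreover from calculation(1) have "sin \<theta> * (Q * (conf_factor z)\<^sup>2) = sin \<theta> * (- s * sphere_form_comp \<omega> s z $ e1 $ e2)"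
      by (simp add: mult_ac)
    ultimately have "Q * (conf_factor z)\<^sup>2 = - s * sphere_form_comp \<omega> s z $ e1 $ e2"
      by (metis mult_left_cancel less_irrefl)
    then have "s * (Q * (conf_factor z)\<^sup>2) = - (s * s) * sphere_form_comp \<omega> s z $ e1 $ e2" by simp
    then show ?thesis by (simp add: D_def ss mult.assoc)
  qed
  have "continuous_on UNIV (conf_factor :: real^'m \<Rightarrow> real)"
    by (intro differentiable_imp_continuous_on) (simp add: differentiable_on_def conf_factor_diff)
  then have "continuous_on UNIV D" unfolding D_def by (intro continuous_intros cont)
  moreover have "closure (- {0::real^'m}) = UNIV" by (simp add: closure_complement)
  ultimately have "D z = 0"
    using continuous_constant_on_closure[of "- {0}" D 0] nz by auto
  then show ?thesis by (simp add: D_def)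
qed

text \<open>The chart with \<open>s = 1\<close> suffices, because polar points with
  \<open>\<theta>\<close> strictly between \<open>0\<close> and \<open>pi\<close> avoid its pole of
  projection.\<close>

lemma is_monopole_formI:
  fixes \<omega> :: "'m::finite sphere_form"
  assumes e: "e1 \<noteq> e2" "UNIV = {e1, e2::'m}"
    and bil: "\<And>p. p \<in> sphere 0 1 \<Longrightarrow> bilinear (\<omega> p)" and alt: "\<And>p u. p \<in> sphere 0 1 \<Longrightarrow> \<omega> p u u = 0"
    and comp: "\<And>z. sphere_form_comp \<omega> 1 z $ e1 $ e2 = - Q * (conf_factor z)\<^sup>2"
  shows "is_monopole_form e1 e2 Q \<omega>"
  unfolding is_monopole_form_def
proof (intro ballI allI)
  fix \<theta> \<phi> :: real assume \<theta>: "\<theta> \<in> {0<..<pi}"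
  note p = polar_in_sphere[OF e(1), of \<theta> \<phi>]
  have "cos \<theta> < 1" using \<theta> cos_monotone_0_pi[of 0 \<theta>] by simp
  then obtain z where z: "stereo 1 z = polar e1 e2 \<theta> \<phi>"
    using stereo_surj[OF p, of 1] by (auto simp: polar_def)
  have "\<omega> (polar e1 e2 \<theta> \<phi>) (polar_dtheta e1 e2 \<theta> \<phi>) (polar_dphi e1 e2 \<theta> \<phi>) * (conf_factor z)\<^sup>2
    = Q * sin \<theta> * (conf_factor z)\<^sup>2"
    using polar_comp[of 1, OF _ e, of \<omega> z \<theta> \<phi>, OF _ _ _ z] bil[OF p] alt[OF p] unfolding z comp by (simp add: mult.commute)
  then show "\<omega> (polar e1 e2 \<theta> \<phi>) (polar_dtheta e1 e2 \<theta> \<phi>) (polar_dphi e1 e2 \<theta> \<phi>) = Q * sin \<theta>"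
    using conf_factor_pos[of z] by simp
qed

section \<open>Warped products with a sphere\<close>

lemma sum_Plus_UNIV:
  "(\<Sum>\<mu>\<in>(UNIV :: ('a::finite + 'b::finite) set). h \<mu>) = (\<Sum>A\<in>UNIV. h (Inl A)) + (\<Sum>i\<in>UNIV. h (Inr i))"
  using sum.Plus[of UNIV UNIV h] by (simp add: UNIV_Plus_UNIV o_def)

lemma all_Plus: "(\<forall>\<mu>::'a + 'b. P \<mu>) \<longleftrightarrow> (\<forall>A. P (Inl A)) \<and> (\<forall>i. P (Inr i))"
  by (metis sum.exhaust)

lemma block_tensor_nth [simp]:
  "block_tensor a b $ Inl A $ Inl B = a $ A $ B" "block_tensor a b $ Inl A $ Inr j = 0"
  "block_tensor a b $ Inr i $ Inl B = 0" "block_tensor a b $ Inr i $ Inr j = b $ i $ j"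
  by (simp_all add: block_tensor_def)

abbreviation \<delta> :: "'i \<Rightarrow> 'i \<Rightarrow> real" where
  "\<delta> i j \<equiv> (if i = j then 1 else 0)"

text \<open>The connection of a conformally flat metric with factor \<open>exp (2 * u)\<close>,
  where the derivative of \<open>u\<close> in direction \<open>k\<close> is
  \<open>- conf_factor z * z $ k\<close>.\<close>

definition sphere_christoffel :: "'m::finite \<Rightarrow> 'm \<Rightarrow> 'm \<Rightarrow> real^'m \<Rightarrow> real" where
  "sphere_christoffel i j k z = - conf_factor z * (\<delta> i j * z $ k + \<delta> i k * z $ j - \<delta> j k * z $ i)"

lemma conf_mult_has_pd:
  "(\<lambda>z. conf_factor z * z $ k) differentiable at z"
  "pd l (\<lambda>z. conf_factor z * z $ k) z = conf_factor z * \<delta> l k - (conf_factor z)\<^sup>2 * z $ l * z $ k"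
  by (simp_all add: conf_factor_diff differentiable_mult pd_mult pd_conf_factor)

lemma sphere_christoffel_eq:
  "sphere_christoffel i j k = (\<lambda>z. - (\<delta> i j * (conf_factor z * z $ k) + \<delta> i k * (conf_factor z * z $ j) - \<delta> j k * (conf_factor z * z $ i)))"
  by (auto simp: sphere_christoffel_def algebra_simps)

lemma sphere_christoffel_diff: "sphere_christoffel i j k differentiable at z"
  unfolding sphere_christoffel_eq by (intro differentiable_minus differentiable_diff differentiable_add differentiable_mult
    differentiable_const conf_mult_has_pd)

lemma pd_sphere_christoffel:
  fixes z :: "real^'m::finite"
  defines "Z \<equiv> \<lambda>l k. conf_factor z * \<delta> l k - (conf_factor z)\<^sup>2 * z $ l * z $ k"
  shows "pd l (sphere_christoffel i j k) z = - (\<delta> i j * Z l k + \<delta> i k * Z l j - \<delta> j k * Z l i)"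
  unfolding sphere_christoffel_eq Z_def
  by (simp add: pd_minus pd_diff pd_add pd_cmult conf_mult_has_pd differentiable_mult differentiable_add differentiable_diff)

lemma sphere_christoffel_trace:
  "(\<Sum>i\<in>UNIV. sphere_christoffel i i k z) = - real CARD('m) * conf_factor z * z $ k" for z :: "real^'m::finite"
proof -
  have "sphere_christoffel i i k z = - conf_factor z * z $ k" for i
    by (simp add: sphere_christoffel_def)
  then show ?thesis by simp
qed

lemma sum_delta:
  fixes h :: "'i::finite \<Rightarrow> real"
  shows "(\<Sum>i\<in>UNIV. \<delta> i a * h i) = h a" "(\<Sum>i\<in>UNIV. \<delta> a i * h i) = h a"
  by (simp_all add: if_distrib[where f="\<lambda>x. x * _"] cong: if_cong)

text \<open>The left side is the Ricci contraction of the connection of the sphere. Its four sums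
  are evaluated one by one; the products of coordinates cancel between them and leave a multiple of
  \<open>\<delta> a b\<close>.\<close>

lemma sphere_ricci:
  fixes z :: "real^'m::finite"
  defines "G \<equiv> sphere_christoffel"
  shows "(\<Sum>i\<in>UNIV. pd i (G i b a) z - pd b (G i i a) z + (\<Sum>k\<in>UNIV. G i i k z * G k b a z - G i b k z * G k i a z))
    = (real CARD('m) - 1) * (conf_factor z)\<^sup>2 * \<delta> a b"
proof -
  define l where "l = conf_factor z"
  define q where "q = z \<bullet> z"
  define m where "m = real CARD('m)"
  have lq: "l * (q + 1) = 2" unfolding l_def q_def by (rule conf_factor_inner)
  have q: "(\<Sum>i\<in>UNIV. z $ i * z $ i) = q" by (simp add: q_def inner_vec_def)
  define Z where "Z i k = l * \<delta> i k - l\<^sup>2 * z $ i * z $ k" for i k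
  have Zsym: "Z i k = Z k i" for i k by (simp add: Z_def)
  have 1: "(\<Sum>i\<in>UNIV. pd i (G i b a) z) = - (Z b a + Z a b - \<delta> b a * (m * l - l\<^sup>2 * q))"
  proof -
    have "(\<Sum>i\<in>UNIV. Z i i) = m * l - l\<^sup>2 * q"
      by (simp add: Z_def sum_subtractf mult.assoc sum_distrib_left[symmetric] q m_def)
    then have t: "(\<Sum>i\<in>UNIV. \<delta> b a * Z i i) = \<delta> b a * (m * l - l\<^sup>2 * q)" by simp
    have "(\<Sum>i\<in>UNIV. pd i (G i b a) z) = (\<Sum>i\<in>UNIV. - (\<delta> i b * Z i a + \<delta> i a * Z i b - \<delta> b a * Z i i))"
      unfolding G_def pd_sphere_christoffel Z_def l_def ..
    also have "\<dots> = - (Z b a + Z a b - \<delta> b a * (m * l - l\<^sup>2 * q))"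
      unfolding sum_negf sum_subtractf sum.distrib sum_delta t ..
    finally show ?thesis .
  qed
  have 2: "(\<Sum>i\<in>UNIV. pd b (G i i a) z) = - (m * Z b a)"
  proof -
    have "pd b (G i i a) z = - Z b a" for i
      unfolding G_def pd_sphere_christoffel Z_def l_def by simp
    then show ?thesis by (simp add: m_def)
  qed
  have 3: "(\<Sum>i\<in>UNIV. \<Sum>k\<in>UNIV. G i i k z * G k b a z) = m * l\<^sup>2 * (2 * z $ a * z $ b - \<delta> b a * q)"
  proof -
    have "(\<Sum>i\<in>UNIV. \<Sum>k\<in>UNIV. G i i k z * G k b a z) = (\<Sum>k\<in>UNIV. (\<Sum>i\<in>UNIV. G i i k z) * G k b a z)"
      unfolding sum_distrib_right by (rule sum.swap)
    also have "\<dots> = (\<Sum>k\<in>UNIV. m * l\<^sup>2 * (\<delta> k b * (z $ k * z $ a) + \<delta> k a * (z $ k * z $ b) - \<delta> b a * (z $ k * z $ k)))"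
      unfolding G_def sphere_christoffel_trace
      by (intro sum.cong) (auto simp: sphere_christoffel_def m_def l_def power2_eq_square algebra_simps)
    also have "\<dots> = m * l\<^sup>2 * (z $ b * z $ a + z $ a * z $ b - \<delta> b a * q)"
      unfolding sum_distrib_left[symmetric] sum_subtractf sum.distrib sum_delta q ..
    finally show ?thesis by (simp add: algebra_simps)
  qed
  have 4: "(\<Sum>i\<in>UNIV. \<Sum>k\<in>UNIV. G i b k z * G k i a z) = l\<^sup>2 * ((m + 2) * z $ a * z $ b - 2 * \<delta> b a * q)"
  proof -
    have row: "(\<Sum>k\<in>UNIV. G i b k z * G k i a z)
        = l\<^sup>2 * (\<delta> i b * (2 * z $ i * z $ a - \<delta> i a * q) + z $ b * z $ a
           - (\<delta> i b * (z $ i * z $ a) + \<delta> b a * (z $ i * z $ i) - \<delta> i a * (z $ i * z $ b)))" for i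
    proof -
      define H where "H k = \<delta> k i * z $ a + \<delta> k a * z $ i - \<delta> i a * z $ k" for k
      have "(\<Sum>k\<in>UNIV. z $ k * H k) = (\<Sum>k\<in>UNIV. \<delta> k i * (z $ k * z $ a) + \<delta> k a * (z $ k * z $ i) - \<delta> i a * (z $ k * z $ k))"
        by (intro sum.cong) (auto simp: H_def algebra_simps)
      also have "\<dots> = 2 * z $ i * z $ a - \<delta> i a * q"
        unfolding sum_subtractf sum.distrib sum_delta sum_distrib_left[symmetric] q by simp
      finally have zH: "(\<Sum>k\<in>UNIV. z $ k * H k) = 2 * z $ i * z $ a - \<delta> i a * q" .
      have "(\<Sum>k\<in>UNIV. G i b k z * G k i a z)
          = (\<Sum>k\<in>UNIV. l\<^sup>2 * (\<delta> i b * (z $ k * H k) + \<delta> i k * (z $ b * H k) - \<delta> b k * (z $ i * H k)))"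
        by (intro sum.cong) (auto simp: G_def sphere_christoffel_def H_def l_def power2_eq_square algebra_simps)
      also have "\<dots> = l\<^sup>2 * (\<delta> i b * (2 * z $ i * z $ a - \<delta> i a * q) + z $ b * H i - z $ i * H b)"
        unfolding sum_distrib_left[symmetric] sum_subtractf sum.distrib sum_delta zH ..
      finally show ?thesis by (simp add: H_def)
    qed
    have "(\<Sum>i\<in>UNIV. \<Sum>k\<in>UNIV. G i b k z * G k i a z)
      = l\<^sup>2 * ((2 * z $ b * z $ a - \<delta> b a * q) + m * (z $ b * z $ a)
           - (z $ b * z $ a + \<delta> b a * q - z $ a * z $ b))"
      unfolding row sum_distrib_left[symmetric] sum_subtractf sum.distrib sum_delta q
      by (simp add: m_def)
    then show ?thesis by (simp add: algebra_simps)
  qed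
  have "(\<Sum>i\<in>UNIV. pd i (G i b a) z - pd b (G i i a) z + (\<Sum>k\<in>UNIV. G i i k z * G k b a z - G i b k z * G k i a z))
    = - (Z b a + Z a b - \<delta> b a * (m * l - l\<^sup>2 * q)) - - (m * Z b a)
      + (m * l\<^sup>2 * (2 * z $ a * z $ b - \<delta> b a * q) - l\<^sup>2 * ((m + 2) * z $ a * z $ b - 2 * \<delta> b a * q))"
    unfolding sum.distrib sum_subtractf 1 2 3 4 ..
  also have "\<dots> = \<delta> b a * ((m - 1) * l * (2 - l * q))"
    unfolding Zsym[of a b] by (simp add: Z_def power2_eq_square algebra_simps)
  \<comment> \<open>This is \<open>l * (q + 1) = 2\<close>; it completes the remaining factor to the
    square of \<open>l\<close>, that is, to the round metric.\<close>
  also have "2 - l * q = l" using lq by (simp add: algebra_simps)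
  finally show ?thesis by (simp add: m_def l_def power2_eq_square)
qed

locale warped = metric2 S g for S g +
  fixes r :: "real^2 \<Rightarrow> real" and s :: real
  assumes r_C3: "Ck_nat 3 S r" and r_pos: "\<And>y. y \<in> S \<Longrightarrow> r y > 0" and s: "s \<in> {1, -1}"
begin

lemmas r_diff = r_diff[OF r_C3] and dr_diff = dr_diff[OF r_C3] and ddr_diff = ddr_diff[OF r_C3]
  and ddr_sym = ddr_sym[OF r_C3] and hess_sym = hess_sym[OF r_C3] and grad_up_diff = grad_up_diff[OF r_C3]
  and pd_grad_up = pd_grad_up[OF r_C3] and divergence_grad = divergence_grad[OF r_C3]
  and grad_square_eq = grad_square_eq[OF r_C3] and grad_square_diff = grad_square_diff[OF r_C3]
  and pd_grad_square = pd_grad_square[OF r_C3] and gauss_curvature_hess = gauss_curvature_hess[OF r_C3]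

abbreviation "h \<equiv> spacetime_metric g r s"

section \<open>Connection of the warped product\<close>

lemma open_dom: "open {x :: real^(2 + 'm::finite). ypart x \<in> S}"
proof -
  have "continuous_on UNIV (ypart :: real^(2 + 'm) \<Rightarrow> real^2)"
    using linear_ypart by (rule bounded_linear.continuous_on) (rule continuous_on_id)
  from open_vimage[OF open_S this] show ?thesis by (simp add: vimage_def)
qed

lemma metric_nth:
  "h x $ Inl A $ Inl B = g (ypart x) $ A $ B" "h x $ Inl A $ Inr j = 0" "h x $ Inr i $ Inl B = 0"
  "h x $ Inr i $ Inr j = \<delta> i j * ((r (ypart x))\<^sup>2 * (conf_factor (zpart x))\<^sup>2)"
  by (simp_all add: spacetime_metric_def sphere_metric_eq[OF s])

lemma inverse_metric:
  fixes x :: "real^(2 + 'm::finite)"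
  assumes x: "ypart x \<in> S"
  shows "matrix_inv (h x) $ Inl A $ Inl B = gi (ypart x) $ A $ B" "matrix_inv (h x) $ Inl A $ Inr j = 0"
    "matrix_inv (h x) $ Inr i $ Inl B = 0"
    "matrix_inv (h x) $ Inr i $ Inr j = \<delta> i j / ((r (ypart x))\<^sup>2 * (conf_factor (zpart x))\<^sup>2)"
proof -
  have pos: "(r (ypart x))\<^sup>2 * (conf_factor (zpart x))\<^sup>2 > 0"
    using r_pos[OF x] conf_factor_pos[of "zpart x"] by simp
  define b :: "real^'m^'m" where "b = (\<chi> i j. \<delta> i j / ((r (ypart x))\<^sup>2 * (conf_factor (zpart x))\<^sup>2))"
  have "(h x ** block_tensor (gi (ypart x)) b) $ \<mu> $ \<nu> = mat 1 $ \<mu> $ \<nu>" for \<mu> \<nu>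
    using pos g_gi(1)[OF x]
    by (cases \<mu>; cases \<nu>)
       (auto simp: matrix_matrix_mult_def sum_Plus_UNIV metric_nth mat_def b_def
         if_distrib[where f="\<lambda>x. x * _"] cong: if_cong)
  then have "h x ** block_tensor (gi (ypart x)) b = mat 1" by (simp add: vec_eq_iff)
  from matrix_inv_unique[OF this]
  show "matrix_inv (h x) $ Inl A $ Inl B = gi (ypart x) $ A $ B" "matrix_inv (h x) $ Inl A $ Inr j = 0"
    "matrix_inv (h x) $ Inr i $ Inl B = 0"
    "matrix_inv (h x) $ Inr i $ Inr j = \<delta> i j / ((r (ypart x))\<^sup>2 * (conf_factor (zpart x))\<^sup>2)"
    by (simp_all add: b_def)
qed

lemma pd_metric:
  fixes x :: "real^(2 + 'm::finite)"
  assumes x: "ypart x \<in> S"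
  shows "pd (Inl C) (\<lambda>x. h x $ Inl A $ Inl B) x = pd C (\<lambda>y. g y $ A $ B) (ypart x)"
    and "pd (Inr k) (\<lambda>x. h x $ Inl A $ Inl B) x = 0"
    and "pd \<mu> (\<lambda>x. h x $ Inl A $ Inr j) x = 0" and "pd \<mu> (\<lambda>x. h x $ Inr j $ Inl A) x = 0"
    and "pd (Inl C) (\<lambda>x. h x $ Inr i $ Inr j) x
      = \<delta> i j * (2 * r (ypart x) * pd C r (ypart x) * (conf_factor (zpart x))\<^sup>2)"
    and "pd (Inr k) (\<lambda>x. h x $ Inr i $ Inr j) x
      = - \<delta> i j * (2 * (r (ypart x))\<^sup>2 * conf_factor (zpart x) ^ 3 * zpart x $ k)"
proof -
  note gy = ypart_differentiable[of "\<lambda>y. g y $ A $ B" x for A B, OF g_diff[OF x]]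
  note ry = ypart_differentiable[of r x, OF r_diff[OF x]]
  note cz = zpart_differentiable[of conf_factor x, OF conf_factor_diff]
  show "pd (Inl C) (\<lambda>x. h x $ Inl A $ Inl B) x = pd C (\<lambda>y. g y $ A $ B) (ypart x)"
    "pd (Inr k) (\<lambda>x. h x $ Inl A $ Inl B) x = 0"
    "pd \<mu> (\<lambda>x. h x $ Inl A $ Inr j) x = 0" "pd \<mu> (\<lambda>x. h x $ Inr j $ Inl A) x = 0"
    by (simp_all add: metric_nth gy)
  have "pd \<mu> (\<lambda>x. h x $ Inr i $ Inr j) x = \<delta> i j * (2 * r (ypart x) * pd \<mu> (\<lambda>x. r (ypart x)) x * (conf_factor (zpart x))\<^sup>2
     + (r (ypart x))\<^sup>2 * (2 * conf_factor (zpart x) * pd \<mu> (\<lambda>x. conf_factor (zpart x)) x))" for \<mu>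
    using ry(1) cz(1) by (simp add: metric_nth pd_mult pd_power differentiable_power)
  then show "pd (Inl C) (\<lambda>x. h x $ Inr i $ Inr j) x
      = \<delta> i j * (2 * r (ypart x) * pd C r (ypart x) * (conf_factor (zpart x))\<^sup>2)"
    "pd (Inr k) (\<lambda>x. h x $ Inr i $ Inr j) x
      = - \<delta> i j * (2 * (r (ypart x))\<^sup>2 * conf_factor (zpart x) ^ 3 * zpart x $ k)"
    by (simp_all add: ry cz pd_conf_factor power2_eq_square power3_eq_cube)
qed

lemma christoffel_warped:
  fixes x :: "real^(2 + 'm::finite)"
  assumes x: "ypart x \<in> S"
  shows "christoffel h (Inl A) (Inl B) (Inl C) x = \<Gamma> A B C (ypart x)"
    and "christoffel h (Inl A) (Inl B) (Inr j) x = 0"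
    and "christoffel h (Inl A) (Inr j) (Inl B) x = 0"
    and "christoffel h (Inl A) (Inr i) (Inr j) x = - \<delta> i j * (r (ypart x) * grad_up g r A (ypart x) * (conf_factor (zpart x))\<^sup>2)"
    and "christoffel h (Inr i) (Inl A) (Inl B) x = 0"
    and "christoffel h (Inr i) (Inr j) (Inl A) x = \<delta> i j * (pd A r (ypart x) / r (ypart x))"
    and "christoffel h (Inr i) (Inl A) (Inr j) x = \<delta> i j * (pd A r (ypart x) / r (ypart x))"
    and "christoffel h (Inr i) (Inr j) (Inr k) x = sphere_christoffel i j k (zpart x)"
proof -
  have pos: "r (ypart x) > 0" "conf_factor (zpart x) > 0"
    using r_pos[OF x] conf_factor_pos[of "zpart x"] by simp_all
  note simps = christoffel_def sum_Plus_UNIV inverse_metric[OF x] pd_metric[OF x]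
  show "christoffel h (Inl A) (Inl B) (Inl C) x = \<Gamma> A B C (ypart x)"
    "christoffel h (Inl A) (Inl B) (Inr j) x = 0"
    "christoffel h (Inl A) (Inr j) (Inl B) x = 0"
    "christoffel h (Inr i) (Inl A) (Inl B) x = 0"
    by (simp_all add: simps)
  show "christoffel h (Inl A) (Inr i) (Inr j) x = - \<delta> i j * (r (ypart x) * grad_up g r A (ypart x) * (conf_factor (zpart x))\<^sup>2)"
    by (auto simp: simps grad_up_def sum_distrib_left sum_distrib_right sum_negf[symmetric] intro!: sum.cong)
  have row: "(\<Sum>k\<in>UNIV. 1/2 * (\<delta> i k / ((r (ypart x))\<^sup>2 * (conf_factor (zpart x))\<^sup>2)) * v k)
    = v i / (2 * (r (ypart x))\<^sup>2 * (conf_factor (zpart x))\<^sup>2)" for v :: "'m \<Rightarrow> real" and i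
    using sum_delta(2)[of i "\<lambda>k. v k / (2 * (r (ypart x))\<^sup>2 * (conf_factor (zpart x))\<^sup>2)"]
    by (simp add: mult.assoc)
  show "christoffel h (Inr i) (Inr j) (Inl A) x = \<delta> i j * (pd A r (ypart x) / r (ypart x))"
    "christoffel h (Inr i) (Inl A) (Inr j) x = \<delta> i j * (pd A r (ypart x) / r (ypart x))"
    unfolding christoffel_def sum_Plus_UNIV inverse_metric[OF x] row
    using pos by (simp_all add: pd_metric[OF x] power2_eq_square)
  show "christoffel h (Inr i) (Inr j) (Inr k) x = sphere_christoffel i j k (zpart x)"
    unfolding christoffel_def sum_Plus_UNIV inverse_metric[OF x] row
    using pos by (auto simp: pd_metric[OF x] sphere_christoffel_def power2_eq_square power3_eq_cube)
qed

lemma pd_christoffel_warped: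
  fixes x :: "real^(2 + 'm::finite)"
  assumes x: "ypart x \<in> S"
  shows "pd (Inl D) (christoffel h (Inl A) (Inl B) (Inl C)) x = pd D (\<Gamma> A B C) (ypart x)"
    and "pd (Inr l) (christoffel h (Inl A) (Inl B) (Inl C)) x = 0"
    and "pd \<mu> (christoffel h (Inl A) (Inl B) (Inr j)) x = 0"
    and "pd \<mu> (christoffel h (Inl A) (Inr j) (Inl B)) x = 0"
    and "pd (Inl D) (christoffel h (Inl A) (Inr i) (Inr j)) x
      = - \<delta> i j * ((pd D r (ypart x) * grad_up g r A (ypart x) + r (ypart x) * pd D (grad_up g r A) (ypart x)) * (conf_factor (zpart x))\<^sup>2)"
    and "pd \<mu> (christoffel h (Inr i) (Inl A) (Inl B)) x = 0"
    and "pd (Inl D) (christoffel h (Inr i) (Inr j) (Inl A)) x = \<delta> i j *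
      ((pd D (pd A r) (ypart x) * r (ypart x) - pd A r (ypart x) * pd D r (ypart x)) / (r (ypart x))\<^sup>2)"
    and "pd (Inl D) (christoffel h (Inr i) (Inl A) (Inr j)) x = \<delta> i j *
      ((pd D (pd A r) (ypart x) * r (ypart x) - pd A r (ypart x) * pd D r (ypart x)) / (r (ypart x))\<^sup>2)"
    and "pd (Inr l) (christoffel h (Inr i) (Inr j) (Inl A)) x = 0"
    and "pd (Inr l) (christoffel h (Inr i) (Inl A) (Inr j)) x = 0"
    and "pd (Inl D) (christoffel h (Inr i) (Inr j) (Inr k)) x = 0"
    and "pd (Inr l) (christoffel h (Inr i) (Inr j) (Inr k)) x = pd l (sphere_christoffel i j k) (zpart x)"
proof -
  have cong: "pd \<mu> u x = pd \<mu> v x" if "\<And>x. ypart x \<in> S \<Longrightarrow> u x = v x" for \<mu> and u v :: "real^(2 + 'm) \<Rightarrow> real"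
    using pd_cong[OF open_dom, of x u v \<mu>] that x by simp
  have c1: "pd \<mu> (christoffel h (Inl A) (Inl B) (Inl C)) x = pd \<mu> (\<lambda>x. \<Gamma> A B C (ypart x)) x" for \<mu> A B C
    by (rule cong) (rule christoffel_warped)
  have c2: "pd \<mu> (christoffel h (Inl A) (Inl B) (Inr j)) x = pd \<mu> (\<lambda>x. 0) x" for \<mu> A B j
    by (rule cong) (rule christoffel_warped)
  have c3: "pd \<mu> (christoffel h (Inl A) (Inr j) (Inl B)) x = pd \<mu> (\<lambda>x. 0) x" for \<mu> A B j
    by (rule cong) (rule christoffel_warped)
  have c4: "pd \<mu> (christoffel h (Inl A) (Inr i) (Inr j)) x =
     pd \<mu> (\<lambda>x. - \<delta> i j * (r (ypart x) * grad_up g r A (ypart x) * (conf_factor (zpart x))\<^sup>2)) x" for \<mu> A i j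
    by (rule cong) (rule christoffel_warped)
  have c5: "pd \<mu> (christoffel h (Inr i) (Inl A) (Inl B)) x = pd \<mu> (\<lambda>x. 0) x" for \<mu> A B i
    by (rule cong) (rule christoffel_warped)
  have c6: "pd \<mu> (christoffel h (Inr i) (Inr j) (Inl A)) x = pd \<mu> (\<lambda>x. \<delta> i j * (pd A r (ypart x) / r (ypart x))) x" for \<mu> A i j
    by (rule cong) (rule christoffel_warped)
  have c7: "pd \<mu> (christoffel h (Inr i) (Inl A) (Inr j)) x = pd \<mu> (\<lambda>x. \<delta> i j * (pd A r (ypart x) / r (ypart x))) x" for \<mu> A i j
    by (rule cong) (rule christoffel_warped)
  have c8: "pd \<mu> (christoffel h (Inr i) (Inr j) (Inr k)) x = pd \<mu> (\<lambda>x. sphere_christoffel i j k (zpart x)) x" for \<mu> i j k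
    by (rule cong) (rule christoffel_warped)
  have r0: "r (ypart x) \<noteq> 0" using r_pos[OF x] by simp
  note ry = ypart_differentiable[of r x, OF r_diff[OF x]]
  note cz = zpart_differentiable[of conf_factor x, OF conf_factor_diff]
  note gu = ypart_differentiable[of "grad_up g r A" x for A, OF grad_up_diff[OF x]]
  note Gy = ypart_differentiable[of "\<Gamma> A B C" x for A B C, OF christoffel_diff[OF x]]
  note sc = zpart_differentiable[of "sphere_christoffel i j k" x for i j k, OF sphere_christoffel_diff]
  have qd: "(\<lambda>y. pd A r y / r y) differentiable at (ypart x)" for A
    using dr_diff[OF x] r_diff[OF x] r0 by (intro differentiable_divide)
  have pq: "pd D (\<lambda>y. pd A r y / r y) (ypart x)
      = (pd D (pd A r) (ypart x) * r (ypart x) - pd A r (ypart x) * pd D r (ypart x)) / (r (ypart x))\<^sup>2" for A D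
    using dr_diff[OF x] r_diff[OF x] r0 by (rule pd_divide)
  note qy = ypart_differentiable[of "\<lambda>y. pd A r y / r y" x for A, OF qd, unfolded pq]
  show "pd (Inl D) (christoffel h (Inl A) (Inl B) (Inl C)) x = pd D (\<Gamma> A B C) (ypart x)"
    "pd (Inr l) (christoffel h (Inl A) (Inl B) (Inl C)) x = 0"
    unfolding c1 by (simp_all add: Gy)
  show "pd \<mu> (christoffel h (Inl A) (Inl B) (Inr j)) x = 0"
    "pd \<mu> (christoffel h (Inl A) (Inr j) (Inl B)) x = 0"
    "pd \<mu> (christoffel h (Inr i) (Inl A) (Inl B)) x = 0"
    unfolding c2 c3 c5 by simp_all
  have cc: "(\<lambda>x. (conf_factor (zpart x))\<^sup>2) differentiable at x"
    "pd (Inl D) (\<lambda>x. (conf_factor (zpart x))\<^sup>2) x = 0"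
    using cz by (simp_all add: pd_power differentiable_power)
  show "pd (Inl D) (christoffel h (Inl A) (Inr i) (Inr j)) x
      = - \<delta> i j * ((pd D r (ypart x) * grad_up g r A (ypart x) + r (ypart x) * pd D (grad_up g r A) (ypart x)) * (conf_factor (zpart x))\<^sup>2)"
    unfolding c4
    using ry gu cc by (auto simp: pd_minus pd_mult differentiable_mult)
  show "pd (Inl D) (christoffel h (Inr i) (Inr j) (Inl A)) x = \<delta> i j *
      ((pd D (pd A r) (ypart x) * r (ypart x) - pd A r (ypart x) * pd D r (ypart x)) / (r (ypart x))\<^sup>2)"
    "pd (Inl D) (christoffel h (Inr i) (Inl A) (Inr j)) x = \<delta> i j *
      ((pd D (pd A r) (ypart x) * r (ypart x) - pd A r (ypart x) * pd D r (ypart x)) / (r (ypart x))\<^sup>2)"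
    "pd (Inr l) (christoffel h (Inr i) (Inr j) (Inl A)) x = 0"
    "pd (Inr l) (christoffel h (Inr i) (Inl A) (Inr j)) x = 0"
    unfolding c6 c7 using qy by auto
  show "pd (Inl D) (christoffel h (Inr i) (Inr j) (Inr k)) x = 0"
    "pd (Inr l) (christoffel h (Inr i) (Inr j) (Inr k)) x = pd l (sphere_christoffel i j k) (zpart x)"
    unfolding c8 using sc by auto
qed

section \<open>Ricci and Einstein tensors of the warped product\<close>

lemma sphere_christoffel_swap: "sphere_christoffel i j k z = sphere_christoffel i k j z"
  by (simp add: sphere_christoffel_def)

text \<open>Each angular direction adds the same term, minus the Hessian over \<open>r\<close>, to
  the trace; the surface itself contributes its Gauss curvature.\<close>

lemma ricci_warped_AB:
  fixes x :: "real^(2 + 'm::finite)"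
  assumes x: "ypart x \<in> S"
  shows "ricci h x $ Inl A $ Inl B = gauss_curvature g (ypart x) * g (ypart x) $ A $ B
     - real CARD('m) / r (ypart x) * hess g r A B (ypart x)"
proof -
  have r0: "r (ypart x) \<noteq> 0" using r_pos[OF x] by simp
  have 1: "riemann h (Inl C) (Inl A) (Inl C) (Inl B) x = riemann g C A C B (ypart x)" for C
    by (simp add: riemann_def sum_Plus_UNIV christoffel_warped[OF x] pd_christoffel_warped[OF x])
  have 2: "riemann h (Inr i) (Inl A) (Inr i) (Inl B) x = - hess g r B A (ypart x) / r (ypart x)" for i :: 'm
  proof -
    have "(\<Sum>k\<in>UNIV. \<delta> i k * (u / r (ypart x)) * (\<delta> k i * (v / r (ypart x)))) = u * v / (r (ypart x))\<^sup>2" for u v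
      using sum_delta(2)[of i "\<lambda>k. (u / r (ypart x)) * (\<delta> k i * (v / r (ypart x)))"]
      by (simp add: mult.assoc power2_eq_square)
    then show ?thesis
      using r0 unfolding riemann_def sum_Plus_UNIV
      by (simp add: christoffel_warped[OF x] pd_christoffel_warped[OF x] sum_negf hess_def sum_2' power2_eq_square field_simps)
  qed
  show ?thesis
    by (simp add: ricci_def sum_Plus_UNIV 1 2 hess_sym[OF x, of B A] ricci2[OF x, unfolded ricci_def, simplified])
qed

lemma ricci_warped_mixed:
  fixes x :: "real^(2 + 'm::finite)"
  assumes x: "ypart x \<in> S"
  shows "ricci h x $ Inl A $ Inr j = 0" "ricci h x $ Inr j $ Inl A = 0"
proof -
  have d: "(\<Sum>k\<in>UNIV. u k * (\<delta> k a * c)) = u a * c" "(\<Sum>k\<in>UNIV. \<delta> a k * c * u k) = u a * c" for u :: "'m \<Rightarrow> real" and a c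
    using sum_delta(1)[of a "\<lambda>k. u k * c"] sum_delta(2)[of a "\<lambda>k. u k * c"] by (simp_all add: mult_ac)
  have "riemann h (Inl C) (Inl A) (Inl C) (Inr j) x = 0" "riemann h (Inl C) (Inr j) (Inl C) (Inl A) x = 0" for C
    by (simp_all add: riemann_def sum_Plus_UNIV christoffel_warped[OF x] pd_christoffel_warped[OF x])
  moreover have "riemann h (Inr i) (Inl A) (Inr i) (Inr j) x = 0" "riemann h (Inr i) (Inr j) (Inr i) (Inl A) x = 0" for i
    unfolding riemann_def sum_Plus_UNIV christoffel_warped[OF x] pd_christoffel_warped[OF x] sum_subtractf d
    by (simp_all add: sphere_christoffel_swap[of i j i])
  ultimately show "ricci h x $ Inl A $ Inr j = 0" "ricci h x $ Inr j $ Inl A = 0"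
    by (simp_all add: ricci_def sum_Plus_UNIV)
qed

text \<open>The angular Ricci tensor in units of the unit sphere metric.\<close>

definition \<kappa> :: "real \<Rightarrow> real^2 \<Rightarrow> real" where
  "\<kappa> m y = (m - 1) * (1 - grad_square g r y) - r y * lapl g r y"

text \<open>The trace over the surface directions assembles, through \<open>divergence_grad\<close>,
  into the Laplacian. The trace over the sphere is that of the unit sphere, corrected by products of
  the symbols that mix surface and sphere; these give \<open>grad_square\<close> once for every
  direction other than the given one, hence the factor \<open>real CARD('m) - 1\<close>.\<close>

lemma ricci_warped_ij:
  fixes x :: "real^(2 + 'm::finite)"
  assumes x: "ypart x \<in> S"
  shows "ricci h x $ Inr a $ Inr b = \<delta> a b * ((conf_factor (zpart x))\<^sup>2 * \<kappa> (real CARD('m)) (ypart x))"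
proof -
  define y where "y = ypart x"
  define z where "z = zpart x"
  define l where "l = conf_factor z"
  have r0: "r y \<noteq> 0" using r_pos[OF x] by (simp add: y_def)
  note cw = christoffel_warped[OF x, folded y_def z_def, folded l_def] 
  note pcw = pd_christoffel_warped[OF x, folded y_def z_def, folded l_def]
  have 1: "riemann h (Inl C) (Inr a) (Inl C) (Inr b) x = \<delta> a b * (l\<^sup>2 *
     (- (pd C r y * grad_up g r C y + r y * pd C (grad_up g r C) y) - (\<Sum>D\<in>UNIV. \<Gamma> C C D y * (r y * grad_up g r D y)) + grad_up g r C y * pd C r y))" for C
  proof -
    have t: "(\<Sum>k\<in>UNIV. christoffel h (Inl C) (Inr b) (Inr k) x * christoffel h (Inr k) (Inl C) (Inr a) x)
        = - \<delta> a b * (grad_up g r C y * pd C r y * l\<^sup>2)"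
    proof -
      have "christoffel h (Inl C) (Inr b) (Inr k) x * christoffel h (Inr k) (Inl C) (Inr a) x
        = \<delta> b k * (- \<delta> k a * (grad_up g r C y * pd C r y * l\<^sup>2))" for k
        unfolding cw using r0 by simp
      then show ?thesis using sum_delta(2)[of b "\<lambda>k. - \<delta> k a * (grad_up g r C y * pd C r y * l\<^sup>2)"] by auto
    qed
    show ?thesis
      unfolding riemann_def sum_Plus_UNIV sum_subtractf t unfolding cw pcw
      by (auto simp: sum_2' algebra_simps)
  qed
  have 2: "(\<Sum>C\<in>UNIV. riemann h (Inl C) (Inr a) (Inl C) (Inr b) x) = - \<delta> a b * (l\<^sup>2 * (r y * lapl g r y))"
    unfolding 1 divergence_grad[OF x, folded y_def, symmetric] sum_2' by (simp add: algebra_simps)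
  have 3: "riemann h (Inr i) (Inr a) (Inr i) (Inr b) x =
      pd i (sphere_christoffel i b a) z - pd b (sphere_christoffel i i a) z
      + (\<Sum>k\<in>UNIV. sphere_christoffel i i k z * sphere_christoffel k b a z - sphere_christoffel i b k z * sphere_christoffel k i a z)
      - (\<delta> a b - \<delta> i b * \<delta> i a) * (l\<^sup>2 * grad_square g r y)" for i
    using r0 unfolding riemann_def sum_Plus_UNIV cw pcw grad_square_eq
    by (auto simp: sum_2' algebra_simps)
  have 4: "(\<Sum>i\<in>UNIV. (\<delta> a b - \<delta> i b * \<delta> i a) * (l\<^sup>2 * grad_square g r y)) = (real CARD('m) - 1) * \<delta> a b * (l\<^sup>2 * grad_square g r y)"
  proof -
    have t: "(\<Sum>i\<in>UNIV. (\<delta> a b - \<delta> i b * \<delta> i a)) = (real CARD('m) - 1) * \<delta> a b"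
      unfolding sum_subtractf sum_delta by auto
    show ?thesis unfolding sum_distrib_right[symmetric] t ..
  qed
  have "ricci h x $ Inr a $ Inr b = - \<delta> a b * (l\<^sup>2 * (r y * lapl g r y)) + ((real CARD('m) - 1) * l\<^sup>2 * \<delta> a b
      - (real CARD('m) - 1) * \<delta> a b * (l\<^sup>2 * grad_square g r y))"
    unfolding ricci_def sum_Plus_UNIV vec_lambda_beta 2 3 sum_subtractf[of _ "\<lambda>i. (\<delta> a b - \<delta> i b * \<delta> i a) * (l\<^sup>2 * grad_square g r y)"] 4
      sphere_ricci l_def[symmetric] ..
  then show ?thesis
    by (auto simp: \<kappa>_def y_def z_def l_def algebra_simps)
qed

definition scal :: "real \<Rightarrow> real^2 \<Rightarrow> real" where
  "scal m y = 2 * gauss_curvature g y - m / r y * lapl g r y + m * \<kappa> m y / (r y)\<^sup>2"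

lemma scalar_curvature_warped:
  fixes x :: "real^(2 + 'm::finite)"
  assumes x: "ypart x \<in> S"
  shows "scalar_curvature h x = scal (real CARD('m)) (ypart x)"
proof -
  have pos: "r (ypart x) \<noteq> 0" "conf_factor (zpart x) \<noteq> 0"
    using r_pos[OF x] conf_factor_pos[of "zpart x"] by simp_all
  have 1: "(\<Sum>A\<in>UNIV. \<Sum>B\<in>UNIV. gi (ypart x) $ A $ B * g (ypart x) $ A $ B) = 2"
    using g_gi(2)[OF x, of 0 0] g_gi(2)[OF x, of 1 1] g_sym[OF x, of 1 0] by (simp add: sum_2')
  have 2: "(\<Sum>A\<in>UNIV. \<Sum>B\<in>UNIV. gi (ypart x) $ A $ B * ricci h x $ Inl A $ Inl B)
    = gauss_curvature g (ypart x) * (\<Sum>A\<in>UNIV. \<Sum>B\<in>UNIV. gi (ypart x) $ A $ B * g (ypart x) $ A $ B)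
      - real CARD('m) / r (ypart x) * lapl g r (ypart x)"
    unfolding ricci_warped_AB[OF x] lapl_def sum_2' by (simp add: algebra_simps)
  have 3: "(\<Sum>i\<in>UNIV. \<Sum>j\<in>UNIV. matrix_inv (h x) $ Inr i $ Inr j * ricci h x $ Inr i $ Inr j)
     = real CARD('m) * \<kappa> (real CARD('m)) (ypart x) / (r (ypart x))\<^sup>2"
  proof -
    have "(\<Sum>j\<in>UNIV. matrix_inv (h x) $ Inr i $ Inr j * ricci h x $ Inr i $ Inr j) = \<kappa> (real CARD('m)) (ypart x) / (r (ypart x))\<^sup>2" for i
    proof -
      have "matrix_inv (h x) $ Inr i $ Inr j * ricci h x $ Inr i $ Inr j = \<delta> i j * (\<kappa> (real CARD('m)) (ypart x) / (r (ypart x))\<^sup>2)" for j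
        unfolding inverse_metric[OF x] ricci_warped_ij[OF x] using pos by simp
      then show ?thesis by (simp only: sum_delta)
    qed
    then show ?thesis by simp
  qed
  show ?thesis
    unfolding scalar_curvature_def sum_Plus_UNIV
    by (simp add: sum.distrib inverse_metric(1-3)[OF x] 2 1 3 scal_def)
qed

text \<open>The Gauss curvature cancels in the surface block, because the Einstein tensor of a
  two-dimensional metric vanishes. It remains in the angular block through \<open>scal\<close>,
  where the converse direction has to compute it.\<close>

lemma einstein_warped:
  fixes x :: "real^(2 + 'm::finite)"
  assumes x: "ypart x \<in> S"
  defines "m \<equiv> real CARD('m)" and "y \<equiv> ypart x"
  shows "einstein h x $ Inl A $ Inl B = - (m / r y) * (hess g r A B y - lapl g r y * g y $ A $ B)
       - m * (m - 1) * (1 - grad_square g r y) / (2 * (r y)\<^sup>2) * g y $ A $ B"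
    and "einstein h x $ Inl A $ Inr j = 0" and "einstein h x $ Inr j $ Inl A = 0"
    and "einstein h x $ Inr i $ Inr j = \<delta> i j * ((conf_factor (zpart x))\<^sup>2 * (\<kappa> m y - 1/2 * scal m y * (r y)\<^sup>2))"
proof -
  have r0: "r y \<noteq> 0" using r_pos[OF x] by (simp add: y_def)
  show "einstein h x $ Inl A $ Inl B = - (m / r y) * (hess g r A B y - lapl g r y * g y $ A $ B)
       - m * (m - 1) * (1 - grad_square g r y) / (2 * (r y)\<^sup>2) * g y $ A $ B"
    using r0
    by (simp add: einstein_def ricci_warped_AB[OF x] scalar_curvature_warped[OF x] metric_nth m_def[symmetric] y_def[symmetric]
        scal_def \<kappa>_def field_simps power2_eq_square)
  show "einstein h x $ Inl A $ Inr j = 0" "einstein h x $ Inr j $ Inl A = 0"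
    by (simp_all add: einstein_def ricci_warped_mixed[OF x] metric_nth)
  show "einstein h x $ Inr i $ Inr j = \<delta> i j * ((conf_factor (zpart x))\<^sup>2 * (\<kappa> m y - 1/2 * scal m y * (r y)\<^sup>2))"
    by (auto simp: einstein_def ricci_warped_ij[OF x] scalar_curvature_warped[OF x] metric_nth m_def y_def algebra_simps)
qed

end

lemma sum_sym_skew:
  fixes c H :: "'i::finite \<Rightarrow> 'i \<Rightarrow> real"
  assumes "\<And>i j. c i j = c j i" "\<And>i j. H i j = - H j i"
  shows "(\<Sum>i\<in>UNIV. \<Sum>j\<in>UNIV. c i j * H j i) = 0"
proof -
  have "(\<Sum>i\<in>UNIV. \<Sum>j\<in>UNIV. c i j * H j i) = (\<Sum>j\<in>UNIV. \<Sum>i\<in>UNIV. c i j * H j i)"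
    by (rule sum.swap)
  also have "\<dots> = (\<Sum>j\<in>UNIV. \<Sum>i\<in>UNIV. - (c j i * H i j))"
  proof (intro sum.cong refl)
    fix i j show "c i j * H j i = - (c j i * H i j)"
      using assms(1)[of i j] assms(2)[of j i] by simp
  qed
  finally show ?thesis by (simp add: sum_negf)
qed

lemma faraday2_skew: "faraday2 a y $ A $ A = 0" "faraday2 a y $ 1 $ 0 = - faraday2 a y $ 0 $ 1"
  by (simp_all add: faraday2_def)

section \<open>The field equations\<close>

text \<open>The volume density \<open>w\<close> may have either sign: it is \<open>\<surd>(- det g)\<close> when a solution is brought into the
  explicit form, and the Jacobian determinant of the coordinates \<open>t, r\<close> when the explicit form is
  verified.\<close>

locale matter = warped S g r s for S g r s +
  fixes a :: "real^2 \<Rightarrow> real^2" and \<omega> :: "'m::finite sphere_form" and w :: "real^2 \<Rightarrow> real"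
    and m \<alpha> \<beta> :: real and L L'' :: "real \<Rightarrow> real"
  assumes m: "m = real CARD('m)" and a_C2: "\<And>A. Ck_nat 2 S (\<lambda>y. a y $ A)"
    and w_diff: "\<And>y. y \<in> S \<Longrightarrow> w differentiable at y"
    and w_sq: "\<And>y. y \<in> S \<Longrightarrow> (w y)\<^sup>2 = - det2 (g y)"
    and L'': "\<And>X. (deriv L has_real_derivative L'' X) (at X)"
    and form_diff: "\<And>i j z. (\<lambda>z. sphere_form_comp \<omega> s z $ i $ j) differentiable at z"
    and form_skew: "\<And>i j z. sphere_form_comp \<omega> s z $ i $ j = - sphere_form_comp \<omega> s z $ j $ i"
begin

text \<open>Dividing by the volume density makes this a scalar up to orientation. It becomes
  \<open>F\<^sub>t\<^sub>r\<close>, since the coordinates \<open>t, r\<close> will have Jacobian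
  \<open>w\<close>.\<close>

definition \<phi> :: "real^2 \<Rightarrow> real" where
  "\<phi> y = faraday2 a y $ 0 $ 1 / w y"

abbreviation "P z i j \<equiv> sphere_form_comp \<omega> s z $ i $ j"

definition X :: "real^2 \<Rightarrow> real^'m \<Rightarrow> real" where
  "X y z = \<alpha> * (- 2 * (\<phi> y)\<^sup>2 + (\<Sum>i\<in>UNIV. \<Sum>j\<in>UNIV. (P z i j)\<^sup>2) / ((r y)\<^sup>2 * (conf_factor z)\<^sup>2)\<^sup>2)"

lemma w_nz: "y \<in> S \<Longrightarrow> w y \<noteq> 0"
  using w_sq[of y] g_det[of y] by auto

text \<open>Obtained by differentiating \<open>w_sq\<close>, which leaves the sign of
  \<open>w\<close> free.\<close>

lemma pd_w: 
  assumes y: "y \<in> S"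
  shows "pd \<mu> w y = w y * (\<Sum>B\<in>UNIV. \<Gamma> B B \<mu> y)"
proof -
  have "pd \<mu> (\<lambda>y. (w y)\<^sup>2) y = pd \<mu> (\<lambda>y. - det2 (g y)) y"
    by (rule pd_cong[OF open_S y]) (rule w_sq)
  moreover have "(\<lambda>y. det2 (g y)) differentiable at y"
    using Ck1_diff[OF Ck_nat_mono[OF det_C2, of 1] y] by simp
  ultimately have "2 * w y * pd \<mu> w y = 2 * (w y)\<^sup>2 * (\<Sum>B\<in>UNIV. \<Gamma> B B \<mu> y)"
    using w_diff[OF y] w_sq[OF y] by (simp add: pd_power pd_minus pd_det[OF y])
  then show ?thesis using w_nz[OF y] by (simp add: power2_eq_square)
qed

lemma faraday2_diff: "y \<in> S \<Longrightarrow> (\<lambda>y. faraday2 a y $ A $ B) differentiable at y"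
proof -
  assume y: "y \<in> S"
  have "Ck_nat 1 S (pd C (\<lambda>y. a y $ D))" for C D
    using Ck_nat_pd[of 1 S "\<lambda>y. a y $ D" C] a_C2[of D] by (simp add: numeral_2_eq_2)
  then show ?thesis
    unfolding faraday2_def using Ck1_diff[OF _ y] by (simp add: differentiable_diff)
qed

lemma \<phi>_diff: "y \<in> S \<Longrightarrow> \<phi> differentiable at y"
  unfolding \<phi>_def[abs_def] using faraday2_diff w_diff w_nz by (intro differentiable_divide)

section \<open>Algebra of the field tensor\<close>

lemma faraday_nth:
  "faraday a \<omega> s x $ Inl A $ Inl B = faraday2 a (ypart x) $ A $ B" "faraday a \<omega> s x $ Inl A $ Inr j = 0"
  "faraday a \<omega> s x $ Inr i $ Inl B = 0" "faraday a \<omega> s x $ Inr i $ Inr j = P (zpart x) i j"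
  by (simp_all add: faraday_def)

lemma faraday2_01: "y \<in> S \<Longrightarrow> faraday2 a y $ 0 $ 1 = \<phi> y * w y"
  using w_nz by (simp add: \<phi>_def)

text \<open>On the surface, raising both indices of a two-form multiplies it by the determinant of
  the inverse metric, which is \<open>- 1 / (w y)\<^sup>2\<close>; this explains the sign and the
  division by \<open>w\<close>.\<close>

lemma raise_faraday:
  fixes x :: "real^(2 + 'm)"
  assumes x: "ypart x \<in> S"
  shows "raise_both h (faraday a \<omega> s) x $ Inl A $ Inl A = 0"
    and "raise_both h (faraday a \<omega> s) x $ Inl 0 $ Inl 1 = - \<phi> (ypart x) / w (ypart x)"
    and "raise_both h (faraday a \<omega> s) x $ Inl 1 $ Inl 0 = \<phi> (ypart x) / w (ypart x)"
    and "raise_both h (faraday a \<omega> s) x $ Inl A $ Inr j = 0"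
    and "raise_both h (faraday a \<omega> s) x $ Inr i $ Inl B = 0"
    and "raise_both h (faraday a \<omega> s) x $ Inr i $ Inr j = P (zpart x) i j / ((r (ypart x))\<^sup>2 * (conf_factor (zpart x))\<^sup>2)\<^sup>2"
proof -
  define y where "y = ypart x"
  have d: "gi y $ 0 $ 0 * gi y $ 1 $ 1 - gi y $ 0 $ 1 * gi y $ 1 $ 0 = - 1 / (w y)\<^sup>2"
  proof -
    have "g y $ 0 $ 0 * g y $ 1 $ 1 - g y $ 0 $ 1 * g y $ 0 $ 1 = det2 (g y)"
      using g_sym[OF x, of 1 0] by (simp add: det2_def y_def)
    then have "gi y $ 0 $ 0 * gi y $ 1 $ 1 - gi y $ 0 $ 1 * gi y $ 1 $ 0 = 1 / det2 (g y)"
      using g_det[OF x] unfolding gi[OF x, folded y_def] y_def[symmetric]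
      by (simp add: field_simps)
    then show ?thesis using w_sq[OF x] by (simp add: y_def)
  qed
  have F: "(\<Sum>C\<in>UNIV. \<Sum>D\<in>UNIV. gi y $ A $ C * gi y $ B $ D * faraday2 a y $ C $ D)
    = (gi y $ A $ 0 * gi y $ B $ 1 - gi y $ A $ 1 * gi y $ B $ 0) * (\<phi> y * w y)" for A B
    unfolding sum_2' faraday2_skew faraday2_01[OF x, folded y_def] by (simp add: algebra_simps)
  have AB: "raise_both h (faraday a \<omega> s) x $ Inl A $ Inl B
    = (gi y $ A $ 0 * gi y $ B $ 1 - gi y $ A $ 1 * gi y $ B $ 0) * (\<phi> y * w y)" for A B
    unfolding F[symmetric]
    by (simp add: raise_both_def sum_Plus_UNIV inverse_metric[OF x] faraday_nth y_def)
  show "raise_both h (faraday a \<omega> s) x $ Inl A $ Inl A = 0"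
    unfolding AB by simp
  have w: "w y \<noteq> 0" using w_nz[OF x] by (simp add: y_def)
  show "raise_both h (faraday a \<omega> s) x $ Inl 0 $ Inl 1 = - \<phi> (ypart x) / w (ypart x)"
    unfolding AB d using w by (simp add: y_def[symmetric] power2_eq_square)
  have "gi y $ 1 $ 0 * gi y $ 0 $ 1 - gi y $ 1 $ 1 * gi y $ 0 $ 0 = 1 / (w y)\<^sup>2"
    using d by (simp add: mult.commute)
  then show "raise_both h (faraday a \<omega> s) x $ Inl 1 $ Inl 0 = \<phi> (ypart x) / w (ypart x)"
    unfolding AB using w by (simp add: y_def[symmetric] power2_eq_square)
  show "raise_both h (faraday a \<omega> s) x $ Inl A $ Inr j = 0" "raise_both h (faraday a \<omega> s) x $ Inr i $ Inl B = 0"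
    by (simp_all add: raise_both_def sum_Plus_UNIV inverse_metric[OF x] faraday_nth)
  define c where "c = (r (ypart x))\<^sup>2 * (conf_factor (zpart x))\<^sup>2"
  have "raise_both h (faraday a \<omega> s) x $ Inr i $ Inr j
    = (\<Sum>k\<in>UNIV. \<Sum>l\<in>UNIV. \<delta> i k / c * (\<delta> j l / c) * P (zpart x) k l)"
    by (simp add: raise_both_def sum_Plus_UNIV inverse_metric[OF x] faraday_nth c_def)
  also have "\<dots> = (\<Sum>k\<in>UNIV. \<delta> i k * (\<Sum>l\<in>UNIV. \<delta> j l * (P (zpart x) k l / c\<^sup>2)))"
    by (auto simp: sum_distrib_left power2_eq_square intro!: sum.cong)
  also have "\<dots> = P (zpart x) i j / c\<^sup>2"
    unfolding sum_delta ..
  finally show "raise_both h (faraday a \<omega> s) x $ Inr i $ Inr j = P (zpart x) i j / ((r (ypart x))\<^sup>2 * (conf_factor (zpart x))\<^sup>2)\<^sup>2"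
    by (simp add: c_def)
qed

lemma em_invariant_eq:
  fixes x :: "real^(2 + 'm)"
  assumes x: "ypart x \<in> S"
  shows "em_invariant \<alpha> h (faraday a \<omega> s) x = X (ypart x) (zpart x)"
proof -
  have "(\<Sum>\<rho>\<in>UNIV. \<Sum>\<sigma>\<in>UNIV. faraday a \<omega> s x $ \<rho> $ \<sigma> * raise_both h (faraday a \<omega> s) x $ \<rho> $ \<sigma>)
    = - 2 * (\<phi> (ypart x))\<^sup>2 + (\<Sum>i\<in>UNIV. \<Sum>j\<in>UNIV. (P (zpart x) i j)\<^sup>2) / ((r (ypart x))\<^sup>2 * (conf_factor (zpart x))\<^sup>2)\<^sup>2"
    using w_nz[OF x]
    by (simp add: sum_Plus_UNIV raise_faraday[OF x] faraday_nth sum_2' faraday2_skew faraday2_01[OF x]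
      sum_divide_distrib power2_eq_square)
  then show ?thesis by (simp add: em_invariant_def X_def)
qed

lemma stress_energy_eq:
  fixes x :: "real^(2 + 'm)"
  assumes x: "ypart x \<in> S"
  defines "y \<equiv> ypart x" and "z \<equiv> zpart x"
  shows "stress_energy \<alpha> \<beta> L h (faraday a \<omega> s) x $ Inl A $ Inl B
      = - 4 * \<beta> * (\<alpha> * deriv L (X y z) * (\<phi> y)\<^sup>2 + 1/4 * L (X y z)) * g y $ A $ B"
    and "stress_energy \<alpha> \<beta> L h (faraday a \<omega> s) x $ Inl A $ Inr j = 0"
    and "stress_energy \<alpha> \<beta> L h (faraday a \<omega> s) x $ Inr i $ Inl B = 0"
    and "stress_energy \<alpha> \<beta> L h (faraday a \<omega> s) x $ Inr i $ Inr j
      = 4 * \<beta> * (\<alpha> * deriv L (X y z) * (\<Sum>k\<in>UNIV. P z i k * P z j k) / ((r y)\<^sup>2 * (conf_factor z)\<^sup>2)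
         - 1/4 * (\<delta> i j * ((r y)\<^sup>2 * (conf_factor z)\<^sup>2)) * L (X y z))"
proof -
  \<comment> \<open>On a surface the square of a two-form is a multiple of the metric; this is why
    the electric stress on the surface has the shape of a cosmological term.\<close>
  have E: "(\<Sum>C\<in>UNIV. \<Sum>D\<in>UNIV. faraday2 a y $ A $ C * gi y $ C $ D * faraday2 a y $ B $ D) = - (\<phi> y)\<^sup>2 * g y $ A $ B"
  proof -
    have ww: "w y * w y = - det2 (g y)" using w_sq[OF x] by (simp add: y_def power2_eq_square)
    have det: "det2 (g y) \<noteq> 0" using g_det[OF x] by (simp add: y_def)
    have q: "(\<phi> y * w y) * G / det2 (g y) * (\<phi> y * w y) = - (\<phi> y)\<^sup>2 * G" for G
    proof -
      have "(\<phi> y * w y) * G / det2 (g y) * (\<phi> y * w y) = (\<phi> y)\<^sup>2 * G * (w y * w y) / det2 (g y)"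
        by (simp add: power2_eq_square mult_ac)
      then show ?thesis unfolding ww using det by simp
    qed
    show ?thesis
      using exhaust_2'[of A] exhaust_2'[of B] q[of "g y $ 0 $ 0"] q[of "g y $ 0 $ 1"] q[of "g y $ 1 $ 1"] g_sym[OF x, of 1 0]
      by (auto simp: sum_2' faraday2_skew faraday2_01[OF x, folded y_def] gi[OF x, folded y_def] y_def[symmetric])
  qed
  note em = em_invariant_eq[OF x, folded y_def z_def]
  show "stress_energy \<alpha> \<beta> L h (faraday a \<omega> s) x $ Inl A $ Inl B
      = - 4 * \<beta> * (\<alpha> * deriv L (X y z) * (\<phi> y)\<^sup>2 + 1/4 * L (X y z)) * g y $ A $ B"
    using E by (simp add: stress_energy_def em sum_Plus_UNIV faraday_nth inverse_metric[OF x] metric_nth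
      y_def[symmetric] z_def[symmetric] algebra_simps)
  show "stress_energy \<alpha> \<beta> L h (faraday a \<omega> s) x $ Inl A $ Inr j = 0"
    "stress_energy \<alpha> \<beta> L h (faraday a \<omega> s) x $ Inr i $ Inl B = 0"
    by (simp_all add: stress_energy_def sum_Plus_UNIV faraday_nth inverse_metric[OF x] metric_nth)
  define c where "c = (r y)\<^sup>2 * (conf_factor z)\<^sup>2"
  have "(\<Sum>k\<in>UNIV. \<Sum>l\<in>UNIV. P z i k * (\<delta> k l / c) * P z j l) = (\<Sum>k\<in>UNIV. \<Sum>l\<in>UNIV. \<delta> k l * (P z i k * P z j l / c))"
    by (auto intro!: sum.cong)
  also have "\<dots> = (\<Sum>k\<in>UNIV. P z i k * P z j k) / c"
    unfolding sum_delta by (simp add: sum_divide_distrib)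
  finally show "stress_energy \<alpha> \<beta> L h (faraday a \<omega> s) x $ Inr i $ Inr j
      = 4 * \<beta> * (\<alpha> * deriv L (X y z) * (\<Sum>k\<in>UNIV. P z i k * P z j k) / ((r y)\<^sup>2 * (conf_factor z)\<^sup>2)
         - 1/4 * (\<delta> i j * ((r y)\<^sup>2 * (conf_factor z)\<^sup>2)) * L (X y z))"
    by (simp add: stress_energy_def em sum_Plus_UNIV faraday_nth inverse_metric[OF x] metric_nth
      y_def[symmetric] z_def[symmetric] c_def)
qed

text \<open>Symmetry of the connection against antisymmetry of \<open>H\<close> removes the term
  with the free upper index; the other term involves only the traced connection, computed separately
  for surface and sphere.\<close>

lemma divergence_eq:
  fixes x :: "real^(2 + 'm)"
  assumes x: "ypart x \<in> S" and skew: "\<And>\<mu> \<nu>. H x $ \<mu> $ \<nu> = - H x $ \<nu> $ \<mu>"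
  shows "covariant_divergence h H \<mu> x = (\<Sum>\<nu>\<in>UNIV. pd \<nu> (\<lambda>x. H x $ \<mu> $ \<nu>) x)
    + (\<Sum>C\<in>UNIV. ((\<Sum>B\<in>UNIV. \<Gamma> B B C (ypart x)) + m * (pd C r (ypart x) / r (ypart x))) * H x $ \<mu> $ Inl C)
    - (\<Sum>k\<in>UNIV. m * conf_factor (zpart x) * zpart x $ k * H x $ \<mu> $ Inr k)"
proof -
  have csym: "christoffel h \<mu> \<nu> \<rho> x = christoffel h \<mu> \<rho> \<nu> x" for \<mu> \<nu> \<rho> :: "2 + 'm"
    by (cases \<mu>; cases \<nu>; cases \<rho>)
       (simp_all add: christoffel_warped[OF x] christoffel_sym[OF x] sphere_christoffel_swap)
  have 1: "(\<Sum>\<nu>\<in>UNIV. \<Sum>\<rho>\<in>UNIV. christoffel h \<mu> \<nu> \<rho> x * H x $ \<rho> $ \<nu>) = 0"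
    by (rule sum_sym_skew) (rule csym, rule skew)
  have tr: "(\<Sum>\<nu>\<in>UNIV. christoffel h \<nu> \<nu> (Inl C) x) = (\<Sum>B\<in>UNIV. \<Gamma> B B C (ypart x)) + m * (pd C r (ypart x) / r (ypart x))"
    "(\<Sum>\<nu>\<in>UNIV. christoffel h \<nu> \<nu> (Inr k) x) = - m * conf_factor (zpart x) * zpart x $ k" for C k
    using sphere_christoffel_trace[of k "zpart x"]
    by (simp_all add: sum_Plus_UNIV christoffel_warped[OF x] m)
  have 2: "(\<Sum>\<nu>\<in>UNIV. \<Sum>\<rho>\<in>UNIV. christoffel h \<nu> \<nu> \<rho> x * H x $ \<mu> $ \<rho>)
     = (\<Sum>\<rho>\<in>UNIV. (\<Sum>\<nu>\<in>UNIV. christoffel h \<nu> \<nu> \<rho> x) * H x $ \<mu> $ \<rho>)"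
    unfolding sum_distrib_right by (rule sum.swap)
  show ?thesis
    unfolding covariant_divergence_def sum.distrib 1 2
    unfolding sum_Plus_UNIV[of "\<lambda>\<rho>. (\<Sum>\<nu>\<in>UNIV. christoffel h \<nu> \<nu> \<rho> x) * H x $ \<mu> $ \<rho>"] tr
    by (simp add: sum_negf)
qed

section \<open>Maxwell equations of the warped product\<close>

lemma X_diff:
  fixes x :: "real^(2 + 'm)"
  assumes x: "ypart x \<in> S"
  shows "(\<lambda>x. X (ypart x) (zpart x)) differentiable at x"
proof -
  have "((r (ypart x))\<^sup>2 * (conf_factor (zpart x))\<^sup>2)\<^sup>2 \<noteq> 0"
    using r_pos[OF x] conf_factor_pos[of "zpart x"] by simp
  then show ?thesis
    unfolding X_def
    using ypart_differentiable(1)[OF \<phi>_diff[OF x]] ypart_differentiable(1)[OF r_diff[OF x]]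
      zpart_differentiable(1)[OF conf_factor_diff] zpart_differentiable(1)[OF form_diff]
    by (intro differentiable_mult differentiable_add differentiable_divide differentiable_power differentiable_const
        differentiable_sum) auto
qed

definition Lp :: "real^(2 + 'm) \<Rightarrow> real" where
  "Lp x = deriv L (X (ypart x) (zpart x))"

lemma Lp_diff: "ypart x \<in> S \<Longrightarrow> Lp differentiable at x"
  unfolding Lp_def[abs_def] using differentiable_compose_real[OF X_diff L''] .

text \<open>The raised electric field contains \<open>1 / w\<close>, so the quotient rule with
  \<open>pd_w\<close> produces the traced surface connection with the opposite sign, and it cancels.
  The power \<open>4\<close> of the conformal factor comes from the two inverse metrics that raise
  the angular indices.\<close>

lemma maxwell_warped:
  fixes x :: "real^(2 + 'm)"
  assumes x: "ypart x \<in> S"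
  defines "D \<equiv> \<lambda>\<mu>. covariant_divergence h (\<lambda>x. deriv L (em_invariant \<alpha> h (faraday a \<omega> s) x) *\<^sub>R raise_both h (faraday a \<omega> s) x) \<mu> x"
    and "M1 \<equiv> \<lambda>B. pd (Inl B) (\<lambda>x. Lp x * \<phi> (ypart x)) x + m * (pd B r (ypart x) / r (ypart x)) * (Lp x * \<phi> (ypart x))"
  shows "D (Inl 0) = - M1 1 / w (ypart x)" "D (Inl 1) = M1 0 / w (ypart x)"
    "D (Inr i) = (\<Sum>j\<in>UNIV. pd (Inr j) (\<lambda>x. Lp x * (P (zpart x) i j / conf_factor (zpart x) ^ 4)) x
        - m * conf_factor (zpart x) * zpart x $ j * (Lp x * (P (zpart x) i j / conf_factor (zpart x) ^ 4))) / r (ypart x) ^ 4"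
proof -
  define H where "H x = deriv L (em_invariant \<alpha> h (faraday a \<omega> s) x) *\<^sub>R raise_both h (faraday a \<omega> s) x" for x
  have H: "H x $ Inl A $ Inl A = 0" "H x $ Inl 0 $ Inl 1 = - (Lp x * \<phi> (ypart x) / w (ypart x))"
    "H x $ Inl 1 $ Inl 0 = Lp x * \<phi> (ypart x) / w (ypart x)"
    "H x $ Inl A $ Inr j = 0" "H x $ Inr i $ Inl A = 0"
    "H x $ Inr i $ Inr j = Lp x * (P (zpart x) i j / ((r (ypart x))\<^sup>2 * (conf_factor (zpart x))\<^sup>2)\<^sup>2)"
    if "ypart x \<in> S" for x A i j
    unfolding H_def vector_scaleR_component raise_faraday[OF that] em_invariant_eq[OF that]
    by (simp_all add: Lp_def)
  have cong: "pd \<mu> u x = pd \<mu> v x" if "\<And>x. ypart x \<in> S \<Longrightarrow> u x = v x" for \<mu> and u v :: "real^(2 + 'm) \<Rightarrow> real"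
    using pd_cong[OF open_dom, of x u v \<mu>] that x by simp
  have skew: "H x $ \<mu> $ \<nu> = - H x $ \<nu> $ \<mu>" for \<mu> \<nu>
  proof (cases \<mu>; cases \<nu>)
    fix A B assume "\<mu> = Inl A" "\<nu> = Inl B"
    then show ?thesis using exhaust_2'[of A] exhaust_2'[of B] by (auto simp: H[OF x])
  next
    fix i j assume *: "\<mu> = Inr i" "\<nu> = Inr j"
    show ?thesis unfolding * H[OF x] using form_skew[of "zpart x" i j] by simp
  qed (simp_all add: H[OF x])
  define u where "u x = Lp x * \<phi> (ypart x)" for x
  have ud: "u differentiable at x" unfolding u_def[abs_def]
    using Lp_diff[OF x] ypart_differentiable(1)[OF \<phi>_diff[OF x]] by (intro differentiable_mult)
  note wy = ypart_differentiable[of w x, OF w_diff[OF x], unfolded pd_w[OF x]]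
  have pq: "pd (Inl B) (\<lambda>x. u x / w (ypart x)) x = (pd (Inl B) u x - u x * (\<Sum>C\<in>UNIV. \<Gamma> C C B (ypart x))) / w (ypart x)" for B
    using w_nz[OF x] by (simp add: pd_divide ud wy power2_eq_square field_simps)
  have z1: "pd \<mu> (\<lambda>x. H x $ Inl A $ Inl A) x = 0" "pd \<mu> (\<lambda>x. H x $ Inl A $ Inr j) x = 0"
    "pd \<mu> (\<lambda>x. H x $ Inr j $ Inl A) x = 0" for \<mu> A j
    by (subst cong[of _ "\<lambda>x. 0"]; simp add: H)+
  have h01: "pd \<mu> (\<lambda>x. H x $ Inl 0 $ Inl 1) x = - pd \<mu> (\<lambda>x. u x / w (ypart x)) x" for \<mu>
  proof -
    have "pd \<mu> (\<lambda>x. H x $ Inl 0 $ Inl 1) x = pd \<mu> (\<lambda>x. - (u x / w (ypart x))) x"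
      by (rule cong) (simp add: H u_def)
    then show ?thesis using ud wy(1) w_nz[OF x] by (simp add: pd_minus differentiable_divide)
  qed
  have h10: "pd \<mu> (\<lambda>x. H x $ Inl 1 $ Inl 0) x = pd \<mu> (\<lambda>x. u x / w (ypart x)) x" for \<mu>
    by (rule cong) (simp add: H u_def)
  note D = D_def[folded H_def, unfolded divergence_eq[where H=H, OF x skew] sum_Plus_UNIV sum_2']
  have M1: "M1 B = pd (Inl B) u x + m * (pd B r (ypart x) / r (ypart x)) * u x" for B
    by (simp add: M1_def u_def[abs_def])
  show "D (Inl 0) = - M1 1 / w (ypart x)"
    using w_nz[OF x] unfolding D M1
    by (simp add: z1 h01 pq H[OF x] sum_2' u_def[of x] field_simps)
  show "D (Inl 1) = M1 0 / w (ypart x)"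
    using w_nz[OF x] unfolding D M1
    by (simp add: z1 h10 pq H[OF x] sum_2' u_def[of x] field_simps)
  have r0: "r (ypart x) \<noteq> 0" using r_pos[OF x] by simp
  have c0: "conf_factor (zpart x) \<noteq> 0" using conf_factor_pos[of "zpart x"] by simp
  define v where "v j x = Lp x * (P (zpart x) i j / conf_factor (zpart x) ^ 4)" for j x
  have vd: "v j differentiable at x" for j unfolding v_def[abs_def]
    using Lp_diff[OF x] zpart_differentiable(1)[OF form_diff] zpart_differentiable(1)[OF conf_factor_diff] c0
    by (intro differentiable_mult differentiable_divide differentiable_power) auto
  note ry = ypart_differentiable[of r x, OF r_diff[OF x]]
  have Hv: "H x $ Inr i $ Inr j = v j x / r (ypart x) ^ 4" if "ypart x \<in> S" for x j
    unfolding H[OF that] v_def by (simp add: power_mult_distrib mult_ac)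
  have hij: "pd (Inr j) (\<lambda>x. H x $ Inr i $ Inr j) x = pd (Inr j) (v j) x / r (ypart x) ^ 4" for j
  proof -
    define R where "R x = r (ypart x) ^ 4" for x :: "real^(2 + 'm)"
    have R: "R differentiable at x" "pd (Inr j) R x = 0" "R x \<noteq> 0"
      unfolding R_def[abs_def] using ry r0 by (simp_all add: pd_power)
    have "pd (Inr j) (\<lambda>x. H x $ Inr i $ Inr j) x = pd (Inr j) (\<lambda>x. v j x / R x) x"
      by (rule cong) (simp add: Hv R_def)
    also have "\<dots> = pd (Inr j) (v j) x / R x"
      using R vd by (simp add: pd_divide power2_eq_square)
    finally show ?thesis by (simp add: R_def)
  qed
  have "D (Inr i) = (\<Sum>j\<in>UNIV. pd (Inr j) (v j) x - m * conf_factor (zpart x) * zpart x $ j * v j x) / r (ypart x) ^ 4"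
    unfolding D by (simp add: z1 hij H(5)[OF x] Hv[OF x] sum_subtractf sum_divide_distrib diff_divide_distrib)
  then show "D (Inr i) = (\<Sum>j\<in>UNIV. pd (Inr j) (\<lambda>x. Lp x * (P (zpart x) i j / conf_factor (zpart x) ^ 4)) x
        - m * conf_factor (zpart x) * zpart x $ j * (Lp x * (P (zpart x) i j / conf_factor (zpart x) ^ 4))) / r (ypart x) ^ 4"
    unfolding v_def .
qed

text \<open>Four families of scalar equations: Einstein on the surface, Einstein on the sphere, and
  the electric and magnetic Maxwell equations. Being an equivalence, it serves both the derivation
  of the explicit form and its verification.\<close>

theorem field_equations_iff:
  fixes x :: "real^(2 + 'm)"
  assumes x: "ypart x \<in> S"
  defines "y \<equiv> ypart x" and "z \<equiv> zpart x"
  shows "field_equations_at \<alpha> \<beta> L h (faraday a \<omega> s) x \<longleftrightarrow>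
    (\<forall>A B. - (m / r y) * (hess g r A B y - lapl g r y * g y $ A $ B)
         - m * (m - 1) * (1 - grad_square g r y) / (2 * (r y)\<^sup>2) * g y $ A $ B
       = - 4 * \<beta> * (\<alpha> * deriv L (X y z) * (\<phi> y)\<^sup>2 + 1/4 * L (X y z)) * g y $ A $ B) \<and>
    (\<forall>i j. \<delta> i j * ((conf_factor z)\<^sup>2 * (\<kappa> m y - 1/2 * scal m y * (r y)\<^sup>2))
       = 4 * \<beta> * (\<alpha> * deriv L (X y z) * (\<Sum>k\<in>UNIV. P z i k * P z j k) / ((r y)\<^sup>2 * (conf_factor z)\<^sup>2)
         - 1/4 * (\<delta> i j * ((r y)\<^sup>2 * (conf_factor z)\<^sup>2)) * L (X y z))) \<and>
    (\<forall>B. pd (Inl B) (\<lambda>x. Lp x * \<phi> (ypart x)) x + m * (pd B r y / r y) * (Lp x * \<phi> y) = 0) \<and>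
    (\<forall>i. (\<Sum>j\<in>UNIV. pd (Inr j) (\<lambda>x. Lp x * (P (zpart x) i j / conf_factor (zpart x) ^ 4)) x
        - m * conf_factor z * z $ j * (Lp x * (P z i j / conf_factor z ^ 4))) = 0)"
proof -
  have e: "einstein h x = stress_energy \<alpha> \<beta> L h (faraday a \<omega> s) x \<longleftrightarrow>
    (\<forall>A B. - (m / r y) * (hess g r A B y - lapl g r y * g y $ A $ B)
         - m * (m - 1) * (1 - grad_square g r y) / (2 * (r y)\<^sup>2) * g y $ A $ B
       = - 4 * \<beta> * (\<alpha> * deriv L (X y z) * (\<phi> y)\<^sup>2 + 1/4 * L (X y z)) * g y $ A $ B) \<and>
    (\<forall>i j. \<delta> i j * ((conf_factor z)\<^sup>2 * (\<kappa> m y - 1/2 * scal m y * (r y)\<^sup>2))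
       = 4 * \<beta> * (\<alpha> * deriv L (X y z) * (\<Sum>k\<in>UNIV. P z i k * P z j k) / ((r y)\<^sup>2 * (conf_factor z)\<^sup>2)
         - 1/4 * (\<delta> i j * ((r y)\<^sup>2 * (conf_factor z)\<^sup>2)) * L (X y z)))"
    unfolding vec_eq_iff all_Plus einstein_warped[OF x, folded y_def z_def m] stress_energy_eq[OF x, folded y_def z_def]
    by blast
  have w: "w y \<noteq> 0" using w_nz[OF x] by (simp add: y_def)
  have r0: "r y ^ 4 \<noteq> 0" using r_pos[OF x] by (simp add: y_def)
  have d: "a / c = 0 \<longleftrightarrow> a = 0" if "c \<noteq> 0" for a c :: real using that by simp
  have mx: "(\<forall>\<mu>. covariant_divergence h (\<lambda>x. deriv L (em_invariant \<alpha> h (faraday a \<omega> s) x) *\<^sub>R raise_both h (faraday a \<omega> s) x) \<mu> x = 0)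
    \<longleftrightarrow> (\<forall>B. pd (Inl B) (\<lambda>x. Lp x * \<phi> (ypart x)) x + m * (pd B r y / r y) * (Lp x * \<phi> y) = 0) \<and>
    (\<forall>i. (\<Sum>j\<in>UNIV. pd (Inr j) (\<lambda>x. Lp x * (P (zpart x) i j / conf_factor (zpart x) ^ 4)) x
        - m * conf_factor z * z $ j * (Lp x * (P z i j / conf_factor z ^ 4))) = 0)"
    unfolding all_Plus forall_2' maxwell_warped[OF x, folded y_def z_def] d[OF w] d[OF r0] neg_equal_0_iff_equal
    by blast
  show ?thesis
    unfolding field_equations_at_def e mx by (simp only: conj_assoc)
qed

end

section \<open>The angular part of the field\<close>

text \<open>Spreads a failure at a point to an open set, on which the relations then obtained may be
  differentiated.\<close>

lemma nonzero_neighbourhood: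
  fixes f :: "real^'i::finite \<Rightarrow> real"
  assumes "open S" "continuous_on S f" "x \<in> S" "f x \<noteq> 0"
  obtains T where "open T" "x \<in> T" "T \<subseteq> S" "\<And>y. y \<in> T \<Longrightarrow> f y \<noteq> 0"
proof -
  have "open (S \<inter> f -` (- {0}))"
    using assms(2,1) by (rule continuous_open_preimage) auto
  then show ?thesis using that[of "S \<inter> f -` (- {0})"] assms by auto
qed

lemma pd_zero_imp_constant:
  fixes f :: "real^'i::finite \<Rightarrow> real"
  assumes "\<And>z. f differentiable at z" "\<And>i z. pd i f z = 0"
  shows "f z = f z'"
proof -
  have "(f has_derivative (\<lambda>h. 0)) (at z within UNIV)" for z
    using has_derivative_pd[OF assms(1), of z] by (simp add: assms(2))
  then obtain c where "\<And>z. z \<in> UNIV \<Longrightarrow> f z = c"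
    using has_derivative_zero_constant[of UNIV f] by auto
  then show ?thesis by simp
qed

lemma conf_factor_Ck: "Ck_nat k UNIV (conf_factor :: real^'i::finite \<Rightarrow> real)"
proof (induction k)
  case 0
  then show ?case
    by (simp add: differentiable_imp_continuous_on differentiable_on_def conf_factor_diff)
next
  case (Suc k)
  have comp: "Ck_nat l UNIV (\<lambda>z::real^'i. z $ i)" for i l
  proof (cases l)
    case 0 then show ?thesis by (simp add: continuous_on_component)
  next
    case (Suc l')
    have "pd j (\<lambda>z::real^'i. z $ i) = (\<lambda>z. if j = i then 1 else 0)" for j by auto
    then show ?thesis unfolding Suc Ck_nat_Suc_iff[OF open_UNIV] by (simp add: Ck_nat_const)
  qed
  have "Ck_nat k UNIV (\<lambda>z. - (conf_factor z)\<^sup>2 * z $ i)" for i :: 'i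
    by (intro Ck_nat_mult Ck_nat_minus Ck_nat_power open_UNIV Suc comp)
  moreover have "pd i conf_factor = (\<lambda>z. - (conf_factor z)\<^sup>2 * z $ i)" for i :: 'i
    by (auto simp: pd_conf_factor)
  ultimately show ?case
    unfolding Ck_nat_Suc_iff[OF open_UNIV] by (simp add: conf_factor_diff)
qed

text \<open>As the norm is constant, the Weitzenboeck formula is only needed at a single point, the origin of
  the stereographic chart.\<close>

lemma weitzenboeck_at_origin:
  fixes P :: "'m::finite \<Rightarrow> 'm \<Rightarrow> real^'m \<Rightarrow> real"
  assumes C2: "\<And>i j. Ck_nat 2 UNIV (P i j)" and skew: "\<And>i j z. P i j z = - P j i z"
    and closed: "\<And>i j l z. pd i (P j l) z + pd j (P l i) z + pd l (P i j) z = 0"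
    and coclosed: "\<And>i z. (\<Sum>j\<in>UNIV. pd j (P i j) z) = (real CARD('m) - 4) * conf_factor z * (\<Sum>j\<in>UNIV. z $ j * P i j z)"
    and norm: "\<And>z. (\<Sum>i\<in>UNIV. \<Sum>j\<in>UNIV. (P i j z)\<^sup>2) = N * conf_factor z ^ 4"
    and dim: "CARD('m) \<ge> 3"
  shows "N = 0"
proof -
  define m where "m = real CARD('m)"
  have d1: "P i j differentiable at z" for i j z
    using Ck_nat_Suc_D[OF open_UNIV, of 1 "P i j" z] C2[of i j] by (simp add: numeral_2_eq_2)
  have d2: "pd l (P i j) differentiable at z" for i j l z
    using Ck_nat_Suc_D[OF open_UNIV, of 0 "pd l (P i j)" z] C2[of i j] by (simp add: numeral_2_eq_2)
  have comm: "pd k (pd l (P i j)) z = pd l (pd k (P i j)) z" for i j k l z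
    by (rule pd_commute[OF open_UNIV C2]) simp
  have l0: "conf_factor (0::real^'m) = 2" by (simp add: conf_factor_def)
  have pskew: "pd l (P i j) z = - pd l (P j i) z" for i j l z
  proof -
    have "pd l (P i j) z = pd l (\<lambda>z. - P j i z) z"
      by (rule pd_cong[OF open_UNIV]) (auto intro: skew)
    then show ?thesis by (simp add: pd_minus d1)
  qed
  define Q where "Q i z = (\<Sum>j\<in>UNIV. pd j (P i j) z)" for i z
  \<comment> \<open>The divergence carries a factor \<open>z $ j\<close>, so at the origin only the
    derivative of that factor survives, multiplied by the value \<open>2\<close> of the conformal
    factor.\<close>
  have dQ: "pd l (Q i) 0 = (m - 4) * 2 * P i l 0" for i l
  proof -
    have Qeq: "Q i = (\<lambda>z. \<Sum>j\<in>UNIV. (m - 4) * (conf_factor z * z $ j * P i j z))"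
      by (auto simp: Q_def coclosed m_def sum_distrib_left mult_ac)
    have "pd l (\<lambda>z. (m - 4) * (conf_factor z * z $ j * P i j z)) 0 = \<delta> l j * ((m - 4) * 2 * P i j 0)" for j
      by (simp add: pd_cmult pd_mult d1 conf_mult_has_pd differentiable_mult l0)
    then show ?thesis
      unfolding Qeq by (simp add: pd_sum d1 conf_mult_has_pd differentiable_mult sum_delta)
  qed
  have dQ': "pd l (Q i) z = (\<Sum>j\<in>UNIV. pd l (pd j (P i j)) z)" for i l z
    unfolding Q_def[abs_def] by (simp add: pd_sum d2)
  have lap: "(\<Sum>l\<in>UNIV. pd l (pd l (P i j)) 0) = 4 * (m - 4) * P i j 0" for i j
  proof -
    \<comment> \<open>Closedness, differentiated along \<open>l\<close>, trades the Laplacian of a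
      component for derivatives of divergences, which are known from coclosedness.\<close>
    have "pd l (pd l (P i j)) 0 = - pd i (pd l (P j l)) 0 + pd j (pd l (P i l)) 0" for l
    proof -
      have "pd l (P i j) z = - pd i (P j l) z + pd j (P i l) z" for z
        using closed[of i j l z] pskew[of j l i z] by simp
      then have "pd l (pd l (P i j)) 0 = pd l (\<lambda>z. - pd i (P j l) z + pd j (P i l) z) 0"
        by (intro pd_cong[OF open_UNIV]) auto
      then show ?thesis by (simp add: pd_diff d2 comm[of l i] comm[of l j])
    qed
    then have "(\<Sum>l\<in>UNIV. pd l (pd l (P i j)) 0) = - pd i (Q j) 0 + pd j (Q i) 0"
      unfolding dQ' by (simp add: sum_subtractf)
    then show ?thesis unfolding dQ using skew[of j i 0] by (simp add: algebra_simps)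
  qed
  have nrm: "(\<Sum>i\<in>UNIV. \<Sum>j\<in>UNIV. (P i j 0)\<^sup>2) = 16 * N" by (simp add: norm l0)
  \<comment> \<open>The prescribed norm is differentiated twice at the origin, where the conformal
    factor is \<open>2\<close>; the constant is \<open>- 4 * 2 ^ 5\<close>.\<close>
  have second: "(\<Sum>i\<in>UNIV. \<Sum>j\<in>UNIV. 2 * (pd l (P i j) 0)\<^sup>2 + 2 * P i j 0 * pd l (pd l (P i j)) 0) = - 128 * N" for l
  proof -
    have "pd l (\<lambda>z. \<Sum>i\<in>UNIV. \<Sum>j\<in>UNIV. (P i j z)\<^sup>2) z = (\<Sum>i\<in>UNIV. \<Sum>j\<in>UNIV. 2 * P i j z * pd l (P i j) z)" for z
      by (simp add: pd_sum pd_power d1 differentiable_power differentiable_sum)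
    moreover have "pd l (\<lambda>z. \<Sum>i\<in>UNIV. \<Sum>j\<in>UNIV. (P i j z)\<^sup>2) z = (- 4 * N) * (conf_factor z ^ 5 * z $ l)" for z
      unfolding norm using conf_factor_diff[of z]
      by (simp add: pd_cmult pd_power pd_conf_factor differentiable_power)
    ultimately have e: "(\<Sum>i\<in>UNIV. \<Sum>j\<in>UNIV. 2 * P i j z * pd l (P i j) z) = (- 4 * N) * (conf_factor z ^ 5 * z $ l)" for z
      by simp
    have "pd l (\<lambda>z. \<Sum>i\<in>UNIV. \<Sum>j\<in>UNIV. 2 * P i j z * pd l (P i j) z) 0
        = (\<Sum>i\<in>UNIV. \<Sum>j\<in>UNIV. 2 * (pd l (P i j) 0)\<^sup>2 + 2 * P i j 0 * pd l (pd l (P i j)) 0)"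
      by (simp add: pd_sum pd_mult pd_cmult d1 d2 differentiable_mult differentiable_sum power2_eq_square mult.assoc)
    moreover have "pd l (\<lambda>z. (- 4 * N) * (conf_factor z ^ 5 * z $ l)) 0 = - 128 * N"
      by (simp add: pd_minus pd_cmult pd_mult conf_factor_diff differentiable_power differentiable_mult l0)
    ultimately show ?thesis unfolding e by simp
  qed
  have "(\<Sum>l\<in>UNIV. \<Sum>i\<in>UNIV. \<Sum>j\<in>UNIV. 2 * (pd l (P i j) 0)\<^sup>2 + 2 * P i j 0 * pd l (pd l (P i j)) 0) = - 128 * m * N"
    unfolding second by (simp add: m_def)
  moreover have "(\<Sum>l\<in>UNIV. \<Sum>i\<in>UNIV. \<Sum>j\<in>UNIV. 2 * P i j 0 * pd l (pd l (P i j)) 0) = 128 * (m - 4) * N"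
  proof -
    have "(\<Sum>l\<in>UNIV. \<Sum>i\<in>UNIV. \<Sum>j\<in>UNIV. 2 * P i j 0 * pd l (pd l (P i j)) 0)
      = (\<Sum>i\<in>UNIV. \<Sum>l\<in>UNIV. \<Sum>j\<in>UNIV. 2 * P i j 0 * pd l (pd l (P i j)) 0)"
      by (rule sum.swap)
    also have "\<dots> = (\<Sum>i\<in>UNIV. \<Sum>j\<in>UNIV. \<Sum>l\<in>UNIV. 2 * P i j 0 * pd l (pd l (P i j)) 0)"
      by (intro sum.cong refl sum.swap)
    also have "\<dots> = (\<Sum>i\<in>UNIV. \<Sum>j\<in>UNIV. 2 * P i j 0 * (4 * (m - 4) * P i j 0))"
      unfolding sum_distrib_left[symmetric] lap ..
    also have "\<dots> = (\<Sum>i\<in>UNIV. \<Sum>j\<in>UNIV. 8 * (m - 4) * (P i j 0)\<^sup>2)"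
      by (intro sum.cong refl) (simp add: power2_eq_square)
    also have "\<dots> = 128 * (m - 4) * N"
      unfolding sum_distrib_left[symmetric] nrm by simp
    finally show ?thesis .
  qed
  \<comment> \<open>The constants combine to
    \<open>- 128 * m - 128 * (m - 4) = - 256 * (m - 2)\<close>, which is where the dimension enters
    the sign argument.\<close>
  ultimately have "(\<Sum>l\<in>UNIV. \<Sum>i\<in>UNIV. \<Sum>j\<in>UNIV. 2 * (pd l (P i j) 0)\<^sup>2) = - 256 * (m - 2) * N"
    by (simp add: sum.distrib algebra_simps)
  moreover have "(\<Sum>l\<in>UNIV. \<Sum>i\<in>UNIV. \<Sum>j\<in>UNIV. 2 * (pd l (P i j) 0)\<^sup>2) \<ge> 0"
    by (intro sum_nonneg) auto
  ultimately have ge: "0 \<le> (- 256 * (m - 2)) * N" by simp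
  have "m - 2 > 0" using dim by (simp add: m_def)
  then have "- 256 * (m - 2) < 0" by simp
  then have "N \<le> 0" using ge by (simp only: zero_le_mult_iff not_le[symmetric]) argo
  moreover have "16 * N \<ge> 0" unfolding nrm[symmetric] by (intro sum_nonneg) auto
  ultimately show ?thesis by simp
qed

context matter
begin

text \<open>The full contraction \<open>F\<^sub>i\<^sub>j F\<^sup>i\<^sup>j\<close> with respect to
  the unit sphere metric; the fourth power stands for two inverse metrics.\<close>

definition N :: "real^'m \<Rightarrow> real" where
  "N z = (\<Sum>i\<in>UNIV. \<Sum>j\<in>UNIV. (P z i j)\<^sup>2) / conf_factor z ^ 4"

lemma X_N: "X y z = \<alpha> * (- 2 * (\<phi> y)\<^sup>2 + N z / r y ^ 4)"
  by (simp add: X_def N_def power_mult_distrib)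

lemma X0_diff: "y \<in> S \<Longrightarrow> (\<lambda>y. X y z) differentiable at y"
  unfolding X_N using \<phi>_diff[of y] r_diff[of y] r_pos[of y]
  by (intro differentiable_mult differentiable_add differentiable_divide differentiable_power differentiable_const) auto

text \<open>With constant \<open>N\<close> the invariant does not depend on the angles, so the
  factor \<open>Lp\<close> comes out of the angular derivatives and the divergence of the form
  remains. In the coefficient \<open>m - 4\<close>, \<open>m\<close> stems from the volume density
  and \<open>4\<close> from the inverse metrics.\<close>

lemma maxwell_sphere:
  assumes xS: "ypart x \<in> S" and N: "\<And>z z'. N z = N z'"
  shows "(\<Sum>j\<in>UNIV. pd (Inr j) (\<lambda>x. Lp x * (P (zpart x) i j / conf_factor (zpart x) ^ 4)) x
        - m * conf_factor (zpart x) * zpart x $ j * (Lp x * (P (zpart x) i j / conf_factor (zpart x) ^ 4)))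
    = Lp x / conf_factor (zpart x) ^ 4 * (\<Sum>j\<in>UNIV. pd j (\<lambda>z. P z i j) (zpart x)
        - (m - 4) * conf_factor (zpart x) * (zpart x $ j * P (zpart x) i j))"
proof -
  define z where "z = zpart x"
  define l where "l = conf_factor z"
  have l: "l > 0" unfolding l_def by (rule conf_factor_pos)
  define D where "D y = deriv L (X y 0)" for y
  have LpD: "Lp x = D (ypart x)" for x
    unfolding Lp_def D_def X_N using N[of "zpart x" 0] by simp
  have Dd: "D differentiable at (ypart x)"
    unfolding D_def[abs_def] by (rule differentiable_compose_real[OF X0_diff[OF xS] L''])
  define V where "V j z = P z i j / conf_factor z ^ 4" for j z
  have Vd: "V j differentiable at z" for j
    unfolding V_def[abs_def] using form_diff conf_factor_diff l unfolding l_def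
    by (intro differentiable_divide differentiable_power) auto
  have pV: "pd j (V j) z = (pd j (\<lambda>z. P z i j) z + 4 * l * z $ j * P z i j) / l ^ 4" for j
  proof -
    define R where "R z = conf_factor z ^ 4" for z :: "real^'m"
    have R: "R differentiable at z" "pd j R z = - (4 * l * z $ j) * R z" "R z \<noteq> 0" "R z = l ^ 4"
      unfolding R_def[abs_def] using conf_factor_diff[of z] l
      by (simp_all add: pd_power pd_conf_factor l_def) (simp add: power_numeral_reduce)
    have "pd j (V j) z = (pd j (\<lambda>z. P z i j) z * R z - P z i j * pd j R z) / (R z)\<^sup>2"
      unfolding V_def[abs_def] using R(1,3) form_diff by (subst pd_divide[symmetric]) (simp_all add: R_def)
    also have "\<dots> = (pd j (\<lambda>z. P z i j) z + 4 * l * z $ j * P z i j) * R z / (R z * R z)"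
      unfolding R(2) by (simp add: power2_eq_square algebra_simps)
    finally show ?thesis using R(3) by (simp add: R(4)[symmetric])
  qed
  have "pd (Inr j) (\<lambda>x. Lp x * (P (zpart x) i j / conf_factor (zpart x) ^ 4)) x = Lp x * pd j (V j) z" for j
  proof -
    have "pd (Inr j) (\<lambda>x. Lp x * (P (zpart x) i j / conf_factor (zpart x) ^ 4)) x = pd (Inr j) (\<lambda>x. D (ypart x) * V j (zpart x)) x"
      by (simp add: LpD V_def)
    then show ?thesis
      using ypart_differentiable[OF Dd] zpart_differentiable[of "V j" x] Vd
      by (simp add: pd_mult LpD z_def)
  qed
  then have "(\<Sum>j\<in>UNIV. pd (Inr j) (\<lambda>x. Lp x * (P (zpart x) i j / conf_factor (zpart x) ^ 4)) x
        - m * conf_factor (zpart x) * zpart x $ j * (Lp x * (P (zpart x) i j / conf_factor (zpart x) ^ 4)))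
     = (\<Sum>j\<in>UNIV. Lp x * pd j (V j) z - m * l * z $ j * (Lp x * V j z))"
    by (simp add: z_def l_def V_def)
  also have "\<dots> = (\<Sum>j\<in>UNIV. Lp x / l ^ 4 * (pd j (\<lambda>z. P z i j) z - (m - 4) * l * (z $ j * P z i j)))"
    unfolding pV by (intro sum.cong refl) (simp add: V_def l_def[symmetric] algebra_simps add_divide_distrib diff_divide_distrib)
  finally show ?thesis by (simp add: sum_distrib_left z_def l_def)
qed

lemma m_pos: "m > 0" by (simp add: m)

context
  assumes fe: "\<And>x :: real^(2 + 'm). ypart x \<in> S \<Longrightarrow> field_equations_at \<alpha> \<beta> L h (faraday a \<omega> s) x"
    and \<alpha>0: "\<alpha> \<noteq> 0" and \<beta>0: "\<beta> \<noteq> 0" and L'0: "\<And>X. deriv L X \<noteq> 0"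
    and L': "\<And>X. (L has_real_derivative deriv L X) (at X)"
    and form_C2: "\<And>i j. Ck_nat 2 UNIV (\<lambda>z. P z i j)"
    and form_closed: "\<And>i j l z. pd i (\<lambda>z. P z j l) z + pd j (\<lambda>z. P z l i) z + pd l (\<lambda>z. P z i j) z = 0"
begin

section \<open>Consequences of the field equations for the angular form\<close>

lemma field_equation_components:
  assumes y: "y \<in> S"
  shows "- (m / r y) * (hess g r A B y - lapl g r y * g y $ A $ B)
         - m * (m - 1) * (1 - grad_square g r y) / (2 * (r y)\<^sup>2) * g y $ A $ B
       = - 4 * \<beta> * (\<alpha> * deriv L (X y z) * (\<phi> y)\<^sup>2 + 1/4 * L (X y z)) * g y $ A $ B"
    and "\<delta> i j * ((conf_factor z)\<^sup>2 * (\<kappa> m y - 1/2 * scal m y * (r y)\<^sup>2))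
       = 4 * \<beta> * (\<alpha> * deriv L (X y z) * (\<Sum>k\<in>UNIV. P z i k * P z j k) / ((r y)\<^sup>2 * (conf_factor z)\<^sup>2)
         - 1/4 * (\<delta> i j * ((r y)\<^sup>2 * (conf_factor z)\<^sup>2)) * L (X y z))"
    and "ypart x = y \<Longrightarrow> pd (Inl B) (\<lambda>x. Lp x * \<phi> (ypart x)) x + m * (pd B r y / r y) * (Lp x * \<phi> y) = 0"
    and "ypart x = y \<Longrightarrow> zpart x = z \<Longrightarrow> (\<Sum>j\<in>UNIV. pd (Inr j) (\<lambda>x. Lp x * (P (zpart x) i j / conf_factor (zpart x) ^ 4)) x
        - m * conf_factor z * z $ j * (Lp x * (P z i j / conf_factor z ^ 4))) = 0"
proof -
  define x0 :: "real^(2 + 'm)" where "x0 = (\<chi> \<mu>. case \<mu> of Inl A \<Rightarrow> y $ A | Inr i \<Rightarrow> z $ i)"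
  have x0: "ypart x0 = y" "zpart x0 = z"
    by (simp_all add: x0_def ypart_def zpart_def vec_eq_iff)
  show "- (m / r y) * (hess g r A B y - lapl g r y * g y $ A $ B)
         - m * (m - 1) * (1 - grad_square g r y) / (2 * (r y)\<^sup>2) * g y $ A $ B
       = - 4 * \<beta> * (\<alpha> * deriv L (X y z) * (\<phi> y)\<^sup>2 + 1/4 * L (X y z)) * g y $ A $ B"
    using fe[of x0] y field_equations_iff[of x0] unfolding x0 by blast
  show "\<delta> i j * ((conf_factor z)\<^sup>2 * (\<kappa> m y - 1/2 * scal m y * (r y)\<^sup>2))
       = 4 * \<beta> * (\<alpha> * deriv L (X y z) * (\<Sum>k\<in>UNIV. P z i k * P z j k) / ((r y)\<^sup>2 * (conf_factor z)\<^sup>2)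
         - 1/4 * (\<delta> i j * ((r y)\<^sup>2 * (conf_factor z)\<^sup>2)) * L (X y z))"
    using fe[of x0] y field_equations_iff[of x0] unfolding x0 by blast
  show "pd (Inl B) (\<lambda>x. Lp x * \<phi> (ypart x)) x + m * (pd B r y / r y) * (Lp x * \<phi> y) = 0" if "ypart x = y"
    using fe[of x] y field_equations_iff[of x] unfolding that by blast
  show "(\<Sum>j\<in>UNIV. pd (Inr j) (\<lambda>x. Lp x * (P (zpart x) i j / conf_factor (zpart x) ^ 4)) x
        - m * conf_factor z * z $ j * (Lp x * (P z i j / conf_factor z ^ 4))) = 0" if "ypart x = y" "zpart x = z"
    using fe[of x] y field_equations_iff[of x] unfolding that by blast
qed

text \<open>In the angular Einstein equation every other term is a multiple of
  \<open>\<delta> i j\<close>, and the coefficient of the square is nonzero because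
  \<open>deriv L\<close> is. The factor is then found by taking the trace.\<close>

lemma form_square:
  assumes y: "y \<in> S"
  shows "(\<Sum>k\<in>UNIV. P z i k * P z j k) = \<delta> i j * (N z * conf_factor z ^ 4 / m)"
proof -
  define c where "c = (r y)\<^sup>2 * (conf_factor z)\<^sup>2"
  have c: "c > 0" using r_pos[OF y] conf_factor_pos[of z] by (simp add: c_def)
  define b where "b = 4 * \<beta> * \<alpha> * deriv L (X y z)"
  have b: "b \<noteq> 0" using \<alpha>0 \<beta>0 L'0 by (simp add: b_def)
  define e where "e = ((conf_factor z)\<^sup>2 * (\<kappa> m y - 1/2 * scal m y * (r y)\<^sup>2) + \<beta> * c * L (X y z)) * c / b"
  have *: "(\<Sum>k\<in>UNIV. P z i k * P z j k) = \<delta> i j * e" for i j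
  proof -
    have "b * (\<Sum>k\<in>UNIV. P z i k * P z j k) / c = \<delta> i j * ((conf_factor z)\<^sup>2 * (\<kappa> m y - 1/2 * scal m y * (r y)\<^sup>2) + \<beta> * c * L (X y z))"
      using field_equation_components(2)[OF y, of i j z] by (auto simp: b_def c_def algebra_simps)
    then show ?thesis using b c by (auto simp: e_def field_simps)
  qed
  have "N z * conf_factor z ^ 4 = (\<Sum>i\<in>UNIV. \<Sum>j\<in>UNIV. P z i j * P z i j)"
    using conf_factor_pos[of z] by (simp add: N_def power2_eq_square)
  also have "\<dots> = m * e" unfolding * by (simp add: m)
  finally show ?thesis using m_pos unfolding * by simp
qed

lemma N_C2: "Ck_nat 2 UNIV N"
  unfolding N_def[abs_def]
  by (intro Ck_nat_divide Ck_nat_sum Ck_nat_power open_UNIV form_C2 conf_factor_Ck)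
    (simp add: less_imp_neq[OF conf_factor_pos, symmetric])

lemma N_diff: "N differentiable at z"
  using Ck_nat_Suc_D[OF open_UNIV, of 1 N z] N_C2 by (simp add: numeral_2_eq_2)

text \<open>Where \<open>dN\<close> does not vanish, the derivatives along the sphere of the two Einstein equations give two
  linear relations between \<open>\<L>\<^sub>,\<^sub>X\<close> and \<open>\<L>\<^sub>,\<^sub>X\<^sub>X\<close>, which determine \<open>N\<close> by the point \<open>y\<close>.\<close>

lemma N_constant:
  assumes y: "y \<in> S"
  shows "N z = N z'"
proof (rule pd_zero_imp_constant[OF N_diff])
  fix i z0
  show "pd i N z0 = 0"
  proof (rule ccontr)
    assume nz: "pd i N z0 \<noteq> 0"
    have "continuous_on UNIV (pd i N)"
      using N_C2 Ck_nat_1_continuous(2)[of UNIV N i] Ck_nat_mono[of 2 UNIV N 1] by simp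
    then obtain T where T: "open T" "z0 \<in> T" "\<And>z. z \<in> T \<Longrightarrow> pd i N z \<noteq> 0"
      using nonzero_neighbourhood[of UNIV "pd i N" z0] nz by auto
    have r0: "r y > 0" using r_pos[OF y] .
    have "g y $ 0 $ 0 \<noteq> 0 \<or> g y $ 0 $ 1 \<noteq> 0"
      using g_det[OF y] by (auto simp: det2_def)
    then obtain A B where gAB: "g y $ A $ B \<noteq> 0" by blast
    \<comment> \<open>The geometric side lives on the surface alone, hence is constant along the
      sphere; a component with nonzero metric coefficient isolates the scalar equation.\<close>
    define c1 where "c1 = (- (m / r y) * (hess g r A B y - lapl g r y * g y $ A $ B)
         - m * (m - 1) * (1 - grad_square g r y) / (2 * (r y)\<^sup>2) * g y $ A $ B) / (- 4 * \<beta> * g y $ A $ B)"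
    have E1: "\<alpha> * deriv L (X y z) * (\<phi> y)\<^sup>2 + 1/4 * L (X y z) = c1" for z
      using field_equation_components(1)[OF y, of A B z] gAB \<beta>0 by (simp add: c1_def field_simps)
    define c2 where "c2 = (\<kappa> m y - 1/2 * scal m y * (r y)\<^sup>2) / (4 * \<beta>)"
    have E2: "\<alpha> * deriv L (X y z) * (N z / (m * (r y)\<^sup>2)) - 1/4 * (r y)\<^sup>2 * L (X y z) = c2" for z
    proof -
      define l where "l = conf_factor z"
      have l: "l > 0" unfolding l_def by (rule conf_factor_pos)
      define Y where "Y = \<alpha> * deriv L (X y z) * (N z / (m * (r y)\<^sup>2)) - 1/4 * (r y)\<^sup>2 * L (X y z)"
      have "l\<^sup>2 * (4 * \<beta> * c2) = 4 * \<beta> * (\<alpha> * deriv L (X y z) * (N z * l ^ 4 / m) / ((r y)\<^sup>2 * l\<^sup>2) - 1/4 * ((r y)\<^sup>2 * l\<^sup>2) * L (X y z))"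
        using field_equation_components(2)[OF y, of i i z] form_square[OF y, of z i i] \<beta>0 by (simp add: c2_def l_def)
      also have "\<alpha> * deriv L (X y z) * (N z * l ^ 4 / m) / ((r y)\<^sup>2 * l\<^sup>2) = l\<^sup>2 * (\<alpha> * deriv L (X y z) * (N z / (m * (r y)\<^sup>2)))"
        using l by (simp add: power_numeral_reduce power2_eq_square)
      finally have "l\<^sup>2 * (4 * \<beta> * c2) = l\<^sup>2 * (4 * \<beta> * Y)"
        by (simp add: Y_def algebra_simps)
      then show ?thesis using l \<beta>0 by (simp add: Y_def)
    qed
    have const: "N z = r y ^ 4 * (\<phi> y)\<^sup>2 * (4 - m)" if z: "z \<in> T" for z
    proof -
      define l1 where "l1 = deriv L (X y z)"
      define l2 where "l2 = L'' (X y z)"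
      have Xd: "X y differentiable at z" "pd i (X y) z = \<alpha> * (pd i N z / r y ^ 4)"
        unfolding X_N[abs_def] using N_diff[of z] r0
        by (simp_all add: pd_cmult pd_add pd_diff pd_cdivide differentiable_diff differentiable_add differentiable_mult differentiable_divide)
      have dL: "pd i (\<lambda>z. L (X y z)) z = l1 * pd i (X y) z" "(\<lambda>z. L (X y z)) differentiable at z"
        using pd_compose_real[OF Xd(1) L'] differentiable_compose_real[OF Xd(1) L'] by (simp_all add: l1_def)
      have dL': "pd i (\<lambda>z. deriv L (X y z)) z = l2 * pd i (X y) z" "(\<lambda>z. deriv L (X y z)) differentiable at z"
        using pd_compose_real[OF Xd(1) L''] differentiable_compose_real[OF Xd(1) L''] by (simp_all add: l2_def)
      have "pd i (\<lambda>z. \<alpha> * deriv L (X y z) * (\<phi> y)\<^sup>2 + 1/4 * L (X y z)) z = 0"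
        unfolding E1 by simp
      then have 1: "(\<alpha> * l2 * (\<phi> y)\<^sup>2 + l1 / 4) * pd i (X y) z = 0"
        by (simp add: pd_add pd_mult pd_cdivide dL dL' differentiable_mult differentiable_divide algebra_simps)
      have "pd i (\<lambda>z. \<alpha> * deriv L (X y z) * (N z / (m * (r y)\<^sup>2)) - 1/4 * (r y)\<^sup>2 * L (X y z)) z = 0"
        unfolding E2 by simp
      then have 2: "\<alpha> * (l2 * pd i (X y) z) * (N z / (m * (r y)\<^sup>2)) + \<alpha> * l1 * (pd i N z / (m * (r y)\<^sup>2))
          - (r y)\<^sup>2 / 4 * (l1 * pd i (X y) z) = 0"
        using N_diff[of z] r0 m_pos
        by (simp add: pd_diff pd_mult pd_cdivide dL dL' differentiable_mult differentiable_divide l1_def add_divide_distrib)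
      have nz: "pd i N z \<noteq> 0" using T(3)[OF z] .
      then have Xnz: "pd i (X y) z \<noteq> 0" using \<alpha>0 r0 by (simp add: Xd)
      \<comment> \<open>The first relation after cancelling the derivative of \<open>X\<close>;
        since \<open>l1\<close> is nonzero it also forces \<open>l2\<close> to be nonzero.\<close>
      have l1_eq: "l1 = - 4 * \<alpha> * l2 * (\<phi> y)\<^sup>2" using 1 Xnz by simp
      have l1: "l1 \<noteq> 0" using L'0 by (simp add: l1_def)
      then have l2: "l2 \<noteq> 0" using l1_eq by auto
      \<comment> \<open>The second relation with the derivative of \<open>X\<close> inserted,
        factored so that the nonzero derivative of \<open>N\<close> can be cancelled.\<close>
      have "\<alpha> * (pd i N z / (m * (r y)\<^sup>2)) * (\<alpha> * l2 * N z / r y ^ 4 + l1 - m / 4 * l1)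
          = \<alpha> * (l2 * pd i (X y) z) * (N z / (m * (r y)\<^sup>2)) + \<alpha> * l1 * (pd i N z / (m * (r y)\<^sup>2))
          - (r y)\<^sup>2 / 4 * (l1 * pd i (X y) z)"
        unfolding Xd using r0 m_pos by (simp add: field_simps power_numeral_reduce)
      then have "\<alpha> * (pd i N z / (m * (r y)\<^sup>2)) * (\<alpha> * l2 * N z / r y ^ 4 + l1 - m / 4 * l1) = 0"
        unfolding 2 .
      then have "\<alpha> * l2 * N z / r y ^ 4 + l1 - m / 4 * l1 = 0"
        using \<alpha>0 nz r0 m_pos by simp
      then have "\<alpha> * l2 * (N z / r y ^ 4 - (\<phi> y)\<^sup>2 * (4 - m)) = 0"
        unfolding l1_eq by (simp add: algebra_simps)
      then have "N z / r y ^ 4 = (\<phi> y)\<^sup>2 * (4 - m)" using \<alpha>0 l2 by simp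
      then show ?thesis using r0 by (simp add: field_simps)
    qed
    have "pd i N z0 = pd i (\<lambda>z. r y ^ 4 * (\<phi> y)\<^sup>2 * (4 - m)) z0"
      by (rule pd_cong[OF T(1,2)]) (rule const)
    then show False using nz by simp
  qed
qed

text \<open>The magnetic Maxwell equation carries \<open>deriv L\<close> as an overall factor, which
  is nonzero and cancels.\<close>

lemma coclosed:
  assumes y: "y \<in> S"
  shows "(\<Sum>j\<in>UNIV. pd j (\<lambda>z. P z i j) z) = (m - 4) * conf_factor z * (\<Sum>j\<in>UNIV. z $ j * P z i j)"
proof -
  define x :: "real^(2 + 'm)" where "x = (\<chi> \<mu>. case \<mu> of Inl A \<Rightarrow> y $ A | Inr i \<Rightarrow> z $ i)"
  have x: "ypart x = y" "zpart x = z"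
    by (simp_all add: x_def ypart_def zpart_def vec_eq_iff)
  have xS: "ypart x \<in> S" using x y by simp
  have "Lp x / conf_factor z ^ 4 * (\<Sum>j\<in>UNIV. pd j (\<lambda>z. P z i j) z - (m - 4) * conf_factor z * (z $ j * P z i j)) = 0"
    using field_equation_components(4)[OF y x, of i] maxwell_sphere[OF xS N_constant[OF y], of i] unfolding x by simp
  moreover have "Lp x / conf_factor z ^ 4 \<noteq> 0" using L'0 conf_factor_pos[of z] by (simp add: Lp_def)
  ultimately have "(\<Sum>j\<in>UNIV. pd j (\<lambda>z. P z i j) z - (m - 4) * conf_factor z * (z $ j * P z i j)) = 0"
    by simp
  then show ?thesis by (simp add: sum_subtractf sum_distrib_left)
qed

lemma form_vanishes:
  assumes y: "y \<in> S" and dim: "CARD('m) \<ge> 3"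
  shows "N z = 0" "P z i j = 0"
proof -
  have nrm: "(\<Sum>i\<in>UNIV. \<Sum>j\<in>UNIV. (P z i j)\<^sup>2) = N 0 * conf_factor z ^ 4" for z
    using N_constant[OF y, of z 0] conf_factor_pos[of z] by (simp add: N_def field_simps)
  have "N 0 = 0"
    by (rule weitzenboeck_at_origin[where P="\<lambda>i j z. P z i j", OF form_C2 form_skew form_closed
      coclosed[OF y, unfolded m] nrm dim])
  then show "N z = 0" using N_constant[OF y, of z 0] by simp
  have "(\<Sum>i\<in>UNIV. \<Sum>j\<in>UNIV. (P z i j)\<^sup>2) = 0" using nrm \<open>N 0 = 0\<close> by simp
  then show "P z i j = 0"
    by (simp add: sum_nonneg_eq_0_iff sum_nonneg)
qed

text \<open>For \<open>m = 2\<close> the coefficient in \<open>coclosed\<close> is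
  \<open>- 2\<close>, and the single component obeys the same linear first-order equation as the
  squared conformal factor; their quotient is therefore constant. The norm counts both orderings of
  the index pair, whence \<open>2 * q\<^sup>2\<close>.\<close>

lemma form_on_two_sphere:
  assumes y: "y \<in> S" and e: "e1 \<noteq> e2" "UNIV = {e1, e2 :: 'm}"
  shows "\<exists>q. (\<forall>z. P z e1 e2 = q * (conf_factor z)\<^sup>2) \<and> (\<forall>z. N z = 2 * q\<^sup>2)"
proof -
  have "card (UNIV :: 'm set) = 2" unfolding e(2) using e(1) by simp
  then have m2: "m = 2" by (simp add: m)
  have diag: "P z i i = 0" for z i using form_skew[of z i i] by simp
  have all: "i = e1 \<or> i = e2" for i using e(2) by auto
  have sum: "(\<Sum>i\<in>UNIV. u i) = u e1 + u e2" for u :: "'m \<Rightarrow> real" unfolding e(2) using e(1) by simp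
  have p: "pd j (\<lambda>z. P z e1 e2) z = - 2 * conf_factor z * z $ j * P z e1 e2" for j z
  proof -
    have p0: "pd k (\<lambda>z. P z i i) z = 0" for i k by (simp add: diag)
    have "pd e1 (\<lambda>z. P z e2 e1) z = pd e1 (\<lambda>z. - P z e1 e2) z"
      by (rule pd_cong[OF open_UNIV]) (auto intro: form_skew)
    then have "pd e1 (\<lambda>z. P z e2 e1) z = - pd e1 (\<lambda>z. P z e1 e2) z"
      by (simp add: pd_minus form_diff)
    then show ?thesis
      using coclosed[OF y, of e1 z] coclosed[OF y, of e2 z] all[of j] form_skew[of z e2 e1]
      by (auto simp: sum p0 diag m2)
  qed
  define v where "v z = P z e1 e2 / (conf_factor z)\<^sup>2" for z
  have c0: "conf_factor z \<noteq> 0" for z :: "real^'m" using conf_factor_pos[of z] by simp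
  have vc: "v z = v 0" for z
  proof (rule pd_zero_imp_constant)
    fix z i
    show "v differentiable at z" unfolding v_def[abs_def] using form_diff conf_factor_diff c0
      by (intro differentiable_divide differentiable_power) auto
    have "pd i (\<lambda>z. (conf_factor z)\<^sup>2) z = - 2 * conf_factor z * z $ i * (conf_factor z)\<^sup>2"
      by (simp add: pd_power conf_factor_diff pd_conf_factor)
    then show "pd i v z = 0" unfolding v_def[abs_def]
      by (simp add: pd_divide form_diff conf_factor_diff differentiable_power c0 p)
  qed
  have Pv: "P z e1 e2 = v z * (conf_factor z)\<^sup>2" for z
    using c0[of z] by (simp add: v_def)
  have P: "P z e1 e2 = v 0 * (conf_factor z)\<^sup>2" for z
    using Pv[of z] vc[of z] by simp
  have "N z = 2 * (v 0)\<^sup>2" for z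
    using c0[of z] form_skew[of z e2 e1]
    by (simp add: N_def sum diag P power_mult_distrib)
  then show ?thesis using P by blast
qed

end

end

section \<open>From solutions to the explicit form\<close>

lemma Ck_subset: "Ck k S f \<Longrightarrow> T \<subseteq> S \<Longrightarrow> Ck k T f"
  unfolding Ck_def using Ck_nat_subset by blast

context matter
begin

lemma scaled_trace:
  assumes y: "y \<in> S" and h: "\<And>A B. hess g r A B y = c * g y $ A $ B"
  shows "lapl g r y = 2 * c"
proof -
  have "(\<Sum>A\<in>UNIV. \<Sum>B\<in>UNIV. gi y $ A $ B * g y $ A $ B) = 2"
    using g_gi(2)[OF y, of 0 0] g_gi(2)[OF y, of 1 1] g_sym[OF y, of 1 0] by (simp add: sum_2')
  moreover have "lapl g r y = c * (\<Sum>A\<in>UNIV. \<Sum>B\<in>UNIV. gi y $ A $ B * g y $ A $ B)"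
    unfolding lapl_def h sum_2' by (simp add: algebra_simps)
  ultimately show ?thesis by simp
qed

context
  fixes k :: enat and N0 :: real
  assumes g_Ck: "\<And>A B. Ck k S (\<lambda>y. g y $ A $ B)" and r_Ck: "Ck (k + 1) S r" and w_Ck: "Ck k S w" and k2: "k \<ge> 2"
    and nz: "\<And>y. y \<in> S \<Longrightarrow> grad_square g r y \<noteq> 0"
    and \<alpha>0: "\<alpha> \<noteq> 0" and \<beta>0: "\<beta> \<noteq> 0" and L'0: "\<And>X. deriv L X \<noteq> 0"
    and E1: "\<And>y A B. y \<in> S \<Longrightarrow> - (m / r y) * (hess g r A B y - lapl g r y * g y $ A $ B)
         - m * (m - 1) * (1 - grad_square g r y) / (2 * (r y)\<^sup>2) * g y $ A $ B
       = - 4 * \<beta> * (\<alpha> * deriv L (\<alpha> * (- 2 * (\<phi> y)\<^sup>2 + N0 / r y ^ 4)) * (\<phi> y)\<^sup>2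
           + 1/4 * L (\<alpha> * (- 2 * (\<phi> y)\<^sup>2 + N0 / r y ^ 4))) * g y $ A $ B"
    and M1: "\<And>y B. y \<in> S \<Longrightarrow> pd B (\<lambda>y. deriv L (\<alpha> * (- 2 * (\<phi> y)\<^sup>2 + N0 / r y ^ 4)) * \<phi> y) y
        + m * (pd B r y / r y) * (deriv L (\<alpha> * (- 2 * (\<phi> y)\<^sup>2 + N0 / r y ^ 4)) * \<phi> y) = 0"
begin

definition Xr :: "real^2 \<Rightarrow> real" where
  "Xr y = \<alpha> * (- 2 * (\<phi> y)\<^sup>2 + N0 / r y ^ 4)"

text \<open>Energy density up to the factor \<open>4 * \<beta>\<close>: on the surface the stress
  tensor is \<open>- 4 * \<beta> * \<rho> y\<close> times the metric.\<close>

definition \<rho> :: "real^2 \<Rightarrow> real" where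
  "\<rho> y = \<alpha> * deriv L (Xr y) * (\<phi> y)\<^sup>2 + 1/4 * L (Xr y)"

lemma Xr_diff:
  assumes y: "y \<in> S"
  shows "Xr differentiable at y"
    and "pd B Xr y = \<alpha> * (- 4 * \<phi> y * pd B \<phi> y - 4 * N0 * pd B r y / r y ^ 5)"
proof -
  have r0: "r y \<noteq> 0" using r_pos[OF y] by simp
  define R where "R y = r y ^ 4" for y
  have R: "R differentiable at y" "pd B R y = 4 * r y ^ 3 * pd B r y" "R y = r y ^ 4"
    unfolding R_def[abs_def] using r_diff[OF y] by (simp_all add: pd_power)
  have Q: "(\<lambda>y. N0 / R y) differentiable at y" "pd B (\<lambda>y. N0 / R y) y = - 4 * N0 * pd B r y / r y ^ 5"
  proof -
    show "(\<lambda>y. N0 / R y) differentiable at y" using R(1,3) r0 by (intro differentiable_divide) auto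
    have "pd B (\<lambda>y. N0 / R y) y = - N0 * (4 * r y ^ 3 * pd B r y) / (R y)\<^sup>2"
      using pd_divide[of "\<lambda>_. N0" y R B] R r0 by simp
    also have "\<dots> = - 4 * N0 * pd B r y / r y ^ 5"
      unfolding R(3) using r0 by (simp add: field_simps power_numeral_reduce)
    finally show "pd B (\<lambda>y. N0 / R y) y = - 4 * N0 * pd B r y / r y ^ 5" .
  qed
  have Xr: "Xr = (\<lambda>y. \<alpha> * (- 2 * (\<phi> y)\<^sup>2 + N0 / R y))" by (auto simp: Xr_def R_def)
  show "Xr differentiable at y" unfolding Xr
    using \<phi>_diff[OF y] Q(1) by (intro differentiable_mult differentiable_add differentiable_power differentiable_const)
  have s: "(\<lambda>y. - 2 * (\<phi> y)\<^sup>2) differentiable at y" "pd B (\<lambda>y. - 2 * (\<phi> y)\<^sup>2) y = - 4 * \<phi> y * pd B \<phi> y"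
    using pd_cmult[of "\<lambda>y. (\<phi> y)\<^sup>2" y B "-2"] \<phi>_diff[OF y]
    by (auto simp: pd_power intro!: differentiable_mult)
  have "pd B Xr y = \<alpha> * pd B (\<lambda>y. - 2 * (\<phi> y)\<^sup>2 + N0 / R y) y"
    unfolding Xr using s(1) Q(1) by (intro pd_cmult differentiable_add)
  also have "pd B (\<lambda>y. - 2 * (\<phi> y)\<^sup>2 + N0 / R y) y = - 4 * \<phi> y * pd B \<phi> y - 4 * N0 * pd B r y / r y ^ 5"
    using pd_add[OF s(1) Q(1), of B] unfolding s(2) Q(2) by simp
  finally show "pd B Xr y = \<alpha> * (- 4 * \<phi> y * pd B \<phi> y - 4 * N0 * pd B r y / r y ^ 5)" .
qed

lemma Lr_diff:
  assumes y: "y \<in> S"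
  shows "(\<lambda>y. deriv L (Xr y)) differentiable at y"
    and "pd B (\<lambda>y. deriv L (Xr y)) y = L'' (Xr y) * pd B Xr y"
  using differentiable_compose_real[OF Xr_diff(1)[OF y] L''] pd_compose_real[OF Xr_diff(1)[OF y] L''] by auto

text \<open>The surface equation makes the Hessian a multiple of the metric; taking the trace, where
  the metric has trace \<open>2\<close>, identifies the multiple and leaves one scalar
  equation.\<close>

lemma hess_eq:
  assumes y: "y \<in> S"
  shows "hess g r A B y = 1/2 * lapl g r y * g y $ A $ B"
    and "m * ((m - 1) * (1 - grad_square g r y) - r y * lapl g r y) = 8 * \<beta> * (r y)\<^sup>2 * \<rho> y"
proof -
  have r0: "r y > 0" using r_pos[OF y] .
  note e = E1[OF y, folded Xr_def, folded \<rho>_def]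
  define E where "E = 4 * \<beta> * \<rho> y - m * (m - 1) * (1 - grad_square g r y) / (2 * (r y)\<^sup>2)"
  define c where "c = lapl g r y + r y / m * E"
  have h: "hess g r A B y = c * g y $ A $ B" for A B
  proof -
    have "(m / r y) * (hess g r A B y - lapl g r y * g y $ A $ B) = E * g y $ A $ B"
      using e[of A B] unfolding E_def by (simp add: algebra_simps)
    then have "hess g r A B y - lapl g r y * g y $ A $ B = r y / m * (E * g y $ A $ B)"
      using r0 m_pos by (simp add: field_simps)
    then show ?thesis by (simp add: c_def algebra_simps)
  qed
  have l: "lapl g r y = 2 * c" by (rule scaled_trace[OF y h])
  show "hess g r A B y = 1/2 * lapl g r y * g y $ A $ B"
    unfolding h l by simp
  have "r y / m * E = - lapl g r y / 2"
    using l c_def by simp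
  then have E: "E = - (m * lapl g r y) / (2 * r y)"
    using r0 m_pos by (simp add: field_simps)
  have "8 * \<beta> * (r y)\<^sup>2 * \<rho> y - m * (m - 1) * (1 - grad_square g r y) = 2 * (r y)\<^sup>2 * E"
    unfolding E_def using r0 by (simp add: field_simps power2_eq_square)
  also have "\<dots> = - (m * r y * lapl g r y)"
    unfolding E using r0 by (simp add: power2_eq_square)
  finally show "m * ((m - 1) * (1 - grad_square g r y) - r y * lapl g r y) = 8 * \<beta> * (r y)\<^sup>2 * \<rho> y"
    by (simp add: algebra_simps)
qed

text \<open>The derivative of the squared gradient is twice the Hessian applied to the gradient, and
  the Hessian is proportional to the metric. Hence \<open>(Dr)\<^sup>2\<close> is constant along the
  level sets of \<open>r\<close>, which makes it the profile \<open>f\<close>.\<close>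

lemma pd_f:
  assumes y: "y \<in> S"
  shows "pd C (grad_square g r) y = lapl g r y * pd C r y"
proof -
  have "(\<Sum>A\<in>UNIV. grad_up g r A y * g y $ A $ C) = pd C r y"
  proof -
    have "(\<Sum>A\<in>UNIV. grad_up g r A y * g y $ A $ C) = (\<Sum>B\<in>UNIV. (\<Sum>A\<in>UNIV. g y $ C $ A * gi y $ A $ B) * pd B r y)"
      unfolding grad_up_def sum_2' using g_sym[OF y, of 1 0] exhaust_2'[of C] by (auto simp: algebra_simps)
    then show ?thesis using exhaust_2'[of C] by (auto simp: g_gi[OF y] sum_2')
  qed
  moreover have "pd C (grad_square g r) y = lapl g r y * (\<Sum>A\<in>UNIV. grad_up g r A y * g y $ A $ C)"
    unfolding pd_grad_square[OF y] hess_eq(1)[OF y] sum_2' by (simp add: algebra_simps)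
  ultimately show ?thesis by simp
qed

section \<open>Reduction of the electric field to a function of the radius\<close>

lemma w_Ck2: "Ck_nat 2 S w"
  using w_Ck k2 by (auto simp: Ck_def numeral_eq_enat)

lemma \<phi>_C1: "Ck_nat 1 S \<phi>"
proof -
  have "Ck_nat 1 S (pd C (\<lambda>y. a y $ D))" for C D
    using Ck_nat_pd[of 1 S "\<lambda>y. a y $ D" C] a_C2[of D] by (simp add: numeral_2_eq_2)
  then have "Ck_nat 1 S (\<lambda>y. (pd 0 (\<lambda>y. a y $ 1) y - pd 1 (\<lambda>y. a y $ 0) y) / w y)"
    by (intro Ck_nat_divide Ck_nat_diff open_S Ck_nat_mono[OF w_Ck2] w_nz) auto
  then show ?thesis by (simp add: \<phi>_def[abs_def] faraday2_def)
qed

lemma r_C1: "Ck_nat 1 S r"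
  using Ck_nat_mono[OF r_C3, of 1] by simp

text \<open>The Maxwell equation says that \<open>D d\<phi>\<close> is parallel to \<open>dr\<close>, where \<open>D\<close> is the derivative
  of \<open>\<L>\<^sub>,\<^sub>X \<phi>\<close> with respect to \<open>\<phi>\<close>. On an open set where \<open>D\<close> vanishes, the equation determines
  \<open>\<phi>\<^sup>2\<close> as a function of \<open>r\<close>.\<close>

lemma \<phi>_parallel:
  assumes y: "y \<in> S"
  shows "pd 1 r y * pd 0 \<phi> y = pd 0 r y * pd 1 \<phi> y"
proof (rule ccontr)
  define \<xi> where "\<xi> y = pd 1 r y * pd 0 \<phi> y - pd 0 r y * pd 1 \<phi> y" for y
  assume "\<not> ?thesis"
  then have "\<xi> y \<noteq> 0" by (simp add: \<xi>_def)
  moreover have "continuous_on S \<xi>"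
    unfolding \<xi>_def using Ck_nat_1_continuous(2)[OF \<phi>_C1] Ck_nat_1_continuous(2)[OF r_C1]
    by (intro continuous_intros)
  ultimately obtain T where T: "open T" "y \<in> T" "T \<subseteq> S" "\<And>y. y \<in> T \<Longrightarrow> \<xi> y \<noteq> 0"
    using nonzero_neighbourhood[OF open_S _ y, of \<xi>] by metis
  have T': "\<phi> y \<noteq> 0 \<and> (\<phi> y)\<^sup>2 = N0 / m / r y ^ 4" if "y \<in> T" for y
  proof -
    have y: "y \<in> S" using that T(3) by blast
    have r0: "r y > 0" using r_pos[OF y] .
    define l1 where "l1 = deriv L (Xr y)"
    define l2 where "l2 = L'' (Xr y)"
    have l1: "l1 \<noteq> 0" using L'0 by (simp add: l1_def)
    \<comment> \<open>\<open>D\<close> is the derivative of \<open>deriv L X * \<phi>\<close> in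
      \<open>\<phi>\<close> at fixed radius, and \<open>c\<close> is minus the radial derivative at
      fixed \<open>\<phi>\<close>, including the term with \<open>m / r\<close>. Expanded, the
      Maxwell equation says that \<open>D\<close> times the gradient of \<open>\<phi>\<close> is
      \<open>c\<close> times that of \<open>r\<close>.\<close>
    define D where "D = l1 - 4 * \<alpha> * (\<phi> y)\<^sup>2 * l2"
    define c where "c = 4 * \<alpha> * N0 * l2 * \<phi> y / r y ^ 5 - m * l1 * \<phi> y / r y"
    have p: "D * pd B \<phi> y = c * pd B r y" for B
    proof -
      have "pd B (\<lambda>y. deriv L (Xr y) * \<phi> y) y = l2 * pd B Xr y * \<phi> y + l1 * pd B \<phi> y"
        using Lr_diff[OF y] \<phi>_diff[OF y] by (simp add: pd_mult l1_def l2_def)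
      then have "l2 * pd B Xr y * \<phi> y + l1 * pd B \<phi> y + m * (pd B r y / r y) * (l1 * \<phi> y) = 0"
        using M1[OF y, of B, folded Xr_def] by (simp add: l1_def)
      then show ?thesis unfolding Xr_diff(2)[OF y] D_def c_def
        by (simp add: algebra_simps power2_eq_square diff_divide_distrib)
    qed
    have "D * \<xi> y = pd 1 r y * (D * pd 0 \<phi> y) - pd 0 r y * (D * pd 1 \<phi> y)"
      by (simp add: \<xi>_def algebra_simps)
    then have "D * \<xi> y = 0" unfolding p by simp
    then have D: "D = 0" using T(4)[OF that] by simp
    then have \<phi>0: "\<phi> y \<noteq> 0" and l2: "l2 \<noteq> 0" using l1 by (auto simp: D_def)
    have "pd 0 r y \<noteq> 0 \<or> pd 1 r y \<noteq> 0"
      using nz[OF y] by (auto simp: grad_square_def sum_2')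
    \<comment> \<open>With \<open>D = 0\<close> the Maxwell equation reads
      \<open>c * dr = 0\<close>, and \<open>dr\<close> is nonzero because
      \<open>(Dr)\<^sup>2\<close> is.\<close>
    then have "c = 0" using p[of 0] p[of 1] D by auto
    then have "4 * \<alpha> * N0 * l2 * \<phi> y / r y ^ 5 = m * l1 * \<phi> y / r y" by (simp add: c_def)
    then have "\<phi> y * (4 * \<alpha> * N0 * l2) = \<phi> y * (m * l1 * r y ^ 4)"
      using r0 by (simp add: field_simps power_numeral_reduce)
    then have "4 * \<alpha> * N0 * l2 = m * l1 * r y ^ 4" using \<phi>0 by simp
    also have "l1 = 4 * \<alpha> * (\<phi> y)\<^sup>2 * l2" using D by (simp add: D_def)
    finally have "(4 * \<alpha> * l2) * N0 = (4 * \<alpha> * l2) * (m * (\<phi> y)\<^sup>2 * r y ^ 4)" by (simp add: mult_ac)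
    then have "N0 = m * (\<phi> y)\<^sup>2 * r y ^ 4" using \<alpha>0 l2 by simp
    then show ?thesis using \<phi>0 r0 m_pos by simp
  qed
  have "2 * \<phi> y * pd B \<phi> y = - 4 * (N0 / m) * pd B r y / r y ^ 5" for B
  proof -
    have r0: "r y \<noteq> 0" using r_pos[OF y] by simp
    have "pd B (\<lambda>y. (\<phi> y)\<^sup>2) y = pd B (\<lambda>y. N0 / m / r y ^ 4) y"
      using T' by (intro pd_cong[OF T(1,2)]) blast
    moreover have "pd B (\<lambda>y. N0 / m / r y ^ 4) y = N0 / m * (- 4 * inverse (r y) ^ 5) * pd B r y"
    proof (subst pd_compose_real[where u="\<lambda>x. N0 / m / x ^ 4" and u'="N0 / m * (- 4 * inverse (r y) ^ 5)", OF r_diff[OF y]])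
      show "((\<lambda>x. N0 / m / x ^ 4) has_real_derivative N0 / m * (- 4 * inverse (r y) ^ 5)) (at (r y))"
        using r0 m_pos by (auto intro!: derivative_eq_intros simp: field_simps power_numeral_reduce)
    qed simp
    ultimately show ?thesis using \<phi>_diff[OF y] by (simp add: pd_power field_simps)
  qed
  note e = this
  have "2 * \<phi> y * \<xi> y = pd 1 r y * (2 * \<phi> y * pd 0 \<phi> y) - pd 0 r y * (2 * \<phi> y * pd 1 \<phi> y)"
    by (simp add: \<xi>_def algebra_simps)
  then have "2 * \<phi> y * \<xi> y = 0" unfolding e by simp
  then show False using T'[OF T(2)] T(4)[OF T(2)] by simp
qed

text \<open>The factor \<open>r y ^ CARD('m)\<close> integrates the Maxwell equation; the conserved
  quantity is the charge \<open>Qe\<close>.\<close>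

lemma charge_gradient:
  assumes y: "y \<in> S"
  shows "(\<lambda>y. r y ^ CARD('m) * (deriv L (Xr y) * \<phi> y)) differentiable at y"
    and "pd B (\<lambda>y. r y ^ CARD('m) * (deriv L (Xr y) * \<phi> y)) y = 0"
proof -
  have r0: "r y > 0" using r_pos[OF y] .
  have d: "(\<lambda>y. r y ^ CARD('m)) differentiable at y" "(\<lambda>y. deriv L (Xr y) * \<phi> y) differentiable at y"
    using r_diff[OF y] Lr_diff(1)[OF y] \<phi>_diff[OF y] by (auto intro!: differentiable_mult)
  show "(\<lambda>y. r y ^ CARD('m) * (deriv L (Xr y) * \<phi> y)) differentiable at y"
    using d by (rule differentiable_mult)
  have "pd B (\<lambda>y. r y ^ CARD('m) * (deriv L (Xr y) * \<phi> y)) y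
    = real CARD('m) * r y ^ (CARD('m) - 1) * pd B r y * (deriv L (Xr y) * \<phi> y)
      + r y ^ CARD('m) * pd B (\<lambda>y. deriv L (Xr y) * \<phi> y) y"
    using d r_diff[OF y] by (simp add: pd_mult pd_power)
  also have "r y ^ (CARD('m) - 1) = r y ^ CARD('m) / r y"
    using r0 by (simp add: power_diff)
  also have "real CARD('m) * (r y ^ CARD('m) / r y) * pd B r y * (deriv L (Xr y) * \<phi> y)
      + r y ^ CARD('m) * pd B (\<lambda>y. deriv L (Xr y) * \<phi> y) y
     = r y ^ CARD('m) * (pd B (\<lambda>y. deriv L (Xr y) * \<phi> y) y + m * (pd B r y / r y) * (deriv L (Xr y) * \<phi> y))"
    by (simp add: m algebra_simps)
  also have "\<dots> = 0" unfolding M1[OF y, of B, folded Xr_def] by simp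
  finally show "pd B (\<lambda>y. r y ^ CARD('m) * (deriv L (Xr y) * \<phi> y)) y = 0" .
qed

text \<open>The area form applied to the gradient of \<open>r\<close>, over
  \<open>(Dr)\<^sup>2\<close>: up to sign the lowered Kodama vector divided by
  \<open>(Dr)\<^sup>2\<close>. It annihilates the gradient, and its wedge product with
  \<open>dr\<close> is the area form.\<close>

definition \<tau> :: "2 \<Rightarrow> real^2 \<Rightarrow> real" where
  "\<tau> A y = (if A = 0 then w y * grad_up g r 1 y / grad_square g r y
     else - (w y * grad_up g r 0 y / grad_square g r y))"

lemma \<tau>_Ck: "Ck k S (\<tau> A)"
  unfolding Ck_def
proof (intro allI impI)
  fix l assume l: "enat l \<le> k"
  have "enat (Suc l) \<le> k + 1" using l by (cases k) (auto simp: one_enat_def)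
  then have "Ck_nat (Suc l) S r" using r_Ck unfolding Ck_def by blast
  then have dr: "Ck_nat l S (pd B r)" for B by simp
  have gl: "Ck_nat l S (\<lambda>y. g y $ C $ D)" for C D using g_Ck l by (simp add: Ck_def)
  have wl: "Ck_nat l S w" using w_Ck l by (simp add: Ck_def)
  have gul: "Ck_nat l S (grad_up g r C)" for C
    unfolding grad_up_def[abs_def] by (intro Ck_nat_sum Ck_nat_mult open_S gi_Ck gl dr)
  have fl: "Ck_nat l S (grad_square g r)"
    unfolding grad_square_eq[abs_def] by (intro Ck_nat_sum Ck_nat_mult open_S gul dr)
  show "Ck_nat l S (\<tau> A)"
    unfolding \<tau>_def[abs_def]
    by (cases "A = 0") (simp_all, (intro Ck_nat_divide Ck_nat_mult Ck_nat_minus open_S gul fl wl nz; assumption)+)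
qed

text \<open>Up to sign and the density \<open>w\<close>, the exterior derivative is the divergence
  of the vector field \<open>grad r / (Dr)\<^sup>2\<close>. The Laplacian that it produces is
  cancelled by the derivative of the denominator, which \<open>pd_f\<close> identifies as the
  Laplacian times \<open>dr\<close>.\<close>

lemma \<tau>_closed:
  assumes y: "y \<in> S"
  shows "pd A (\<tau> B) y = pd B (\<tau> A) y"
proof -
  define f where "f = grad_square g r y"
  have f0: "f \<noteq> 0" using nz[OF y] by (simp add: f_def)
  define G where "G C = (\<Sum>B\<in>UNIV. \<Gamma> B B C y)" for C
  have quot: "pd B (\<lambda>y. w y * grad_up g r C y / grad_square g r y) y
     = w y * (f * (G B * grad_up g r C y + pd B (grad_up g r C) y) - grad_up g r C y * (lapl g r y * pd B r y)) / f\<^sup>2" for B C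
    using w_diff[OF y] grad_up_diff[OF y] grad_square_diff[OF y] nz[OF y]
    by (simp add: pd_divide pd_mult differentiable_mult pd_w[OF y] pd_f[OF y] f_def G_def algebra_simps)
  have qd: "(\<lambda>y. w y * grad_up g r C y / grad_square g r y) differentiable at y" for C
    using w_diff[OF y] grad_up_diff[OF y] grad_square_diff[OF y] nz[OF y] by (intro differentiable_divide differentiable_mult)
  have t0: "\<tau> 0 = (\<lambda>y. w y * grad_up g r 1 y / grad_square g r y)"
    and t1: "\<tau> 1 = (\<lambda>y. - (w y * grad_up g r 0 y / grad_square g r y))"
    by (auto simp: \<tau>_def)
  have div: "pd 0 (grad_up g r 0) y + pd 1 (grad_up g r 1) y + (G 0 * grad_up g r 0 y + G 1 * grad_up g r 1 y) = lapl g r y"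
    using divergence_grad[OF y] by (simp add: sum_2' G_def)
  have fe: "f = grad_up g r 0 y * pd 0 r y + grad_up g r 1 y * pd 1 r y"
    by (simp add: f_def grad_square_eq sum_2')
  have "pd 0 (\<tau> 1) y - pd 1 (\<tau> 0) y = - w y * (f * (pd 0 (grad_up g r 0) y + pd 1 (grad_up g r 1) y + (G 0 * grad_up g r 0 y + G 1 * grad_up g r 1 y))
      - lapl g r y * (grad_up g r 0 y * pd 0 r y + grad_up g r 1 y * pd 1 r y)) / f\<^sup>2"
    unfolding t0 t1 pd_minus[OF qd] quot by (simp add: diff_divide_distrib add_divide_distrib algebra_simps)
  also have "\<dots> = 0" unfolding div fe[symmetric] by (simp add: algebra_simps)
  finally show ?thesis using exhaust_2'[of A] exhaust_2'[of B] by auto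
qed

text \<open>The mass is taken to be \<open>0\<close>, as the additive constant of the primitive
  absorbs it. The neighbourhood starts as a ball, whose convexity serves both the Poincare lemma and
  the constancy of the charge.\<close>

theorem local_form:
  assumes y0: "y0 \<in> S"
  shows "\<exists>W t Qe Ftr f l u. y0 \<in> W \<and> W \<subseteq> S \<and> coordinates_on (k + 1) W t r \<and> r ` W = {l<..<u} \<and>
    radial_profile (CARD('m) + 2) \<alpha> \<beta> L {l<..<u} (\<lambda>x. \<alpha> * (- 2 * (Ftr x)\<^sup>2 + N0 / x ^ 4)) 0 Qe Ftr f \<and>
    metric_has_form W g t r f \<and> faraday_has_form W a t r Ftr"
proof -
  obtain e where e: "e > 0" "ball y0 e \<subseteq> S" using open_S y0 open_contains_ball by blast
  define V where "V = ball y0 e"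
  have V: "open V" "convex V" "y0 \<in> V" "V \<subseteq> S" using e by (auto simp: V_def)
  have "enat 1 \<le> k" using k2 by (cases k) (auto simp: numeral_eq_enat)
  then have "Ck_nat 1 S (\<tau> A)" for A
    using \<tau>_Ck[of A] unfolding Ck_def by blast
  then have "Ck_nat 1 V (\<tau> A)" for A using V(4) Ck_nat_subset by blast
  then obtain t where t: "\<And>y. y \<in> V \<Longrightarrow> (t has_derivative (\<lambda>h. \<Sum>i\<in>UNIV. h $ i * \<tau> i y)) (at y)"
    using poincare[OF V(1,2), of \<tau>] \<tau>_closed V(4) by blast
  have pt: "pd A t y = \<tau> A y" if "y \<in> V" for A y
    using has_derivative_imp_pd[OF t[OF that]] .
  have tCk: "Ck (k + 1) V t"
    by (rule Ck_potential[OF V(1) t Ck_subset[OF \<tau>_Ck V(4)]])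
  have rCk: "Ck (k + 1) V r"
    using Ck_subset[OF r_Ck V(4)] .
  have k1: "enat 1 \<le> k + 1" by (cases k) (auto simp: one_enat_def)
  have t1: "Ck_nat 1 V t" and r1: "Ck_nat 1 V r"
    using tCk rCk k1 unfolding Ck_def by blast+
  have fup: "grad_square g r y = grad_up g r 0 y * pd 0 r y + grad_up g r 1 y * pd 1 r y" if "y \<in> S" for y
    by (simp add: grad_square_eq sum_2')
  \<comment> \<open>A Jacobian equal to the area density: this matches the product \<open>-1\<close>
    of the two metric coefficients in \<open>t, r\<close>, and it turns \<open>\<phi>\<close> into
    \<open>F\<^sub>t\<^sub>r\<close>.\<close>
  have J: "jac t r y = w y" if "y \<in> V" for y
  proof -
    have yS: "y \<in> S" using that V(4) by blast
    have "jac t r y = w y * (grad_up g r 0 y * pd 0 r y + grad_up g r 1 y * pd 1 r y) / grad_square g r y"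
      unfolding jac_def pt[OF that] by (simp add: \<tau>_def add_divide_distrib algebra_simps)
    then show ?thesis using nz[OF yS] by (simp add: fup[OF yS, symmetric])
  qed
  have J0: "jac t r y0 \<noteq> 0" using J[OF V(3)] w_nz[OF y0] by simp
  obtain W p q l u where W: "open W" "y0 \<in> W" "W \<subseteq> V" "inj_on (\<lambda>y. (t y, r y)) W"
    "\<And>y. y \<in> W \<Longrightarrow> jac t r y \<noteq> 0" "(\<lambda>y. (t y, r y)) ` W = {p<..<q} \<times> {l<..<u}"
    by (rule local_coordinates[OF V(1,3) t1 r1 J0]) (rule that)
  have WS: "W \<subseteq> S" using W(3) V(4) by blast
  have tW: "Ck_nat 1 W t" and rW: "Ck_nat 1 W r" using t1 r1 W(3) Ck_nat_subset by blast+
  have rim: "r ` W = {l<..<u}"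
  proof -
    have ne: "{p<..<q} \<noteq> {}" using W(2,6) by auto
    have "r ` W = snd ` ((\<lambda>y. (t y, r y)) ` W)" by (simp add: image_image)
    then show ?thesis unfolding W(6) using ne by simp
  qed
  note foc = function_of_coordinate[OF W(1) tW rW W(4,5,6)]
  have "\<exists>f. \<forall>y\<in>W. grad_square g r y = f (r y) \<and> (f has_real_derivative
      (pd 0 t y * pd 1 (grad_square g r) y - pd 1 t y * pd 0 (grad_square g r) y) / jac t r y) (at (r y))"
    using WS by (intro foc) (auto simp: grad_square_diff pd_f subset_iff)
  then obtain f where f: "\<And>y. y \<in> W \<Longrightarrow> grad_square g r y = f (r y)"
    "\<And>y. y \<in> W \<Longrightarrow> (f has_real_derivative
      (pd 0 t y * pd 1 (grad_square g r) y - pd 1 t y * pd 0 (grad_square g r) y) / jac t r y) (at (r y))" by blast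
  have f': "(f has_real_derivative lapl g r y) (at (r y))" if "y \<in> W" for y
  proof -
    have yS: "y \<in> S" using that WS by blast
    have "(pd 0 t y * pd 1 (grad_square g r) y - pd 1 t y * pd 0 (grad_square g r) y) = lapl g r y * jac t r y"
      unfolding pd_f[OF yS] jac_def by (simp add: algebra_simps)
    then show ?thesis using f(2)[OF that] W(5)[OF that] by simp
  qed
  have "\<exists>F. \<forall>y\<in>W. \<phi> y = F (r y) \<and> (F has_real_derivative
      (pd 0 t y * pd 1 \<phi> y - pd 1 t y * pd 0 \<phi> y) / jac t r y) (at (r y))"
    using WS by (intro foc) (auto simp: \<phi>_diff \<phi>_parallel subset_iff)
  then obtain F where F: "\<And>y. y \<in> W \<Longrightarrow> \<phi> y = F (r y)" by blast
  have "((\<lambda>y. r y ^ CARD('m) * (deriv L (Xr y) * \<phi> y)) has_derivative (\<lambda>h. 0)) (at y within V)" if "y \<in> V" for y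
  proof -
    have yS: "y \<in> S" using that V(4) by blast
    from has_derivative_pd[OF charge_gradient(1)[OF yS]] show ?thesis
      unfolding charge_gradient(2)[OF yS] by (simp add: has_derivative_at_withinI)
  qed
  then obtain Q where Q: "\<And>y. y \<in> V \<Longrightarrow> r y ^ CARD('m) * (deriv L (Xr y) * \<phi> y) = Q"
    using has_derivative_zero_constant[OF V(2), of "\<lambda>y. r y ^ CARD('m) * (deriv L (Xr y) * \<phi> y)"] by blast
  define Xf where "Xf x = \<alpha> * (- 2 * (F x)\<^sup>2 + N0 / x ^ 4)" for x
  have Xf: "Xr y = Xf (r y)" if "y \<in> W" for y
    using F[OF that] by (simp add: Xr_def Xf_def)
  have "coordinates_on (k + 1) W t r"
    unfolding coordinates_on_def
    using W(1,4,5) Ck_subset[OF tCk W(3)] Ck_subset[OF rCk W(3)] by (auto simp: jac_def)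
  moreover have "radial_profile (CARD('m) + 2) \<alpha> \<beta> L {l<..<u} Xf 0 Q F f"
    unfolding radial_profile_def
  proof (intro conjI exI ballI)
    fix x assume "x \<in> {l<..<u}"
    then obtain y where y: "y \<in> W" "x = r y" unfolding rim[symmetric] by blast
    have yS: "y \<in> S" and yV: "y \<in> V" using y WS W(3) by auto
    have x0: "x > 0" using r_pos[OF yS] y by simp
    show "deriv L (Xf x) * F x = Q / x ^ (CARD('m) + 2 - 2)"
      using Q[OF yV] x0 unfolding Xf[OF y(1)] F[OF y(1)] y(2)[symmetric] by (simp add: field_simps)
    define M where "M = CARD('m) - 1"
    have M: "CARD('m) = Suc M" by (simp add: M_def)
    have M': "CARD('m) + 2 - 3 = M" "CARD('m) + 2 - 2 = Suc M" using M by auto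
    \<comment> \<open>The formula for \<open>f\<close> with mass \<open>0\<close>, solved for the
      primitive; its derivative is then computed from the scalar equation in
      \<open>hess_eq\<close>.\<close>
    define P where "P x = m / (8 * \<beta>) * (x ^ M * (1 - f x))" for x
    have Pd: "(P has_real_derivative m / (8 * \<beta>) * (real M * x ^ (M - 1) * (1 - f x) - x ^ M * lapl g r y)) (at x)"
      unfolding P_def
    proof (rule DERIV_cmult)
      show "((\<lambda>x. x ^ M * (1 - f x)) has_real_derivative real M * x ^ (M - 1) * (1 - f x) - x ^ M * lapl g r y) (at x)"
        using f'[OF y(1)] y(2) by (auto intro!: derivative_eq_intros simp: algebra_simps)
    qed
    have "m * ((m - 1) * (1 - f x) - x * lapl g r y) = 8 * \<beta> * x\<^sup>2 * \<rho> y"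
      using hess_eq(2)[OF yS] f(1)[OF y(1)] y(2) by simp
    then have e: "x ^ M * (m * ((m - 1) * (1 - f x) - x * lapl g r y)) = x * (8 * \<beta> * x ^ Suc M * \<rho> y)"
      by (simp add: power2_eq_square)
    define q where "q = real M * x ^ (M - 1)"
    \<comment> \<open>At \<open>M = 0\<close> the exponent \<open>M - 1\<close> truncates to
      \<open>0\<close>, but the factor \<open>real M\<close> vanishes there, and so does
      \<open>m - 1\<close>.\<close>
    have q: "x * q = x ^ M * (m - 1)" unfolding q_def by (cases M) (auto simp: m M)
    have "x * (m * (q * (1 - f x) - x ^ M * lapl g r y)) = m * ((x * q) * (1 - f x) - x * x ^ M * lapl g r y)"
      by (simp add: algebra_simps)
    also have "\<dots> = x * (8 * \<beta> * x ^ Suc M * \<rho> y)"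
      unfolding q e[symmetric] by (simp add: algebra_simps)
    finally have "m * (q * (1 - f x) - x ^ M * lapl g r y) = 8 * \<beta> * x ^ Suc M * \<rho> y"
      using x0 by simp
    then have "m / (8 * \<beta>) * (real M * x ^ (M - 1) * (1 - f x) - x ^ M * lapl g r y) = x ^ Suc M * \<rho> y"
      unfolding q_def using \<beta>0 by (simp add: field_simps)
    also have "\<rho> y = \<alpha> * deriv L (Xf x) * (F x)\<^sup>2 + 1/4 * L (Xf x)"
      unfolding \<rho>_def Xf[OF y(1)] F[OF y(1)] y(2) ..
    finally show "((\<lambda>x. m / (8 * \<beta>) * (x ^ (CARD('m) - 1) * (1 - f x))) has_real_derivative
        x ^ (CARD('m) + 2 - 2) * (\<alpha> * deriv L (Xf x) * (F x)\<^sup>2 + 1/4 * L (Xf x))) (at x)"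
      using Pd unfolding M' P_def[abs_def] M_def by simp
    have "8 * \<beta> / (real (CARD('m) + 2 - 2) * x ^ (CARD('m) + 2 - 3)) * (m / (8 * \<beta>) * (x ^ (CARD('m) - 1) * (1 - f x))) = 1 - f x"
      using \<beta>0 x0 m_pos by (simp add: m)
    then show "f x = 1 - 2 * 0 / x ^ (CARD('m) + 2 - 3)
       - 8 * \<beta> / (real (CARD('m) + 2 - 2) * x ^ (CARD('m) + 2 - 3)) * (m / (8 * \<beta>) * (x ^ (CARD('m) - 1) * (1 - f x)))"
      by simp
  qed
  moreover have "metric_has_form W g t r f"
    unfolding metric_has_form_def
  proof (intro ballI conjI allI)
    fix y assume y: "y \<in> W"
    have yS: "y \<in> S" and yV: "y \<in> V" using y WS W(3) by auto
    show "f (r y) \<noteq> 0" using nz[OF yS] f(1)[OF y] by simp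
    define D where "D = det2 (g y)"
    define fy where "fy = f (r y)"
    have D: "D \<noteq> 0" using g_det[OF yS] by (simp add: D_def)
    have Dg: "g y $ 0 $ 0 * g y $ 1 $ 1 - g y $ 0 $ 1 * g y $ 0 $ 1 = D"
      using g_sym[OF yS, of 1 0] by (simp add: D_def det2_def)
    have fy: "fy \<noteq> 0" "fy = grad_square g r y" using nz[OF yS] f(1)[OF y] by (simp_all add: fy_def)
    have ww: "w y * w y = - D" using w_sq[OF yS] by (simp add: D_def power2_eq_square)
    define u0 where "u0 = g y $ 1 $ 1 * pd 0 r y - g y $ 0 $ 1 * pd 1 r y"
    define u1 where "u1 = g y $ 0 $ 0 * pd 1 r y - g y $ 0 $ 1 * pd 0 r y"
    have up: "grad_up g r 0 y = u0 / D" "grad_up g r 1 y = u1 / D"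
      by (simp_all add: grad_up_def sum_2' gi[OF yS] u0_def u1_def D_def diff_divide_distrib)
    have fD: "D * fy = u0 * pd 0 r y + u1 * pd 1 r y"
      using D unfolding fy(2) fup[OF yS] up by (simp add: field_simps)
    have t01: "pd 0 t y = w y * u1 / (D * fy)" "pd 1 t y = - (w y * u0 / (D * fy))"
      unfolding pt[OF yV] \<tau>_def fy(2)[symmetric] up by simp_all
    have tt: "- fy * (w y * a / (D * fy)) * (w y * b / (D * fy)) = a * b / (D * fy)" for a b
    proof -
      have "- fy * (w y * a / (D * fy)) * (w y * b / (D * fy)) = - (w y * w y) * fy * (a * b) / ((D * fy) * (D * fy))"
        by (simp add: field_simps)
      then show ?thesis unfolding ww using D fy(1) by (simp add: field_simps)
    qed
    have rr: "inverse fy * a * b = D * a * b / (D * fy)" for a b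
      using D fy(1) by (simp add: field_simps)
    \<comment> \<open>The metric in the orthogonal frame of \<open>dr\<close> and the rotated
      gradient, with denominators cleared; \<open>fD\<close> and \<open>Dg\<close> make these
      polynomial identities.\<close>
    have k: "g y $ 0 $ 0 * (D * fy) = u1 * u1 + D * pd 0 r y * pd 0 r y"
      "g y $ 1 $ 1 * (D * fy) = u0 * u0 + D * pd 1 r y * pd 1 r y"
      "g y $ 0 $ 1 * (D * fy) = - (u1 * u0) + D * pd 0 r y * pd 1 r y"
      unfolding fD unfolding u0_def u1_def Dg[symmetric] by (simp_all add: algebra_simps)
    have k': "g y $ 0 $ 0 = (u1 * u1 + D * pd 0 r y * pd 0 r y) / (D * fy)"
      "g y $ 1 $ 1 = (u0 * u0 + D * pd 1 r y * pd 1 r y) / (D * fy)"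
      "g y $ 0 $ 1 = (- (u1 * u0) + D * pd 0 r y * pd 1 r y) / (D * fy)"
      unfolding k[symmetric] using D fy(1) by simp_all
    have g00: "g y $ 0 $ 0 = - fy * pd 0 t y * pd 0 t y + inverse fy * pd 0 r y * pd 0 r y"
      unfolding t01 tt rr k'(1) by (simp add: add_divide_distrib)
    have g11: "g y $ 1 $ 1 = - fy * pd 1 t y * pd 1 t y + inverse fy * pd 1 r y * pd 1 r y"
      using tt[of u0 u0] unfolding t01 rr k'(2) by (simp add: add_divide_distrib)
    have g01: "g y $ 0 $ 1 = - fy * pd 0 t y * pd 1 t y + inverse fy * pd 0 r y * pd 1 r y"
    proof -
      have s: "- fy * (w y * u1 / (D * fy)) * (- (w y * u0 / (D * fy))) = - (u1 * u0) / (D * fy)"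
        using tt[of u1 u0] by (simp only: mult_minus_right minus_divide_left)
      show ?thesis unfolding t01 s rr k'(3) by (simp only: add_divide_distrib)
    qed
    show "g y $ A $ B = - f (r y) * pd A t y * pd B t y + inverse (f (r y)) * pd A r y * pd B r y" for A B
      using exhaust_2'[of A] exhaust_2'[of B] g00 g11 g01 g_sym[OF yS, of 1 0] unfolding fy_def
      by (auto simp: mult_ac)
  qed
  moreover have "faraday_has_form W a t r F"
    unfolding faraday_has_form_def
  proof (intro ballI allI)
    fix y A B assume y: "y \<in> W"
    have yS: "y \<in> S" and yV: "y \<in> V" using y WS W(3) by auto
    have "faraday2 a y $ 0 $ 1 = F (r y) * (pd 0 t y * pd 1 r y - pd 1 t y * pd 0 r y)"
      using faraday2_01[OF yS] F[OF y] J[OF yV] by (simp add: jac_def)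
    then show "faraday2 a y $ A $ B = F (r y) * (pd A t y * pd B r y - pd B t y * pd A r y)"
      using exhaust_2'[of A] exhaust_2'[of B] faraday2_skew[of a y] by (auto simp: algebra_simps)
  qed
  ultimately show ?thesis
    using W(2) WS rim unfolding Xf_def[abs_def] by blast
qed

end

end

section \<open>Verification of the explicit form\<close>

text \<open>The angular form enters only through its norm, its square and its divergence, so that
  the vanishing form and the monopole form are verified together, with \<open>N0\<close> equal to
  \<open>0\<close> or to twice the squared magnetic charge.\<close>

locale explicit = matter S g r s a \<omega> w m \<alpha> \<beta> L L'' for S g r s a and \<omega> :: "'m::finite sphere_form" and w m \<alpha> \<beta> L L'' +
  fixes k :: enat and t :: "real^2 \<Rightarrow> real" and f F :: "real \<Rightarrow> real" and N0 M0 Q :: real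
  assumes coords: "coordinates_on (k + 1) S t r" and k2: "k \<ge> 2"
    and metric: "metric_has_form S g t r f" and far: "faraday_has_form S a t r F" and w_jac: "w = jac t r"
    and profile: "radial_profile (CARD('m) + 2) \<alpha> \<beta> L (r ` S) (\<lambda>x. \<alpha> * (- 2 * (F x)\<^sup>2 + N0 / x ^ 4)) M0 Q F f"
    and N_eq: "\<And>z. N z = N0"
    and square: "\<And>z i j. (\<Sum>k\<in>UNIV. P z i k * P z j k) = \<delta> i j * (N0 * conf_factor z ^ 4 / m)"
    and coclosed': "\<And>z i. (\<Sum>j\<in>UNIV. pd j (\<lambda>z. P z i j) z - (m - 4) * conf_factor z * (z $ j * P z i j)) = 0"
    and \<beta>0: "\<beta> \<noteq> 0"
    and L': "\<And>X. (L has_real_derivative deriv L X) (at X)"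
begin

section \<open>Geometry of the explicit metric\<close>

lemma f_nz: "y \<in> S \<Longrightarrow> f (r y) \<noteq> 0"
  using metric by (simp add: metric_has_form_def)

lemma g_form: "y \<in> S \<Longrightarrow> g y $ A $ B = - f (r y) * pd A t y * pd B t y + inverse (f (r y)) * pd A r y * pd B r y"
  using metric by (simp add: metric_has_form_def)

lemma J_nz: "y \<in> S \<Longrightarrow> jac t r y \<noteq> 0"
  using w_nz w_jac by simp

lemma t_C3: "Ck_nat 3 S t"
proof -
  have "enat 3 \<le> k + 1" using k2
    by (cases k) (auto simp: one_enat_def numeral_eq_enat)
  then show ?thesis using coords by (simp add: coordinates_on_def Ck_def)
qed

lemma t_diff: "y \<in> S \<Longrightarrow> t differentiable at y"
  using Ck1_diff[OF Ck_nat_mono[OF t_C3, of 1]] by simp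

lemma dt_diff: "y \<in> S \<Longrightarrow> pd A t differentiable at y"
  using Ck_nat_Suc_D[OF open_S, of 1 "pd A t"] t_C3 by (simp add: numeral_3_eq_3)

lemma ddt_sym: "y \<in> S \<Longrightarrow> pd A (pd B t) y = pd B (pd A t) y"
  using pd_commute[OF open_S Ck_nat_mono[OF t_C3]] by simp

lemma \<phi>_F: "y \<in> S \<Longrightarrow> \<phi> y = F (r y)"
proof -
  assume y: "y \<in> S"
  have "faraday2 a y $ 0 $ 1 = F (r y) * w y"
    using far y by (simp add: faraday_has_form_def fun_cong[OF w_jac] jac_def)
  then show ?thesis using w_nz[OF y] by (simp add: \<phi>_def)
qed

definition Xf :: "real \<Rightarrow> real" where
  "Xf x = \<alpha> * (- 2 * (F x)\<^sup>2 + N0 / x ^ 4)"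

lemma X_Xf: "y \<in> S \<Longrightarrow> X y z = Xf (r y)"
  by (simp add: X_N N_eq \<phi>_F Xf_def)

definition \<rho>f :: "real \<Rightarrow> real" where
  "\<rho>f x = \<alpha> * deriv L (Xf x) * (F x)\<^sup>2 + 1/4 * L (Xf x)"

text \<open>The derivative of \<open>f\<close>, with the primitive and the mass eliminated in favour
  of \<open>f\<close> itself: the integral formula solves a first-order linear equation.\<close>

definition f1 :: "real \<Rightarrow> real" where
  "f1 x = (- (8 * \<beta> / m) * x\<^sup>2 * \<rho>f x - (m - 1) * (f x - 1)) / x"

text \<open>The profiles are constrained only on the range of \<open>r\<close>; openness of the
  range permits differentiating these constraints.\<close>

lemma open_range: "y \<in> S \<Longrightarrow> \<forall>\<^sub>F x in nhds (r y). x \<in> r ` S"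
proof -
  assume y: "y \<in> S"
  have "\<forall>\<^sub>F x in nhds (r y). inv_into S (\<lambda>y. (t y, r y)) (t y, x) \<in> S \<and> r (inv_into S (\<lambda>y. (t y, r y)) (t y, x)) = x"
    by (rule coord_curve(3)[OF open_S y Ck_nat_mono[OF t_C3] Ck_nat_mono[OF r_C3] _ J_nz[OF y] t_diff[OF y]])
      (use coords in \<open>simp_all add: coordinates_on_def\<close>)
  then show ?thesis by (rule eventually_mono) force
qed

lemma f_deriv:
  assumes y: "y \<in> S"
  shows "(f has_real_derivative f1 (r y)) (at (r y))"
proof -
  define x where "x = r y"
  have x0: "x > 0" using r_pos[OF y] by (simp add: x_def)
  define M where "M = CARD('m) - 1"
  have M: "CARD('m) = Suc M" by (simp add: M_def)
  have M': "CARD('m) + 2 - 3 = M" "CARD('m) + 2 - 2 = Suc M" using M by auto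
  have mM: "m = real (Suc M)" using M by (simp add: m)
  obtain p where p: "\<And>x. x \<in> r ` S \<Longrightarrow> (p has_real_derivative x ^ Suc M * \<rho>f x) (at x)"
    "\<And>x. x \<in> r ` S \<Longrightarrow> f x = 1 - 2 * M0 / x ^ M - 8 * \<beta> / (m * x ^ M) * p x"
    using profile unfolding radial_profile_def M' Xf_def[symmetric] \<rho>f_def[symmetric] mM[symmetric] by blast
  have xS: "x \<in> r ` S" using y by (simp add: x_def)
  define h where "h x = - 2 * M0 - 8 * \<beta> / m * p x" for x
  have hd: "(h has_real_derivative - (8 * \<beta> / m) * (x ^ Suc M * \<rho>f x)) (at x)"
    unfolding h_def using p(1)[OF xS] m_pos by (auto intro!: derivative_eq_intros)
  have fh: "f x = 1 + h x / x ^ M" if "x \<in> r ` S" for x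
    unfolding p(2)[OF that] h_def by (simp add: diff_divide_distrib)
  have "((\<lambda>x. 1 + h x / x ^ M) has_real_derivative
      (- (8 * \<beta> / m) * (x ^ Suc M * \<rho>f x) * x ^ M - h x * (real M * x ^ (M - 1))) / (x ^ M * x ^ M)) (at x)"
    using hd x0 by (auto intro!: derivative_eq_intros)
  moreover have "(- (8 * \<beta> / m) * (x ^ Suc M * \<rho>f x) * x ^ M - h x * (real M * x ^ (M - 1))) / (x ^ M * x ^ M) = f1 x"
  proof -
    have hx: "h x = (f x - 1) * x ^ M" using fh[OF xS] x0 by simp
    have q: "real M * x ^ (M - 1) = (m - 1) * x ^ M / x" using x0 by (cases M) (auto simp: mM)
    show ?thesis unfolding hx q f1_def using x0 by (simp add: field_simps power2_eq_square)
  qed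
  ultimately have "((\<lambda>x. 1 + h x / x ^ M) has_real_derivative f1 x) (at x)" by simp
  moreover have "\<forall>\<^sub>F x in nhds x. f x = 1 + h x / x ^ M"
    using open_range[OF y] unfolding x_def by (rule eventually_mono) (rule fh)
  ultimately show ?thesis
    unfolding x_def[symmetric] using DERIV_cong_ev[of x x f "\<lambda>x. 1 + h x / x ^ M" "f1 x"] by simp
qed

text \<open>The gradient is the unique vector that the metric lowers to \<open>dr\<close>. The
  candidate \<open>v\<close> has \<open>dt\<close>-component \<open>0\<close> and
  \<open>dr\<close>-component \<open>f (r y)\<close>, and with these the explicit metric yields
  \<open>dr\<close>.\<close>

lemma grad_up_form:
  assumes y: "y \<in> S"
  shows "grad_up g r 0 y = - f (r y) * pd 1 t y / jac t r y" "grad_up g r 1 y = f (r y) * pd 0 t y / jac t r y"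
proof -
  define v where "v = (\<chi> A::2. if A = 0 then - f (r y) * pd 1 t y / jac t r y else f (r y) * pd 0 t y / jac t r y)"
  have J: "jac t r y \<noteq> 0" and f0: "f (r y) \<noteq> 0" using J_nz[OF y] f_nz[OF y] .
  have tv: "pd 0 t y * v $ 0 + pd 1 t y * v $ 1 = 0" by (simp add: v_def)
  have "pd 0 r y * v $ 0 + pd 1 r y * v $ 1 = f (r y) * jac t r y / jac t r y"
    by (simp add: v_def jac_def algebra_simps diff_divide_distrib)
  then have rv: "pd 0 r y * v $ 0 + pd 1 r y * v $ 1 = f (r y)" using J by simp
  have gv: "(\<Sum>B\<in>UNIV. g y $ A $ B * v $ B) = pd A r y" for A
  proof -
    have "(\<Sum>B\<in>UNIV. g y $ A $ B * v $ B) = - f (r y) * pd A t y * (pd 0 t y * v $ 0 + pd 1 t y * v $ 1)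
        + inverse (f (r y)) * pd A r y * (pd 0 r y * v $ 0 + pd 1 r y * v $ 1)"
      unfolding g_form[OF y] sum_2' by (simp add: algebra_simps)
    then show ?thesis unfolding tv rv using f0 by simp
  qed
  have "grad_up g r A y = v $ A" for A
  proof -
    have "grad_up g r A y = (\<Sum>C\<in>UNIV. (\<Sum>B\<in>UNIV. gi y $ A $ B * g y $ B $ C) * v $ C)"
      unfolding grad_up_def gv[symmetric] sum_2' by (simp add: algebra_simps)
    then show ?thesis using exhaust_2'[of A] unfolding g_gi[OF y] by (auto simp: sum_2')
  qed
  then show "grad_up g r 0 y = - f (r y) * pd 1 t y / jac t r y" "grad_up g r 1 y = f (r y) * pd 0 t y / jac t r y"
    by (simp_all add: v_def)
qed

lemma grad_contractions:
  assumes y: "y \<in> S"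
  shows "(\<Sum>A\<in>UNIV. grad_up g r A y * pd A t y) = 0" "(\<Sum>A\<in>UNIV. grad_up g r A y * pd A r y) = f (r y)"
proof -
  show "(\<Sum>A\<in>UNIV. grad_up g r A y * pd A t y) = 0"
    by (simp add: sum_2' grad_up_form[OF y])
  have "(\<Sum>A\<in>UNIV. grad_up g r A y * pd A r y) = f (r y) * jac t r y / jac t r y"
    by (simp add: sum_2' grad_up_form[OF y] jac_def algebra_simps diff_divide_distrib)
  then show "(\<Sum>A\<in>UNIV. grad_up g r A y * pd A r y) = f (r y)" using J_nz[OF y] by simp
qed

lemma grad_square_f: "y \<in> S \<Longrightarrow> grad_square g r y = f (r y)"
  by (simp add: grad_square_eq grad_contractions)

text \<open>The connection contracted with \<open>dr\<close> is the first-kind symbol contracted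
  with the gradient, which \<open>dt\<close> annihilates. All second derivatives of \<open>t\<close>
  thereby drop out, and those of \<open>r\<close> cancel in the Hessian.\<close>

lemma hess_form:
  assumes y: "y \<in> S"
  shows "hess g r A B y = 1/2 * f1 (r y) * g y $ A $ B"
proof -
  have f0: "f (r y) \<noteq> 0" using f_nz[OF y] .
  have fd: "(\<lambda>y. f (r y)) differentiable at y" "pd C (\<lambda>y. f (r y)) y = f1 (r y) * pd C r y" for C
    using differentiable_compose_real[OF r_diff[OF y] f_deriv[OF y]] pd_compose_real[OF r_diff[OF y] f_deriv[OF y]] by auto
  have dg: "pd C (\<lambda>y. g y $ A $ B) y =
      - (f1 (r y) * pd C r y) * pd A t y * pd B t y - f (r y) * (pd C (pd A t) y * pd B t y + pd A t y * pd C (pd B t) y)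
      + (pd C (pd A r) y * pd B r y + pd A r y * pd C (pd B r) y) / f (r y)
      - f1 (r y) * pd C r y * pd A r y * pd B r y / (f (r y))\<^sup>2" for A B C
  proof -
    have e: "pd C (\<lambda>y. g y $ A $ B) y
      = pd C (\<lambda>y. - (f (r y) * (pd A t y * pd B t y)) + inverse (f (r y)) * (pd A r y * pd B r y)) y"
      by (rule pd_cong[OF open_S y]) (simp add: g_form mult.assoc)
    have d: "(\<lambda>y. pd A t y * pd B t y) differentiable at y" "(\<lambda>y. pd A r y * pd B r y) differentiable at y"
      "(\<lambda>y. inverse (f (r y))) differentiable at y"
      using dt_diff[OF y] dr_diff[OF y] fd(1) f0 by (auto intro!: differentiable_mult differentiable_inverse)
    have inv: "pd C (\<lambda>y. inverse (f (r y))) y = - (f1 (r y) * pd C r y) / (f (r y))\<^sup>2"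
      using pd_inverse[of "\<lambda>y. f (r y)" y C] fd f0 by simp
    have "pd C (\<lambda>y. - (f (r y) * (pd A t y * pd B t y)) + inverse (f (r y)) * (pd A r y * pd B r y)) y
      = - (f1 (r y) * pd C r y * (pd A t y * pd B t y) + f (r y) * (pd C (pd A t) y * pd B t y + pd A t y * pd C (pd B t) y))
        + (- (f1 (r y) * pd C r y) / (f (r y))\<^sup>2 * (pd A r y * pd B r y)
           + inverse (f (r y)) * (pd C (pd A r) y * pd B r y + pd A r y * pd C (pd B r) y))"
      using dt_diff[OF y] dr_diff[OF y] fd d f0
      by (simp only: pd_add pd_minus pd_mult inv differentiable_mult differentiable_minus)
    then show ?thesis unfolding e by (simp add: divide_inverse algebra_simps)
  qed
  define u0 where "u0 = grad_up g r 0 y"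
  define u1 where "u1 = grad_up g r 1 y"
  have c1: "u0 * pd 0 t y + u1 * pd 1 t y = 0" and c2: "u0 * pd 0 r y + u1 * pd 1 r y = f (r y)"
    using grad_contractions[OF y] by (simp_all add: sum_2' u0_def u1_def)
  have cl: "cl D A B y = - f (r y) * pd D t y * pd A (pd B t) y + pd D r y * pd A (pd B r) y / f (r y)
     + 1/2 * (- f1 (r y) * (pd A r y * pd D t y * pd B t y + pd B r y * pd A t y * pd D t y - pd D r y * pd A t y * pd B t y)
        - f1 (r y) * (pd A r y * pd B r y * pd D r y) / (f (r y))\<^sup>2)" for D
    unfolding lowered_christoffel_def dg
    using ddt_sym[OF y, of B A] ddt_sym[OF y, of D B] ddt_sym[OF y, of D A]
      ddr_sym[OF y, of B A] ddr_sym[OF y, of D B] ddr_sym[OF y, of D A]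
    by (simp add: algebra_simps add_divide_distrib)
  have "(\<Sum>C\<in>UNIV. \<Gamma> C A B y * pd C r y) = u0 * cl 0 A B y + u1 * cl 1 A B y"
    unfolding christoffel_cl u0_def u1_def grad_up_def sum_2' gi(2)[OF y] gi(3)[OF y] by (simp add: algebra_simps)
  also have "\<dots> = - f (r y) * (u0 * pd 0 t y + u1 * pd 1 t y) * pd A (pd B t) y + (u0 * pd 0 r y + u1 * pd 1 r y) * pd A (pd B r) y / f (r y)
     + 1/2 * (- f1 (r y) * ((pd A r y * pd B t y + pd B r y * pd A t y) * (u0 * pd 0 t y + u1 * pd 1 t y) - (u0 * pd 0 r y + u1 * pd 1 r y) * pd A t y * pd B t y)
        - f1 (r y) * (pd A r y * pd B r y * (u0 * pd 0 r y + u1 * pd 1 r y)) / (f (r y))\<^sup>2)"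
    unfolding cl by (simp add: algebra_simps add_divide_distrib)
  also have "\<dots> = pd A (pd B r) y - 1/2 * f1 (r y) * g y $ A $ B"
    unfolding c1 c2 g_form[OF y] using f0 by (simp add: field_simps power2_eq_square)
  finally show ?thesis by (simp add: hess_def)
qed

lemma lapl_form: "y \<in> S \<Longrightarrow> lapl g r y = f1 (r y)"
  using scaled_trace[of y "1/2 * f1 (r y)"] hess_form by simp

section \<open>Radial equations and the verification of the field equations\<close>

lemma gauss_law: "y \<in> S \<Longrightarrow> deriv L (Xf (r y)) * F (r y) = Q / r y ^ CARD('m)"
  using profile by (simp add: radial_profile_def Xf_def)

text \<open>\<open>F\<close> is differentiable because \<open>\<phi>\<close> is. The differentiated
  Gauss law then eliminates \<open>L''\<close> and the derivative of \<open>F\<close> from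
  \<open>\<rho>'\<close>. The equation for \<open>f2\<close> is the derivative of the equation
  defining \<open>f1\<close>, multiplied by the radius.\<close>

lemma radial_derivatives:
  assumes y: "y \<in> S"
  defines "x \<equiv> r y"
  shows "\<exists>\<rho>' f2. (\<rho>f has_real_derivative \<rho>') (at x) \<and> (f1 has_real_derivative f2) (at x) \<and>
     \<rho>' = - m * \<alpha> * deriv L (Xf x) * (F x)\<^sup>2 / x - \<alpha> * deriv L (Xf x) * N0 / x ^ 5 \<and>
     x\<^sup>2 * f2 = - m * x * f1 x - 8 * \<beta> / m * (2 * x\<^sup>2 * \<rho>f x + x ^ 3 * \<rho>')"
proof -
  have x0: "x > 0" using r_pos[OF y] by (simp add: x_def)
  obtain F' where F': "(F has_real_derivative F') (at x)"
    using profile_derivative[OF open_S y Ck_nat_mono[OF t_C3] Ck_nat_mono[OF r_C3] _ J_nz[OF y] \<phi>_diff[OF y] \<phi>_F] coords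
    unfolding x_def coordinates_on_def by auto
  define l1 where "l1 = deriv L (Xf x)"
  define l2 where "l2 = L'' (Xf x)"
  define X' where "X' = \<alpha> * (- 4 * F x * F' - 4 * N0 / x ^ 5)"
  have Xd: "(Xf has_real_derivative X') (at x)"
    unfolding Xf_def[abs_def] X'_def using F' x0
    by (auto intro!: derivative_eq_intros) (simp add: field_simps power_numeral_reduce)
  have L1: "((\<lambda>x. L (Xf x)) has_real_derivative l1 * X') (at x)"
    unfolding l1_def using DERIV_chain2[OF L' Xd] .
  have L2: "((\<lambda>x. deriv L (Xf x)) has_real_derivative l2 * X') (at x)"
    unfolding l2_def using DERIV_chain2[OF L'' Xd] .
  have LF: "((\<lambda>x. deriv L (Xf x) * F x) has_real_derivative l2 * X' * F x + l1 * F') (at x)"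
    using DERIV_mult[OF L2 F'] by (simp add: l1_def algebra_simps)
  have "((\<lambda>x. Q / x ^ CARD('m)) has_real_derivative - m * (Q / x ^ CARD('m)) / x) (at x)"
  proof -
    have "real CARD('m) * x ^ (CARD('m) - 1) = m * x ^ CARD('m) / x"
      using x0 by (simp add: m power_diff)
    then show ?thesis using x0
      by (auto intro!: derivative_eq_intros simp: m mult_ac)
  qed
  moreover have "\<forall>\<^sub>F x in nhds x. deriv L (Xf x) * F x = Q / x ^ CARD('m)"
    using open_range[OF y] unfolding x_def by (rule eventually_mono) (auto simp: gauss_law)
  ultimately have "((\<lambda>x. deriv L (Xf x) * F x) has_real_derivative - m * (Q / x ^ CARD('m)) / x) (at x)"
    using DERIV_cong_ev[of x x "\<lambda>x. deriv L (Xf x) * F x" "\<lambda>x. Q / x ^ CARD('m)"] by simp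
  then have "l2 * X' * F x + l1 * F' = - m * (Q / x ^ CARD('m)) / x"
    using LF DERIV_unique by blast
  also have "Q / x ^ CARD('m) = l1 * F x" using gauss_law[OF y] by (simp add: x_def l1_def)
  finally have gauss': "l2 * X' * F x = - m * l1 * F x / x - l1 * F'" by simp
  define \<rho>' where "\<rho>' = \<alpha> * (l2 * X') * (F x)\<^sup>2 + \<alpha> * l1 * (2 * F x * F') + 1/4 * (l1 * X')"
  have \<rho>d: "(\<rho>f has_real_derivative \<rho>') (at x)"
    unfolding \<rho>f_def[abs_def] \<rho>'_def
    by (auto intro!: derivative_eq_intros L1 L2 F' simp: l1_def algebra_simps)
  have "\<rho>' = \<alpha> * F x * (l2 * X' * F x) + \<alpha> * l1 * (2 * F x * F') + 1/4 * (l1 * X')"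
    by (simp add: \<rho>'_def power2_eq_square)
  also have "\<dots> = - m * \<alpha> * l1 * (F x)\<^sup>2 / x - \<alpha> * l1 * N0 / x ^ 5"
    unfolding gauss' unfolding X'_def by (simp add: algebra_simps power2_eq_square)
  finally have \<rho>': "\<rho>' = - m * \<alpha> * l1 * (F x)\<^sup>2 / x - \<alpha> * l1 * N0 / x ^ 5" .
  define f2 where "f2 = ((- (8 * \<beta> / m) * (2 * x * \<rho>f x + x\<^sup>2 * \<rho>') - (m - 1) * f1 x) * x
      - (- (8 * \<beta> / m) * x\<^sup>2 * \<rho>f x - (m - 1) * (f x - 1))) / (x * x)"
  have f2: "(f1 has_real_derivative f2) (at x)"
  proof -
    define c where "c = - (8 * \<beta> / m)"
    have "(f has_real_derivative f1 x) (at x)" using f_deriv[OF y] by (simp add: x_def)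
    then have "((\<lambda>x. c * x\<^sup>2 * \<rho>f x - (m - 1) * (f x - 1)) has_real_derivative
        c * (2 * x * \<rho>f x + x\<^sup>2 * \<rho>') - (m - 1) * f1 x) (at x)"
      by (auto intro!: derivative_eq_intros \<rho>d simp: algebra_simps)
    from DERIV_divide[OF this DERIV_ident] show ?thesis
      using x0 unfolding f1_def[abs_def] f2_def c_def by simp
  qed
  have "- (8 * \<beta> / m) * x\<^sup>2 * \<rho>f x - (m - 1) * (f x - 1) = x * f1 x"
    using x0 by (simp add: f1_def)
  then have "x\<^sup>2 * f2 = (- (8 * \<beta> / m) * (2 * x * \<rho>f x + x\<^sup>2 * \<rho>') - (m - 1) * f1 x) * x - x * f1 x"
    unfolding f2_def using x0 by (simp add: power2_eq_square)
  then have "x\<^sup>2 * f2 = - m * x * f1 x - 8 * \<beta> / m * (2 * x\<^sup>2 * \<rho>f x + x ^ 3 * \<rho>')"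
    by (simp add: algebra_simps power2_eq_square power3_eq_cube)
  then show ?thesis using \<rho>d f2 \<rho>' unfolding l1_def by blast
qed

theorem explicit_solution:
  fixes x :: "real^(2 + 'm)"
  assumes x: "ypart x \<in> S"
  shows "field_equations_at \<alpha> \<beta> L h (faraday a \<omega> s) x"
  unfolding field_equations_iff[OF x]
proof (intro conjI allI)
  define y where "y = ypart x"
  define z where "z = zpart x"
  have y: "y \<in> S" using x by (simp add: y_def)
  define \<xi> where "\<xi> = r y"
  have x0: "\<xi> > 0" using r_pos[OF y] by (simp add: \<xi>_def)
  have m1: "m > 0" by (rule m_pos)
  have rf1: "\<xi> * f1 \<xi> + (m - 1) * (f \<xi> - 1) = - (8 * \<beta> / m) * \<xi>\<^sup>2 * \<rho>f \<xi>"
    using x0 by (simp add: f1_def)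
  obtain \<rho>' f2 where d: "(\<rho>f has_real_derivative \<rho>') (at \<xi>)" "(f1 has_real_derivative f2) (at \<xi>)"
    "\<rho>' = - m * \<alpha> * deriv L (Xf \<xi>) * (F \<xi>)\<^sup>2 / \<xi> - \<alpha> * deriv L (Xf \<xi>) * N0 / \<xi> ^ 5"
    "\<xi>\<^sup>2 * f2 = - m * \<xi> * f1 \<xi> - 8 * \<beta> / m * (2 * \<xi>\<^sup>2 * \<rho>f \<xi> + \<xi> ^ 3 * \<rho>')"
    using radial_derivatives[OF y] unfolding \<xi>_def by blast
  show "- (m / r (ypart x)) * (hess g r A B (ypart x) - lapl g r (ypart x) * g (ypart x) $ A $ B)
         - m * (m - 1) * (1 - grad_square g r (ypart x)) / (2 * (r (ypart x))\<^sup>2) * g (ypart x) $ A $ B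
       = - 4 * \<beta> * (\<alpha> * deriv L (X (ypart x) (zpart x)) * (\<phi> (ypart x))\<^sup>2 + 1/4 * L (X (ypart x) (zpart x))) * g (ypart x) $ A $ B" for A B
  proof -
    have "- (m / \<xi>) * (1/2 * f1 \<xi> * G - f1 \<xi> * G) - m * (m - 1) * (1 - f \<xi>) / (2 * \<xi>\<^sup>2) * G
      = m / (2 * \<xi>\<^sup>2) * (\<xi> * f1 \<xi> + (m - 1) * (f \<xi> - 1)) * G" for G
      using x0 by (simp add: field_simps power2_eq_square)
    also have "m / (2 * \<xi>\<^sup>2) * (\<xi> * f1 \<xi> + (m - 1) * (f \<xi> - 1)) * G = - 4 * \<beta> * \<rho>f \<xi> * G" for G
      unfolding rf1 using x0 m1 by simp
    finally show ?thesis
      unfolding y_def[symmetric] hess_form[OF y] lapl_form[OF y] grad_square_f[OF y] X_Xf[OF y] \<phi>_F[OF y]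
        \<xi>_def[symmetric] \<rho>f_def[symmetric] .
  qed
  show "\<delta> i j * ((conf_factor (zpart x))\<^sup>2 * (\<kappa> m (ypart x) - 1/2 * scal m (ypart x) * (r (ypart x))\<^sup>2))
       = 4 * \<beta> * (\<alpha> * deriv L (X (ypart x) (zpart x)) * (\<Sum>k\<in>UNIV. P (zpart x) i k * P (zpart x) j k) / ((r (ypart x))\<^sup>2 * (conf_factor (zpart x))\<^sup>2)
         - 1/4 * (\<delta> i j * ((r (ypart x))\<^sup>2 * (conf_factor (zpart x))\<^sup>2)) * L (X (ypart x) (zpart x)))" for i j
  proof -
    define l where "l = conf_factor z"
    have l: "l > 0" unfolding l_def by (rule conf_factor_pos)
    \<comment> \<open>The Ricci identity, applied with the function \<open>f1 (r y)\<close> in the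
      role of \<open>q\<close>, replaces a direct computation of the curvature.\<close>
    have K: "gauss_curvature g y = - f2 / 2"
    proof (rule gauss_curvature_hess[OF y])
      show "(\<lambda>y. f1 (r y)) differentiable at y" "pd A (\<lambda>y. f1 (r y)) y = f2 * pd A r y" for A
        using differentiable_compose_real[OF r_diff[OF y] d(2)[unfolded \<xi>_def]]
          pd_compose_real[OF r_diff[OF y] d(2)[unfolded \<xi>_def]] by auto
      show "grad_square g r y \<noteq> 0" using grad_square_f[OF y] f_nz[OF y] by simp
    qed (rule hess_form)
    define l1 where "l1 = deriv L (Xf \<xi>)"
    define k1 where "k1 = (m - 1) * (1 - f \<xi>) - \<xi> * f1 \<xi>"
    have k: "\<kappa> m y = k1" unfolding \<kappa>_def k1_def lapl_form[OF y] grad_square_f[OF y] \<xi>_def ..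
    have sc: "scal m y = - f2 - m / \<xi> * f1 \<xi> + m * k1 / \<xi>\<^sup>2"
      unfolding scal_def K k lapl_form[OF y] \<xi>_def by simp
    have "k1 - 1/2 * scal m y * \<xi>\<^sup>2 = k1 * (1 - m / 2) + \<xi>\<^sup>2 * f2 / 2 + m / 2 * \<xi> * f1 \<xi>"
      unfolding sc using x0 by (simp add: field_simps power2_eq_square)
    \<comment> \<open>The second derivative is replaced by the radial equation; the bracket is then
      the left side of \<open>rf1\<close>, so that only matter terms remain.\<close>
    also have "\<dots> = (m / 2 - 1) * (\<xi> * f1 \<xi> + (m - 1) * (f \<xi> - 1)) - 4 * \<beta> / m * (2 * \<xi>\<^sup>2 * \<rho>f \<xi> + \<xi> ^ 3 * \<rho>')"
      unfolding d(4) k1_def by (simp add: algebra_simps diff_divide_distrib add_divide_distrib)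
    also have "\<dots> = - 4 * \<beta> * (\<xi>\<^sup>2 * \<rho>f \<xi> + \<xi> ^ 3 * \<rho>' / m)"
      unfolding rf1 using m1 by (simp add: field_simps)
    also have "\<xi> ^ 3 * \<rho>' / m = - \<alpha> * l1 * (F \<xi>)\<^sup>2 * \<xi>\<^sup>2 - \<alpha> * l1 * N0 / (m * \<xi>\<^sup>2)"
      unfolding d(3) l1_def using x0 m1 by (simp add: field_simps power_numeral_reduce)
    also have "- 4 * \<beta> * (\<xi>\<^sup>2 * \<rho>f \<xi> + (- \<alpha> * l1 * (F \<xi>)\<^sup>2 * \<xi>\<^sup>2 - \<alpha> * l1 * N0 / (m * \<xi>\<^sup>2)))
        = 4 * \<beta> * (\<alpha> * l1 * N0 / (m * \<xi>\<^sup>2) - 1/4 * \<xi>\<^sup>2 * L (Xf \<xi>))"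
      unfolding \<rho>f_def l1_def by (simp add: algebra_simps)
    finally have e: "k1 - 1/2 * scal m y * \<xi>\<^sup>2 = 4 * \<beta> * (\<alpha> * l1 * N0 / (m * \<xi>\<^sup>2) - 1/4 * \<xi>\<^sup>2 * L (Xf \<xi>))" .
    have "\<alpha> * l1 * (N0 * l ^ 4 / m) / (\<xi>\<^sup>2 * l\<^sup>2) = l\<^sup>2 * (\<alpha> * l1 * N0 / (m * \<xi>\<^sup>2))"
      using l by (simp add: power_numeral_reduce power2_eq_square)
    then have "l\<^sup>2 * (k1 - 1/2 * scal m y * \<xi>\<^sup>2) = 4 * \<beta> * (\<alpha> * l1 * (N0 * l ^ 4 / m) / (\<xi>\<^sup>2 * l\<^sup>2) - 1/4 * (\<xi>\<^sup>2 * l\<^sup>2) * L (Xf \<xi>))"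
      unfolding e by (simp add: algebra_simps)
    then show ?thesis
      unfolding square y_def[symmetric] z_def[symmetric] X_Xf[OF y] \<xi>_def[symmetric] l_def[symmetric] l1_def[symmetric] k
      by auto
  qed
  show "pd (Inl B) (\<lambda>x. Lp x * \<phi> (ypart x)) x + m * (pd B r (ypart x) / r (ypart x)) * (Lp x * \<phi> (ypart x)) = 0" for B
  proof -
    have e: "Lp x * \<phi> (ypart x) = Q / r (ypart x) ^ CARD('m)" if "ypart x \<in> S" for x
      unfolding Lp_def X_Xf[OF that] \<phi>_F[OF that] by (rule gauss_law[OF that])
    have u: "((\<lambda>x. Q / x ^ CARD('m)) has_real_derivative - m * (Q / \<xi> ^ CARD('m)) / \<xi>) (at (r y))"
    proof -
      have "real CARD('m) * \<xi> ^ (CARD('m) - 1) = m * \<xi> ^ CARD('m) / \<xi>"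
        using x0 by (simp add: m power_diff)
      then show ?thesis using x0 unfolding \<xi>_def
        by (auto intro!: derivative_eq_intros simp: m mult_ac)
    qed
    have "pd (Inl B) (\<lambda>x. Lp x * \<phi> (ypart x)) x = pd (Inl B) (\<lambda>x. Q / r (ypart x) ^ CARD('m)) x"
      by (rule pd_cong[OF open_dom]) (use x e in auto)
    also have "\<dots> = - m * (Q / \<xi> ^ CARD('m)) / \<xi> * pd B r y"
      using ypart_differentiable(2)[of "\<lambda>y. Q / r y ^ CARD('m)" x B]
        differentiable_compose_real[OF r_diff[OF y] u] pd_compose_real[OF r_diff[OF y] u] by (simp add: y_def)
    finally show ?thesis
      using e[OF x] unfolding y_def[symmetric] by (simp add: \<xi>_def)
  qed
  show "(\<Sum>j\<in>UNIV. pd (Inr j) (\<lambda>x. Lp x * (P (zpart x) i j / conf_factor (zpart x) ^ 4)) x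
        - m * conf_factor (zpart x) * zpart x $ j * (Lp x * (P (zpart x) i j / conf_factor (zpart x) ^ 4))) = 0" for i
    unfolding maxwell_sphere[OF x, unfolded N_eq, OF refl] coclosed' by simp
qed

end

section \<open>The general solution\<close>

context matter
begin

text \<open>With constant angular norm the surface Einstein and electric Maxwell equations close on
  the surface; they are read off at a point whose angular coordinates are set to
  \<open>0\<close>.\<close>

lemma reduced_equations:
  assumes fe: "\<And>x :: real^(2 + 'm). ypart x \<in> S \<Longrightarrow> field_equations_at \<alpha> \<beta> L h (faraday a \<omega> s) x"
    and N: "\<And>z. N z = N0" and y: "y \<in> S"
  defines "Y0 \<equiv> \<lambda>y. \<alpha> * (- 2 * (\<phi> y)\<^sup>2 + N0 / r y ^ 4)"
  shows "- (m / r y) * (hess g r A B y - lapl g r y * g y $ A $ B)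
         - m * (m - 1) * (1 - grad_square g r y) / (2 * (r y)\<^sup>2) * g y $ A $ B
       = - 4 * \<beta> * (\<alpha> * deriv L (Y0 y) * (\<phi> y)\<^sup>2 + 1/4 * L (Y0 y)) * g y $ A $ B"
    and "pd B (\<lambda>y. deriv L (Y0 y) * \<phi> y) y + m * (pd B r y / r y) * (deriv L (Y0 y) * \<phi> y) = 0"
proof -
  have Y0: "X y z = Y0 y" for y z by (simp add: X_N N Y0_def)
  define x :: "real^(2 + 'm)" where "x = (\<chi> \<mu>. case \<mu> of Inl A \<Rightarrow> y $ A | Inr i \<Rightarrow> 0)"
  have x: "ypart x = y" by (simp add: x_def ypart_def vec_eq_iff)
  have xS: "ypart x \<in> S" using x y by simp
  note eq = fe[OF xS, unfolded field_equations_iff[OF xS], unfolded x Y0]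
  show "- (m / r y) * (hess g r A B y - lapl g r y * g y $ A $ B)
         - m * (m - 1) * (1 - grad_square g r y) / (2 * (r y)\<^sup>2) * g y $ A $ B
       = - 4 * \<beta> * (\<alpha> * deriv L (Y0 y) * (\<phi> y)\<^sup>2 + 1/4 * L (Y0 y)) * g y $ A $ B"
    using eq by blast
  have Lp: "Lp x = deriv L (Y0 (ypart x))" for x by (simp add: Lp_def Y0)
  have "Y0 differentiable at y" using X0_diff[OF y, of 0] by (simp add: Y0)
  then have "(\<lambda>y. deriv L (Y0 y) * \<phi> y) differentiable at y"
    by (intro differentiable_mult \<phi>_diff[OF y] differentiable_compose_real[OF _ L''])
  then have e: "pd (Inl B) (\<lambda>x. Lp x * \<phi> (ypart x)) x = pd B (\<lambda>y. deriv L (Y0 y) * \<phi> y) y"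
    using ypart_differentiable(2)[of "\<lambda>y. deriv L (Y0 y) * \<phi> y" x B] by (simp add: x Lp)
  have "pd (Inl B) (\<lambda>x. Lp x * \<phi> (ypart x)) x + m * (pd B r y / r y) * (Lp x * \<phi> y) = 0"
    using eq by blast
  then show "pd B (\<lambda>y. deriv L (Y0 y) * \<phi> y) y + m * (pd B r y / r y) * (deriv L (Y0 y) * \<phi> y) = 0"
    unfolding e unfolding Lp x .
qed

end

section \<open>From the hypotheses of the theorem to the locales\<close>

lemma lorentzian2_det:
  assumes "lorentzian2 G"
  shows "G $ A $ B = G $ B $ A" "det2 G < 0"
proof -
  obtain P :: "real^2^2" where tr: "transpose G = G"
    and P: "transpose P ** G ** P = (\<chi> A B. if A \<noteq> B then 0 else if A = 0 then -1 else 1)"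
    using assms by (auto simp: lorentzian2_def)
  have "transpose G $ B $ A = G $ B $ A" using tr by simp
  then show "G $ A $ B = G $ B $ A" by (simp add: transpose_def)
  have "det (transpose P ** G ** P) = - 1"
    unfolding P by (simp add: det_2)
  then have "(det P)\<^sup>2 * det G = - 1"
    by (simp add: det_mul det_transpose power2_eq_square mult_ac)
  then have "det G < 0"
    by (smt (verit) mult_nonneg_nonneg zero_le_power2)
  moreover have "det G = det2 G"
    unfolding det_2 det2_def two_eq_zero by (simp add: mult.commute)
  ultimately show "det2 G < 0" by simp
qed

lemma C1_has_deriv:
  assumes "L C1_differentiable_on UNIV"
  shows "(L has_real_derivative deriv L x) (at x)"
proof -
  obtain D where "\<And>x. (L has_vector_derivative D x) (at x)"
    using assms by (auto simp: C1_differentiable_on_def)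
  then have "(L has_real_derivative D x) (at x)"
    by (simp add: has_real_derivative_iff_has_vector_derivative)
  then show ?thesis using DERIV_imp_deriv by fastforce
qed

lemma closed_formD:
  fixes \<omega> :: "'m::finite sphere_form"
  assumes "closed_two_form_on_sphere k \<omega>" and k: "k \<ge> 2" and s: "s \<in> {1, -1}"
  shows "\<And>p. p \<in> sphere 0 1 \<Longrightarrow> bilinear (\<omega> p)" "\<And>p u. p \<in> sphere 0 1 \<Longrightarrow> \<omega> p u u = 0"
    and "\<And>i j. Ck_nat 2 UNIV (\<lambda>z. sphere_form_comp \<omega> s z $ i $ j)"
    and "\<And>i j z. (\<lambda>z. sphere_form_comp \<omega> s z $ i $ j) differentiable at z"
    and "\<And>i j z. sphere_form_comp \<omega> s z $ i $ j = - sphere_form_comp \<omega> s z $ j $ i"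
    and "\<And>i j l z. pd i (\<lambda>z. sphere_form_comp \<omega> s z $ j $ l) z + pd j (\<lambda>z. sphere_form_comp \<omega> s z $ l $ i) z
      + pd l (\<lambda>z. sphere_form_comp \<omega> s z $ i $ j) z = 0"
proof -
  show bil: "\<And>p. p \<in> sphere 0 1 \<Longrightarrow> bilinear (\<omega> p)" and alt: "\<And>p u. p \<in> sphere 0 1 \<Longrightarrow> \<omega> p u u = 0"
    using assms(1) unfolding closed_two_form_on_sphere_def by blast+
  have ck: "Ck k UNIV (\<lambda>z. sphere_form_comp \<omega> s z $ i $ j)" for i j
    using assms(1) s unfolding closed_two_form_on_sphere_def by blast
  have "enat 2 \<le> k" using k by (simp add: numeral_eq_enat)
  then show c2: "\<And>i j. Ck_nat 2 UNIV (\<lambda>z. sphere_form_comp \<omega> s z $ i $ j)"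
    using ck unfolding Ck_def by blast
  show "\<And>i j z. (\<lambda>z. sphere_form_comp \<omega> s z $ i $ j) differentiable at z"
    using Ck_nat_Suc_D[OF open_UNIV _ UNIV_I] c2 unfolding numeral_2_eq_2 by blast
  show "pd i (\<lambda>z. sphere_form_comp \<omega> s z $ j $ l) z + pd j (\<lambda>z. sphere_form_comp \<omega> s z $ l $ i) z
      + pd l (\<lambda>z. sphere_form_comp \<omega> s z $ i $ j) z = 0" for i j l z
    using assms(1) s unfolding closed_two_form_on_sphere_def by blast
  show "sphere_form_comp \<omega> s z $ i $ j = - sphere_form_comp \<omega> s z $ j $ i" for i j z
  proof -
    note p = stereo_in_sphere[OF s, of z]
    have "\<omega> (stereo s z) u v = - \<omega> (stereo s z) v u" for u v
      using alt[OF p, of "u + v"] alt[OF p, of u] alt[OF p, of v]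
      by (simp add: bilinear_ladd[OF bil[OF p]] bilinear_radd[OF bil[OF p]])
    from this[of "pd i (stereo s) z" "pd j (stereo s) z"] show ?thesis by (simp add: sphere_form_comp_def)
  qed
qed

lemma configurationD:
  fixes \<omega> :: "'m::finite sphere_form"
  assumes c: "configuration k U g r a \<omega>" and k: "k \<ge> 2"
  shows "open U" "\<And>A B. Ck k U (\<lambda>y. g y $ A $ B)" "\<And>A B. Ck_nat 2 U (\<lambda>y. g y $ A $ B)"
    "\<And>y. y \<in> U \<Longrightarrow> lorentzian2 (g y)" "Ck (k + 1) U r" "Ck_nat 3 U r" "\<And>y. y \<in> U \<Longrightarrow> r y > 0"
    "\<And>A. Ck_nat 2 U (\<lambda>y. a y $ A)" "closed_two_form_on_sphere k \<omega>"
proof -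
  have e: "enat 2 \<le> k" "enat 3 \<le> k + 1" "enat 2 \<le> k + 1"
    using k by (cases k; simp add: one_enat_def numeral_eq_enat)+
  show "open U" "\<And>A B. Ck k U (\<lambda>y. g y $ A $ B)" "\<And>y. y \<in> U \<Longrightarrow> lorentzian2 (g y)" "Ck (k + 1) U r"
    "\<And>y. y \<in> U \<Longrightarrow> r y > 0" "closed_two_form_on_sphere k \<omega>"
    using c unfolding configuration_def by blast+
  show "\<And>A B. Ck_nat 2 U (\<lambda>y. g y $ A $ B)" "Ck_nat 3 U r" "\<And>A. Ck_nat 2 U (\<lambda>y. a y $ A)"
    using c e unfolding configuration_def Ck_def by blast+
qed

text \<open>The predicate \<open>prof\<close> is indexed by the angular norm \<open>N0\<close>, so
  one local argument covers both cases; they differ in how the angular form is determined.\<close>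

lemma local_form_of_solution:
  fixes \<omega> :: "'m::finite sphere_form"
  assumes conf: "configuration k U g r a \<omega>" and k: "k \<ge> 2" and nz: "\<And>y. y \<in> U \<Longrightarrow> grad_square g r y \<noteq> 0"
    and \<alpha>: "\<alpha> \<noteq> 0" and \<beta>: "\<beta> \<noteq> 0"
    and L: "L C1_differentiable_on UNIV" "deriv L C1_differentiable_on UNIV" and L0: "\<And>X. deriv L X \<noteq> 0"
    and sol: "solution \<alpha> \<beta> L U g r a \<omega>" and y0: "y0 \<in> U"
  defines "prof \<equiv> \<lambda>N0 W. \<exists>t Qe Ftr f l u. coordinates_on (k + 1) W t r \<and> r ` W = {l<..<u} \<and>
    radial_profile (CARD('m) + 2) \<alpha> \<beta> L {l<..<u} (\<lambda>x. \<alpha> * (- 2 * (Ftr x)\<^sup>2 + N0 / x ^ 4)) 0 Qe Ftr f \<and>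
    metric_has_form W g t r f \<and> faraday_has_form W a t r Ftr"
  shows "CARD('m) \<ge> 3 \<Longrightarrow> vanishes_on_sphere \<omega> \<and> (\<exists>W. y0 \<in> W \<and> W \<subseteq> U \<and> prof 0 W)"
    and "e1 \<noteq> e2 \<Longrightarrow> UNIV = {e1, e2 :: 'm} \<Longrightarrow>
      \<exists>q. is_monopole_form e1 e2 q \<omega> \<and> (\<exists>W. y0 \<in> W \<and> W \<subseteq> U \<and> prof (2 * q\<^sup>2) W)"
proof -
  note c = configurationD[OF conf k]
  \<comment> \<open>The positive root; it has the class of the metric because the determinant is
    negative throughout.\<close>
  define w where "w y = sqrt (- det2 (g y))" for y
  have wpos: "- det2 (g y) > 0" if "y \<in> U" for y
    using lorentzian2_det(2)[OF c(4)[OF that]] by simp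
  have wCk: "Ck k U w"
    unfolding Ck_def
  proof (intro allI impI)
    fix l assume "enat l \<le> k"
    then have "Ck_nat l U (\<lambda>y. g y $ A $ B)" for A B using c(2) by (simp add: Ck_def)
    then show "Ck_nat l U w"
      unfolding w_def[abs_def] using wpos
      by (intro Ck_nat_sqrt Ck_nat_minus c(1)) (auto simp: det2_def intro!: Ck_nat_diff Ck_nat_mult c(1))
  qed
  have "enat 1 \<le> k" using k by (cases k) (auto simp: one_enat_def numeral_eq_enat)
  then have w1: "Ck_nat 1 U w" using wCk unfolding Ck_def by blast
  have mat: "matter U g r s a \<omega> w (real CARD('m)) L (deriv (deriv L))" if s: "s \<in> {1, -1}" for s
  proof -
    note f = closed_formD[OF c(9) k s]
    show ?thesis
    proof (unfold_locales, goal_cases)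
      case (2 A B) show ?case by (rule c(3))
    next
      case (3 y A B) then show ?case using lorentzian2_det(1)[OF c(4)] by blast
    next
      case (4 y) then show ?case using wpos[of y] by simp
    next
      case (10 y) then show ?case using Ck_nat_Suc_D[OF c(1), of 0 w] w1 by simp
    next
      case (11 y) then show ?case using wpos[of y] by (simp add: w_def)
    qed (rule refl s c(1) c(6) c(7) c(8) f(4) f(5) C1_has_deriv[OF L(2)] | assumption)+
  qed
  have fe: "field_equations_at \<alpha> \<beta> L (spacetime_metric g r s) (faraday a \<omega> s) x" if "s \<in> {1, -1}" "ypart x \<in> U" for s x
    using sol that unfolding solution_def by blast
  interpret m1: matter U g r 1 a \<omega> w "real CARD('m)" \<alpha> \<beta> L "deriv (deriv L)"
    by (rule mat) simp
  have s1: "(1::real) \<in> {1, -1}" by simp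
  note f1 = closed_formD[OF c(9) k s1]
  note fe1 = fe[OF s1]
  have loc: "\<exists>W. y0 \<in> W \<and> W \<subseteq> U \<and> prof N0 W" if N: "\<And>z. m1.N z = N0" for N0
  proof -
    note E = m1.reduced_equations(1)[OF fe1 N] m1.reduced_equations(2)[OF fe1 N]
    have "\<exists>W t Qe Ftr f l u. y0 \<in> W \<and> W \<subseteq> U \<and> coordinates_on (k + 1) W t r \<and> r ` W = {l<..<u} \<and>
      radial_profile (CARD('m) + 2) \<alpha> \<beta> L {l<..<u} (\<lambda>x. \<alpha> * (- 2 * (Ftr x)\<^sup>2 + N0 / x ^ 4)) 0 Qe Ftr f \<and>
      metric_has_form W g t r f \<and> faraday_has_form W a t r Ftr"
      by (rule m1.local_form) (rule c(2) c(5) wCk k nz \<alpha> \<beta> L0 E y0 | assumption)+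
    then obtain W t Qe Ftr f l u where "y0 \<in> W" "W \<subseteq> U" "coordinates_on (k + 1) W t r \<and> r ` W = {l<..<u} \<and>
      radial_profile (CARD('m) + 2) \<alpha> \<beta> L {l<..<u} (\<lambda>x. \<alpha> * (- 2 * (Ftr x)\<^sup>2 + N0 / x ^ 4)) 0 Qe Ftr f \<and>
      metric_has_form W g t r f \<and> faraday_has_form W a t r Ftr"
      by (elim exE conjE) (rule that; (intro conjI)?; assumption)
    then show ?thesis unfolding prof_def by (intro exI[of _ W] conjI exI) (assumption | elim conjE)+
  qed
  show "vanishes_on_sphere \<omega> \<and> (\<exists>W. y0 \<in> W \<and> W \<subseteq> U \<and> prof 0 W)" if dim: "CARD('m) \<ge> 3"
  proof
    have "sphere_form_comp \<omega> s z $ i $ j = 0" if s: "s \<in> {1, -1}" for s z i j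
    proof -
      \<comment> \<open>Vanishing is established in each chart separately, as neither covers the
        sphere.\<close>
      interpret ms: matter U g r s a \<omega> w "real CARD('m)" \<alpha> \<beta> L "deriv (deriv L)"
        by (rule mat[OF s])
      note fs = closed_formD[OF c(9) k s]
      show ?thesis
        by (rule ms.form_vanishes(2)[OF fe[OF s] \<alpha> \<beta> L0 C1_has_deriv[OF L(1)] fs(3) fs(6) y0 dim])
    qed
    then show "vanishes_on_sphere \<omega>"
      by (intro iffD2[OF vanishes_on_sphere_iff[where \<omega>=\<omega>, OF f1(1)]]) (simp_all add: vec_eq_iff)
    show "\<exists>W. y0 \<in> W \<and> W \<subseteq> U \<and> prof 0 W"
      by (rule loc) (rule m1.form_vanishes(1)[OF fe1 \<alpha> \<beta> L0 C1_has_deriv[OF L(1)] f1(3) f1(6) y0 dim])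
  qed
  show "\<exists>q. is_monopole_form e1 e2 q \<omega> \<and> (\<exists>W. y0 \<in> W \<and> W \<subseteq> U \<and> prof (2 * q\<^sup>2) W)"
    if e: "e1 \<noteq> e2" "UNIV = {e1, e2 :: 'm}"
  proof -
    obtain q where q: "\<And>z. sphere_form_comp \<omega> 1 z $ e1 $ e2 = q * (conf_factor z)\<^sup>2" "\<And>z. m1.N z = 2 * q\<^sup>2"
      using m1.form_on_two_sphere[OF fe1 \<alpha> \<beta> L0 C1_has_deriv[OF L(1)] f1(3) f1(6) y0 e] by blast
    \<comment> \<open>In the chart with \<open>s = 1\<close> a monopole of charge \<open>Q\<close>
      has component \<open>- Q\<close> times the squared conformal factor, hence the sign.\<close>
    have "is_monopole_form e1 e2 (- q) \<omega>"
      by (rule is_monopole_formI[OF e f1(1,2)]) (simp_all add: q)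
    moreover have "\<exists>W. y0 \<in> W \<and> W \<subseteq> U \<and> prof (2 * (- q)\<^sup>2) W"
      using loc[OF q(2)] by simp
    ultimately show ?thesis by blast
  qed
qed

text \<open>Here the density is the Jacobian of the given coordinates, whose square is
  \<open>- det2 (g y)\<close> for the explicit metric and whose sign is not controlled.\<close>

lemma solution_of_local_form:
  fixes \<omega> :: "'m::finite sphere_form"
  assumes conf: "configuration k U g r a \<omega>" and k: "k \<ge> 2" and \<beta>: "\<beta> \<noteq> 0"
    and L: "L C1_differentiable_on UNIV" "deriv L C1_differentiable_on UNIV"
    and W: "W \<subseteq> U" and coords: "coordinates_on (k + 1) W t r"
    and profile: "radial_profile (CARD('m) + 2) \<alpha> \<beta> L (r ` W) (\<lambda>x. \<alpha> * (- 2 * (F x)\<^sup>2 + N0 / x ^ 4)) M0 Q F f"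
    and metric: "metric_has_form W g t r f" and far: "faraday_has_form W a t r F"
    and s: "s \<in> {1, -1}"
    and square: "\<And>z i j. (\<Sum>k\<in>UNIV. sphere_form_comp \<omega> s z $ i $ k * sphere_form_comp \<omega> s z $ j $ k)
      = \<delta> i j * (N0 * conf_factor z ^ 4 / real CARD('m))"
    and div: "\<And>z i. (\<Sum>j\<in>UNIV. pd j (\<lambda>z. sphere_form_comp \<omega> s z $ i $ j) z
      - (real CARD('m) - 4) * conf_factor z * (z $ j * sphere_form_comp \<omega> s z $ i $ j)) = 0"
    and x: "ypart x \<in> W"
  shows "field_equations_at \<alpha> \<beta> L (spacetime_metric g r s) (faraday a \<omega> s) x"
proof -
  note c = configurationD[OF conf k]
  note f = closed_formD[OF c(9) k s]
  have oW: "open W" using coords by (simp add: coordinates_on_def)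
  have jnz: "jac t r y \<noteq> 0" if "y \<in> W" for y
    using coords that by (simp add: coordinates_on_def jac_def)
  have "enat 2 \<le> k + 1" using k by (cases k) (auto simp: one_enat_def numeral_eq_enat)
  then have tr2: "Ck_nat 2 W t" "Ck_nat 2 W r"
    using coords unfolding coordinates_on_def Ck_def by blast+
  have det: "det2 (g y) = - (jac t r y)\<^sup>2" if "y \<in> W" for y
  proof -
    have f0: "f (r y) \<noteq> 0" and g: "g y $ A $ B = - f (r y) * pd A t y * pd B t y + inverse (f (r y)) * pd A r y * pd B r y" for A B
      using metric that by (simp_all add: metric_has_form_def)
    have "f (r y) * inverse (f (r y)) = 1" using f0 by simp
    then show ?thesis unfolding det2_def g jac_def power2_eq_square by algebra
  qed
  have jd: "jac t r differentiable at y" if "y \<in> W" for y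
  proof -
    have "pd A t differentiable at y" "pd A r differentiable at y" for A
      using Ck_nat_Suc_D[OF oW, of 0 "pd A t"] Ck_nat_Suc_D[OF oW, of 0 "pd A r"] tr2 that
      by (simp_all add: numeral_2_eq_2)
    then show ?thesis unfolding jac_def[abs_def] by (intro differentiable_diff differentiable_mult)
  qed
  have mat: "matter W g r s a \<omega> (jac t r) (real CARD('m)) L (deriv (deriv L))"
  proof (unfold_locales, goal_cases)
    case (2 A B) show ?case using Ck_nat_subset[OF c(3) W] .
  next
    case (3 y A B) then show ?case using lorentzian2_det(1)[OF c(4)] W by blast
  next
    case (4 y) then show ?case using det jnz by simp
  next
    case 5 show ?case using Ck_nat_subset[OF c(6) W] .
  next
    case (9 A) show ?case using Ck_nat_subset[OF c(8) W] .
  next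
    case (11 y) then show ?case using det by simp
  qed (rule refl s oW c(7)[OF subsetD[OF W]] jd f(4) f(5) C1_has_deriv[OF L(2)] | assumption)+
  interpret matter W g r s a \<omega> "jac t r" "real CARD('m)" \<alpha> \<beta> L "deriv (deriv L)"
    by (rule mat)
  have N: "N z = N0" for z
  proof -
    have "(\<Sum>i\<in>UNIV. \<Sum>j\<in>UNIV. (P z i j)\<^sup>2) = (\<Sum>i\<in>UNIV. \<Sum>j\<in>UNIV. P z i j * P z i j)"
      by (simp add: power2_eq_square)
    also have "\<dots> = N0 * conf_factor z ^ 4" unfolding square by simp
    finally show ?thesis using conf_factor_pos[of z] by (simp add: N_def)
  qed
  interpret explicit W g r s a \<omega> "jac t r" "real CARD('m)" \<alpha> \<beta> L "deriv (deriv L)" k t f F N0 M0 Q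
    by unfold_locales (fact coords k metric far refl profile N square div \<beta> C1_has_deriv[OF L(1)])+
  show ?thesis by (rule explicit_solution[OF x])
qed

text \<open>Supplies the hypotheses \<open>square\<close> and \<open>coclosed'\<close> of
  \<open>explicit\<close> for a constant multiple of the area form, with
  \<open>N0 = 2 * q\<^sup>2\<close>.\<close>

lemma monopole_components:
  fixes P :: "'m::finite \<Rightarrow> 'm \<Rightarrow> real^'m \<Rightarrow> real"
  assumes e: "e1 \<noteq> e2" "UNIV = {e1, e2}" and skew: "\<And>i j z. P i j z = - P j i z"
    and P: "\<And>z. P e1 e2 z = q * (conf_factor z)\<^sup>2"
  shows "(\<Sum>k\<in>UNIV. P i k z * P j k z) = \<delta> i j * (2 * q\<^sup>2 * conf_factor z ^ 4 / real CARD('m))"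
    and "(\<Sum>j\<in>UNIV. pd j (P i j) z - (real CARD('m) - 4) * conf_factor z * (z $ j * P i j z)) = 0"
proof -
  have "card (UNIV :: 'm set) = 2" unfolding e(2) using e(1) by simp
  then have m: "real CARD('m) = 2" by simp
  have diag: "P i i z = 0" for i z using skew[of i i z] by simp
  have P': "P e2 e1 z = - (q * (conf_factor z)\<^sup>2)" for z using skew[of e2 e1 z] P by simp
  have all: "i = e1 \<or> i = e2" for i using e(2) by auto
  have sum: "(\<Sum>i\<in>UNIV. u i) = u e1 + u e2" for u :: "'m \<Rightarrow> real" unfolding e(2) using e(1) by simp
  have sq: "q * (conf_factor z)\<^sup>2 * (q * (conf_factor z)\<^sup>2) = 2 * q\<^sup>2 * conf_factor z ^ 4 / 2"
    by (simp add: power2_eq_square power_numeral_reduce)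
  show "(\<Sum>k\<in>UNIV. P i k z * P j k z) = \<delta> i j * (2 * q\<^sup>2 * conf_factor z ^ 4 / real CARD('m))"
    unfolding m sum using all[of i] all[of j] e(1) sq by (auto simp: diag P P')
  have p: "pd j (\<lambda>z. q * (conf_factor z)\<^sup>2) z = - 2 * q * conf_factor z ^ 3 * z $ j" for j
    by (simp add: pd_cmult pd_power conf_factor_diff pd_conf_factor) (simp add: power3_eq_cube power2_eq_square)
  have pP: "pd j (P e1 e2) z = - 2 * q * conf_factor z ^ 3 * z $ j" "pd j (P e2 e1) z = 2 * q * conf_factor z ^ 3 * z $ j"
    "pd j (P i i) z = 0" for i j
  proof -
    show "pd j (P e1 e2) z = - 2 * q * conf_factor z ^ 3 * z $ j" using p[of j] P by presburger
    have "pd j (P e2 e1) z = pd j (\<lambda>z. - (q * (conf_factor z)\<^sup>2)) z"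
      by (rule pd_cong[OF open_UNIV]) (simp_all add: P')
    then show "pd j (P e2 e1) z = 2 * q * conf_factor z ^ 3 * z $ j"
      using p[of j] by (simp add: pd_minus conf_factor_diff differentiable_mult)
    show "pd j (P i i) z = 0"
      using pd_cong[OF open_UNIV, of z "P i i" "\<lambda>z. 0" j] diag by simp
  qed
  show "(\<Sum>j\<in>UNIV. pd j (P i j) z - (real CARD('m) - 4) * conf_factor z * (z $ j * P i j z)) = 0"
    unfolding m sum using all[of i]
    by (auto simp: diag P P' pP power3_eq_cube power2_eq_square)
qed

theorem proposition10:
  fixes n :: nat and k :: enat
    and \<alpha> \<beta> :: real and L :: "real \<Rightarrow> real"
    and U :: "(real^2) set" and g :: "2 tensor2" and r :: "real^2 \<Rightarrow> real"
    and a :: "real^2 \<Rightarrow> real^2" and \<omega> :: "'m::finite sphere_form"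
  assumes "n \<ge> 4" and "CARD('m) = n - 2"
    and "k \<ge> 2"
    and "\<alpha> \<noteq> 0" and "\<beta> \<noteq> 0"
    and "L C1_differentiable_on UNIV" and "deriv L C1_differentiable_on UNIV"
    and "\<not> L constant_on UNIV"
    and "\<not> (\<exists>X. deriv L X = 0)"
    and "configuration k U g r a \<omega>"
    and "\<forall>y\<in>U. grad_square g r y \<noteq> 0"
  shows "(n \<ge> 5 \<longrightarrow>
            (solution \<alpha> \<beta> L U g r a \<omega> \<longleftrightarrow>
               (\<forall>y\<in>U. \<exists>W. y \<in> W \<and> W \<subseteq> U \<and> electric_form k n \<alpha> \<beta> L W g r a \<omega>))) \<and>
         (n = 4 \<longrightarrow>
            (\<forall>e1 e2 :: 'm. e1 \<noteq> e2 \<longrightarrow>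
              (solution \<alpha> \<beta> L U g r a \<omega> \<longleftrightarrow>
                 (\<forall>y\<in>U. \<exists>W. y \<in> W \<and> W \<subseteq> U \<and> dyonic_form k e1 e2 \<alpha> \<beta> L W g r a \<omega>))))"
proof -
  note n = assms(1) and card = assms(2) and k = assms(3) and \<alpha> = assms(4) and \<beta> = assms(5)
    and L = assms(6,7) and conf = assms(10)
  have L0: "deriv L X \<noteq> 0" for X using assms(9) by blast
  have nz: "grad_square g r y \<noteq> 0" if "y \<in> U" for y using assms(11) that by blast
  have cn: "CARD('m) + 2 = n" using n card by simp
  note conf' = configurationD[OF conf k]
  have one: "(1::real) \<in> {1, -1}" by simp
  note form = closed_formD[OF conf'(9) k]
  show ?thesis
  proof (intro conjI impI allI iffI ballI)
    fix y assume n5: "n \<ge> 5" and sol: "solution \<alpha> \<beta> L U g r a \<omega>" and y: "y \<in> U"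
    have dim: "CARD('m) \<ge> 3" using n5 card by simp
    obtain W t Qe Ftr f l u where W: "y \<in> W" "W \<subseteq> U" "coordinates_on (k + 1) W t r" "r ` W = {l<..<u}"
      "radial_profile n \<alpha> \<beta> L {l<..<u} (\<lambda>x. \<alpha> * (- 2 * (Ftr x)\<^sup>2 + 0 / x ^ 4)) 0 Qe Ftr f"
      "metric_has_form W g t r f" "faraday_has_form W a t r Ftr"
      and van: "vanishes_on_sphere \<omega>"
      using local_form_of_solution(1)[OF conf k nz \<alpha> \<beta> L L0 sol y dim] unfolding cn by blast
    have "(\<lambda>x. \<alpha> * (- 2 * (Ftr x)\<^sup>2 + 0 / x ^ 4)) = (\<lambda>x. - 2 * \<alpha> * (Ftr x)\<^sup>2)" by auto
    then have prof: "radial_profile n \<alpha> \<beta> L {l<..<u} (\<lambda>x. - 2 * \<alpha> * (Ftr x)\<^sup>2) 0 Qe Ftr f"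
      using W(5) by simp
    have "electric_form k n \<alpha> \<beta> L W g r a \<omega>"
      unfolding electric_form_def by (intro exI conjI) (rule W(3) W(4) prof W(6) W(7) van)+
    then show "\<exists>W. y \<in> W \<and> W \<subseteq> U \<and> electric_form k n \<alpha> \<beta> L W g r a \<omega>"
      using W(1,2) by blast
  next
    assume n5: "n \<ge> 5" and loc: "\<forall>y\<in>U. \<exists>W. y \<in> W \<and> W \<subseteq> U \<and> electric_form k n \<alpha> \<beta> L W g r a \<omega>"
    show "solution \<alpha> \<beta> L U g r a \<omega>"
      unfolding solution_def
    proof (intro ballI allI impI)
      fix s :: real and x :: "real^(2 + 'm)" assume s: "s \<in> {1, -1}" and x: "ypart x \<in> U"
      obtain W where xW: "ypart x \<in> W" "W \<subseteq> U" and ef: "electric_form k n \<alpha> \<beta> L W g r a \<omega>"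
        using loc x by blast
      obtain t M Qe Ftr f l u where W: "coordinates_on (k + 1) W t r" "r ` W = {l<..<u}"
        "radial_profile n \<alpha> \<beta> L {l<..<u} (\<lambda>x. - 2 * \<alpha> * (Ftr x)\<^sup>2) M Qe Ftr f"
        "metric_has_form W g t r f" "faraday_has_form W a t r Ftr" and van: "vanishes_on_sphere \<omega>"
        using ef unfolding electric_form_def by (elim exE conjE) (rule that)
      have P0: "sphere_form_comp \<omega> s z $ i $ j = 0" for z i j
        using van vanishes_on_sphere_iff[where \<omega>=\<omega>, OF form(1)[OF one]] s by (metis zero_index)
      have "(\<lambda>x. - 2 * \<alpha> * (Ftr x)\<^sup>2) = (\<lambda>x. \<alpha> * (- 2 * (Ftr x)\<^sup>2 + 0 / x ^ 4))" by auto
      then have prof: "radial_profile (CARD('m) + 2) \<alpha> \<beta> L (r ` W) (\<lambda>x. \<alpha> * (- 2 * (Ftr x)\<^sup>2 + 0 / x ^ 4)) M Qe Ftr f"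
        using W(3) unfolding cn W(2) by simp
      show "field_equations_at \<alpha> \<beta> L (spacetime_metric g r s) (faraday a \<omega> s) x"
        by (rule solution_of_local_form[OF conf k \<beta> L xW(2) W(1) prof W(4,5) s _ _ xW(1)]) (simp_all add: P0)
    qed
  next
    fix e1 e2 :: 'm and y
    assume n4: "n = 4" and e: "e1 \<noteq> e2" and sol: "solution \<alpha> \<beta> L U g r a \<omega>" and y: "y \<in> U"
    have "card (UNIV :: 'm set) = 2" using n4 card by simp
    then have U2: "UNIV = {e1, e2}" using e card_2_iff'[of "UNIV :: 'm set"] by (auto; metis)
    obtain W t Qe Ftr f l u q where W: "y \<in> W" "W \<subseteq> U" "coordinates_on (k + 1) W t r" "r ` W = {l<..<u}"
      "radial_profile 4 \<alpha> \<beta> L {l<..<u} (\<lambda>x. \<alpha> * (- 2 * (Ftr x)\<^sup>2 + 2 * q\<^sup>2 / x ^ 4)) 0 Qe Ftr f"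
      "metric_has_form W g t r f" "faraday_has_form W a t r Ftr" and mono: "is_monopole_form e1 e2 q \<omega>"
      using local_form_of_solution(2)[OF conf k nz \<alpha> \<beta> L L0 sol y e U2] unfolding cn n4 by blast
    \<comment> \<open>The norm \<open>2 * q\<^sup>2\<close> becomes the magnetic term of the
      invariant once \<open>- 2 * \<alpha>\<close> is factored out.\<close>
    have "(\<lambda>x. \<alpha> * (- 2 * (Ftr x)\<^sup>2 + 2 * q\<^sup>2 / x ^ 4)) = (\<lambda>x. - 2 * \<alpha> * ((Ftr x)\<^sup>2 - q\<^sup>2 / x ^ 4))"
      by (auto simp: algebra_simps)
    then have prof: "radial_profile 4 \<alpha> \<beta> L {l<..<u} (\<lambda>x. - 2 * \<alpha> * ((Ftr x)\<^sup>2 - q\<^sup>2 / x ^ 4)) 0 Qe Ftr f"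
      using W(5) by simp
    have "dyonic_form k e1 e2 \<alpha> \<beta> L W g r a \<omega>"
      unfolding dyonic_form_def by (intro exI conjI) (rule W(3) W(4) prof W(6) W(7) mono)+
    then show "\<exists>W. y \<in> W \<and> W \<subseteq> U \<and> dyonic_form k e1 e2 \<alpha> \<beta> L W g r a \<omega>"
      using W(1,2) by blast
  next
    fix e1 e2 :: 'm
    assume n4: "n = 4" and e: "e1 \<noteq> e2"
      and loc: "\<forall>y\<in>U. \<exists>W. y \<in> W \<and> W \<subseteq> U \<and> dyonic_form k e1 e2 \<alpha> \<beta> L W g r a \<omega>"
    have "card (UNIV :: 'm set) = 2" using n4 card by simp
    then have U2: "UNIV = {e1, e2}" using e card_2_iff'[of "UNIV :: 'm set"] by (auto; metis)
    show "solution \<alpha> \<beta> L U g r a \<omega>"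
      unfolding solution_def
    proof (intro ballI allI impI)
      fix s :: real and x :: "real^(2 + 'm)" assume s: "s \<in> {1, -1}" and x: "ypart x \<in> U"
      obtain W where xW: "ypart x \<in> W" "W \<subseteq> U" and df: "dyonic_form k e1 e2 \<alpha> \<beta> L W g r a \<omega>"
        using loc x by blast
      obtain t M Qe Qm Ftr f l u where W: "coordinates_on (k + 1) W t r" "r ` W = {l<..<u}"
        "radial_profile 4 \<alpha> \<beta> L {l<..<u} (\<lambda>x. - 2 * \<alpha> * ((Ftr x)\<^sup>2 - Qm\<^sup>2 / x ^ 4)) M Qe Ftr f"
        "metric_has_form W g t r f" "faraday_has_form W a t r Ftr" and mono: "is_monopole_form e1 e2 Qm \<omega>"
        using df unfolding dyonic_form_def by (elim exE conjE) (rule that)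
      have "continuous_on UNIV (\<lambda>z. sphere_form_comp \<omega> s z $ e1 $ e2)"
        using Ck_nat_mono[OF form(3)[OF s], of 0] by simp
      then have P: "sphere_form_comp \<omega> s z $ e1 $ e2 = (- s * Qm) * (conf_factor z)\<^sup>2" for z
        using monopole_comp[OF e U2 form(1)[OF one] form(2)[OF one] _ s mono] by blast
      note comps = monopole_components[where P="\<lambda>i j z. sphere_form_comp \<omega> s z $ i $ j", OF e U2 form(5)[OF s] P]
      \<comment> \<open>The chart components of the form differ in sign, but the squared charge, and
        with it the profile, is the same in both charts.\<close>
      have ss: "(- s * Qm)\<^sup>2 = Qm\<^sup>2" using s by auto
      have "(\<lambda>x. - 2 * \<alpha> * ((Ftr x)\<^sup>2 - Qm\<^sup>2 / x ^ 4)) = (\<lambda>x. \<alpha> * (- 2 * (Ftr x)\<^sup>2 + 2 * Qm\<^sup>2 / x ^ 4))"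
        by (auto simp: algebra_simps)
      then have prof: "radial_profile (CARD('m) + 2) \<alpha> \<beta> L (r ` W) (\<lambda>x. \<alpha> * (- 2 * (Ftr x)\<^sup>2 + 2 * Qm\<^sup>2 / x ^ 4)) M Qe Ftr f"
        using W(3) unfolding cn n4 W(2) by simp
      show "field_equations_at \<alpha> \<beta> L (spacetime_metric g r s) (faraday a \<omega> s) x"
        by (rule solution_of_local_form[OF conf k \<beta> L xW(2) W(1) prof W(4,5) s comps(1)[unfolded ss] comps(2) xW(1)])
    qed
  qed
qed

end
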